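(* Let $a,b,c\in\mathbb{Z}^{+}$ with $\gcd(a,b,c)=1$. Then the form $$f(x,y,z):=aT_x+bT_y+cT_z$$ is asymptotically universal if and only if $$-bc\,R\,a',\quad -ac\,R\,b',\quad\text{and}\quad -ab\,R\,c'.$$
   Context: $\mathbb{N}=\{0,1,2,\ldots\}$ and $\mathbb{Z}^{+}=\{1,2,3,\ldots\}$. For $x\in\mathbb{Z}$, $T_x=x(x+1)/2$. For a form $f(x,y,z)$ as in the claim, with variables ranging over $\mathbb{Z}$, put $E(f)=\{n\in\mathbb{N}: f(x,y,z)=n \text{ has no solution } x,y,z\in\mathbb{Z}\}$. The form $f$ is asymptotically universal if $E(f)$ has asymptotic density zero, i.e. $\lim_{N\to\infty}\frac1N|\{1\le n\le N: n=f(x,y,z)\text{ for some }x,y,z\in\mathbb{Z}\}|=1$. For a positive integer $n$, $v_2(n)$ is the 2-adic order of $n$ and $n'=n/2^{v_2(n)}$ is the odd part of $n$. For $u\in\mathbb{Z}$ and $m\in\mathbb{Z}^+$, $u\,R\,m$ means that $\gcd(u,m)=1$ and the congruence $x^2\equiv u\pmod m$ is solvable in $\mathbb{Z}$. *)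

theory Defs
  imports Complex_Main "HOL-Number_Theory.Number_Theory"
begin

definition triangular :: "int \<Rightarrow> int" where
  "triangular x = x * (x + 1) div 2"

definition tri_form :: "int \<Rightarrow> int \<Rightarrow> int \<Rightarrow> int \<Rightarrow> int \<Rightarrow> int \<Rightarrow> int" where
  "tri_form a b c x y z = a * triangular x + b * triangular y + c * triangular z"

definition exceptional_set :: "(int \<Rightarrow> int \<Rightarrow> int \<Rightarrow> int) \<Rightarrow> nat set" where
  "exceptional_set f = {n. \<not> (\<exists>x y z. f x y z = int n)}"

(* The term at N = 0 is 0 / 0 = 0 and does not affect the limit. *)
definition has_asymptotic_density :: "nat set \<Rightarrow> real \<Rightarrow> bool" where
  "has_asymptotic_density A d \<longleftrightarrow>
     (\<lambda>N. real (card {n \<in> A. 1 \<le> n \<and> n \<le> N}) / real N) \<longlonglongrightarrow> d"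

definition asymptotically_universal :: "(int \<Rightarrow> int \<Rightarrow> int \<Rightarrow> int) \<Rightarrow> bool" where
  "asymptotically_universal f \<longleftrightarrow> has_asymptotic_density (exceptional_set f) 0"

definition odd_part :: "int \<Rightarrow> int" where
  "odd_part n = n div 2 ^ multiplicity 2 n"

(* u R m.  The argument order of QuadRes is (modulus, residue); it does not itself require
   coprimality.  For m = 1 the relation holds for every u. *)
definition quad_residue :: "int \<Rightarrow> int \<Rightarrow> bool" where
  "quad_residue u m \<longleftrightarrow> gcd u m = 1 \<and> QuadRes m u"

lemma two_times_triangular: "2 * triangular x = x * (x + 1)"
  by (simp add: triangular_def)

(* Equivalently, the represented positive integers have density one. *)
lemma asymptotically_universal_iff:
  "asymptotically_universal f \<longleftrightarrow>
     (\<lambda>N. real (card {n::nat. 1 \<le> n \<and> n \<le> N \<and> (\<exists>x y z. int n = f x y z)}) / real N)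
       \<longlonglongrightarrow> 1"
proof -
  define R where "R N = {n::nat. 1 \<le> n \<and> n \<le> N \<and> (\<exists>x y z. int n = f x y z)}" for N
  define X where "X N = {n \<in> exceptional_set f. 1 \<le> n \<and> n \<le> N}" for N
  have "card (X N) + card (R N) = N" for N
  proof -
    have "X N \<union> R N = {1..N}" "X N \<inter> R N = {}"
      unfolding X_def R_def exceptional_set_def by (auto; metis)+
    moreover from this have "finite (X N)" "finite (R N)"
      by (metis finite_Un finite_atLeastAtMost)+
    ultimately show ?thesis
      by (metis card_Un_disjoint card_atLeastAtMost diff_Suc_1 One_nat_def)
  qed
  then have sum: "real (card (X N)) + real (card (R N)) = real N" for N
    by (metis of_nat_add)
  have ev: "\<forall>\<^sub>F N in sequentially. real (card (X N)) / N = 1 - real (card (R N)) / N"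
    using eventually_gt_at_top[of 0]
  proof eventually_elim
    case (elim N)
    then show ?case using sum[of N] by (simp add: field_simps)
  qed
  have "asymptotically_universal f \<longleftrightarrow> (\<lambda>N. real (card (X N)) / N) \<longlonglongrightarrow> 0"
    by (simp add: asymptotically_universal_def has_asymptotic_density_def X_def)
  also have "\<dots> \<longleftrightarrow> (\<lambda>N. 1 - real (card (R N)) / N) \<longlonglongrightarrow> 0"
    by (rule tendsto_cong[OF ev])
  also have "\<dots> \<longleftrightarrow> (\<lambda>N. real (card (R N)) / N) \<longlonglongrightarrow> 1"
  proof
    assume "(\<lambda>N. 1 - real (card (R N)) / N) \<longlonglongrightarrow> 0"
    from tendsto_diff[OF tendsto_const[of 1] this]
    show "(\<lambda>N. real (card (R N)) / N) \<longlonglongrightarrow> 1" by simp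
  next
    assume "(\<lambda>N. real (card (R N)) / N) \<longlonglongrightarrow> 1"
    from tendsto_diff[OF tendsto_const[of 1] this]
    show "(\<lambda>N. 1 - real (card (R N)) / N) \<longlonglongrightarrow> 0" by simp
  qed
  finally show ?thesis by (simp add: R_def)
qed

end

theory Submission
  imports Defs "HOL-Real_Asymp.Real_Asymp" "HOL-Analysis.Convex"
begin

text \<open>
  Necessity is local: if an odd prime \<open>p\<close> divides two coefficients, or divides \<open>a\<close> while \<open>-bc\<close> is a nonresidue,
  then a whole residue class modulo \<open>p\<close> or \<open>p\<^sup>2\<close> is missed.

  For sufficiency fix \<open>K\<close>, let \<open>q\<close> be the product of the primes up to \<open>K\<close>, and treat each class of \<open>n\<close> modulo \<open>q\<close>
  separately, using only \<open>x, y, z\<close> in a fixed class modulo \<open>2q\<close> that gives a nonsingular solution at every prime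
  up to \<open>K\<close>. By Cauchy--Schwarz the number of values taken on a box is at least (size of the box)\<open>\<^sup>2\<close> divided by
  the number of pairs of points with equal value, so an upper bound for the latter suffices. A difference of two
  values of \<open>a T\<^sub>x\<close> factors; for a fixed difference \<open>u\<close> of the \<open>x\<close>-coordinates it runs through an arithmetic
  progression with modulus proportional to \<open>u\<close>. The remaining two variables are equidistributed modulo \<open>u\<close> up to
  the factor \<open>\<Sum> 1/d\<close> over the divisors \<open>d\<close> of \<open>u\<close> prime to \<open>q\<close>, whose average over \<open>u\<close> is at most \<open>1 + 1/K\<close>. Hence
  the proportion of missed values is \<open>O(1/K)\<close>, and \<open>K\<close> is arbitrary.
\<close>

section \<open>Linear congruences in a box\<close>

text \<open>Cauchy--Schwarz gives density one only if the collision count is sharp: a fixed constant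
  lost in it would leave mere positive density. This forces the shape of the box. The variable
  \<open>i\<close> runs over a tile [tL, (t+1)L) while \<open>j\<close> and \<open>k\<close> stay
  below a much smaller \<open>H\<close>. The slope of \<phi> on the tile then varies only by a
  factor of about 1 + 1/t, and the number of collisions is at most about H^4 / (2At). So about
  2AtL^2 values are taken among A(2t+1)L^2 candidates, and a tile loses a bounded multiple of AL^2,
  whatever t is. Over K tiles the loss is O(AKL^2) out of AK^2L^2. Thus \<open>K\<close> has two
  roles: it bounds the primes that are handled exactly, and it counts the tiles. Primes above
  \<open>K\<close> need no exact treatment because together they contribute at most a tail of the
  series of 1/d^2.\<close>

lemma int_div_less:
  fixes x g h :: int
  assumes "0 < h" "x < g * h"
  shows "x div h < g"
proof -
  have "x div h * h \<le> x" using assms(1) by (simp add: minus_mod_eq_div_mult [symmetric])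
  then have "x div h * h < g * h" using assms(2) by linarith
  then show ?thesis using assms(1) by simp
qed

text \<open>Two solutions differ by a multiple of \<open>h = v div g\<close>, so the quotient
  \<open>k div h\<close>, which takes only \<open>g\<close> values, separates them.\<close>

lemma card_linear_cong:
  fixes v w s :: int
  assumes v: "v > 0"
  shows "card {k \<in> {0..<v}. v dvd w * k - s} \<le> nat (gcd w v)"
proof (cases "{k \<in> {0..<v}. v dvd w * k - s} = {}")
  case True
  then show ?thesis by (simp only: card.empty)
next
  case False
  then obtain k0 where k0: "k0 \<in> {0..<v}" "v dvd w * k0 - s" by auto
  define g where "g = gcd w v"
  define h where "h = v div g"
  have g0: "g > 0" using v by (simp add: g_def gcd_pos_int)
  have vh: "v = h * g" by (simp add: h_def g_def)
  have h0: "h > 0" using vh v g0 by (simp add: zero_less_mult_iff)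
  define w' where "w' = w div g"
  have w': "w = w' * g" by (simp add: w'_def g_def)
  have cop: "coprime h w'"
    unfolding h_def w'_def g_def using v by (metis div_gcd_coprime coprime_commute less_irrefl)
  have key: "k mod h = k0 mod h" if "v dvd w * k - s" for k
  proof -
    have "v dvd (w * k - s) - (w * k0 - s)" using that k0(2) by (rule dvd_diff)
    then have "h * g dvd (w' * (k - k0)) * g" by (simp add: vh w' algebra_simps)
    then have "h dvd w' * (k - k0)" using g0 by simp
    then have "h dvd k - k0" using cop by (simp add: coprime_dvd_mult_right_iff)
    then show ?thesis by (simp add: mod_eq_dvd_iff)
  qed
  have "card {k \<in> {0..<v}. v dvd w * k - s} \<le> card {0..<g}"
  proof (rule card_inj_on_le[where f = "\<lambda>k. k div h"])
    show "inj_on (\<lambda>k. k div h) {k \<in> {0..<v}. v dvd w * k - s}"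
    proof (rule inj_onI)
      fix x y assume "x \<in> {k \<in> {0..<v}. v dvd w * k - s}" "y \<in> {k \<in> {0..<v}. v dvd w * k - s}"
        "x div h = y div h"
      then have "x div h = y div h" "x mod h = y mod h" using key by auto
      then show "x = y" by (metis div_mult_mod_eq)
    qed
    show "(\<lambda>k. k div h) ` {k \<in> {0..<v}. v dvd w * k - s} \<subseteq> {0..<g}"
      using h0 by (auto simp: vh pos_imp_zdiv_nonneg_iff mult.commute intro!: int_div_less)
  qed simp
  then show ?thesis by (simp add: g_def)
qed

lemma card_residue_class_le:
  fixes n g :: int
  assumes g: "g > 0" and n: "n \<ge> 0" and P: "\<And>k. P (k mod g) = P k"
  shows "card {k \<in> {0..<n * g}. P k} \<le> nat n * card {k \<in> {0..<g}. P k}"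
proof -
  have "card {k \<in> {0..<n * g}. P k} \<le> card ({0..<n} \<times> {k \<in> {0..<g}. P k})"
  proof (rule card_inj_on_le[where f = "\<lambda>k. (k div g, k mod g)"])
    show "inj_on (\<lambda>k. (k div g, k mod g)) {k \<in> {0..<n * g}. P k}"
      by (rule inj_onI) (metis div_mult_mod_eq prod.inject)
    show "(\<lambda>k. (k div g, k mod g)) ` {k \<in> {0..<n * g}. P k} \<subseteq> {0..<n} \<times> {k \<in> {0..<g}. P k}"
      using g P by (auto simp: pos_imp_zdiv_nonneg_iff intro!: int_div_less)
    show "finite ({0..<n} \<times> {k \<in> {0..<g}. P k})"
      by (rule finite_subset[of _ "{0..<n} \<times> {0..<g}"]) auto
  qed
  then show ?thesis by (simp add: card_cartesian_product)
qed

text \<open>For fixed \<open>k\<close> the congruence in \<open>j\<close> is solvable only if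
  \<open>g = gcd w v\<close> divides \<open>r * k - s\<close>, and it then has at most
  \<open>g\<close> solutions. The admissible \<open>k\<close> satisfy a congruence modulo
  \<open>g\<close>, which leaves at most (v/g) gcd(r, g) of them; the product is v gcd(w, r,
  v).\<close>

lemma card_linear_cong2:
  fixes v w r s :: int
  assumes v: "v > 0"
  shows "card {(j, k). j \<in> {0..<v} \<and> k \<in> {0..<v} \<and> v dvd w * j + r * k - s} \<le> nat (v * gcd (gcd w r) v)"
proof -
  define g where "g = gcd w v"
  have g0: "g > 0" using v by (simp add: g_def gcd_pos_int)
  define X where "X = {k \<in> {0..<v}. g dvd r * k - s}"
  have v': "v = (v div g) * g" by (simp add: g_def)
  have vg: "v div g > 0" using v' v g0 by (metis zero_less_mult_pos2)
  have "{(j, k). j \<in> {0..<v} \<and> k \<in> {0..<v} \<and> v dvd w * j + r * k - s}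
      \<subseteq> (\<lambda>(k, j). (j, k)) ` (SIGMA k:X. {j \<in> {0..<v}. v dvd w * j - (s - r * k)})" (is "?L \<subseteq> _ ` ?R")
  proof -
    have "k \<in> X" if "j \<in> {0..<v}" "k \<in> {0..<v}" "v dvd w * j + r * k - s" for j k
    proof -
      have "g dvd w * j + r * k - s" using that(3) by (auto simp: g_def intro: dvd_trans)
      moreover have "g dvd w * j" by (simp add: g_def)
      ultimately have "g dvd (w * j + r * k - s) - w * j" by (rule dvd_diff)
      then show ?thesis using that(2) by (simp add: X_def algebra_simps)
    qed
    then show ?thesis by (force simp: algebra_simps)
  qed
  note sub = this
  have fX: "finite X" by (rule finite_subset[of _ "{0..<v}"]) (auto simp: X_def)
  have fR: "finite ?R"
    by (rule finite_subset[of _ "X \<times> {0..<v}"]) (use fX in auto)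
  have "card ?L \<le> card ?R" using fR sub by (rule surj_card_le)
  also have "\<dots> = (\<Sum>k\<in>X. card {j \<in> {0..<v}. v dvd w * j - (s - r * k)})"
  proof (rule card_SigmaI)
    show "\<forall>k\<in>X. finite {j \<in> {0..<v}. v dvd w * j - (s - r * k)}"
      by (intro ballI finite_subset[of "{j \<in> {0..<v}. P j}" "{0..<v}" for P]) auto
  qed (rule fX)
  also have "\<dots> \<le> (\<Sum>k\<in>X. nat g)" unfolding g_def by (intro sum_mono card_linear_cong v)
  also have "\<dots> = card X * nat g" by simp
  also have "card X \<le> nat (v div g) * card {k \<in> {0..<g}. g dvd r * k - s}"
  proof -
    have "(g dvd r * (k mod g) - s) = (g dvd r * k - s)" for k
      by (metis mod_eq_dvd_iff mod_mult_right_eq mod_diff_left_eq dvd_eq_mod_eq_0)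
    from card_residue_class_le[where P = "\<lambda>k. g dvd r * k - s", OF g0 order.strict_implies_order[OF vg] this]
    show ?thesis unfolding X_def using v' by simp
  qed
  also have "card {k \<in> {0..<g}. g dvd r * k - s} \<le> nat (gcd r g)" by (rule card_linear_cong[OF g0])
  finally have "card ?L \<le> nat (v div g) * nat (gcd r g) * nat g" by simp
  also have "\<dots> = nat (v * gcd (gcd w r) v)"
  proof -
    have "gcd r g = gcd (gcd w r) v" by (simp add: g_def gcd.assoc gcd.left_commute)
    then have "nat (v div g) * nat (gcd r g) * nat g = nat ((v div g) * g * gcd (gcd w r) v)"
      using vg g0 by (simp add: nat_mult_distrib ac_simps)
    then show ?thesis using v' by simp
  qed
  finally show ?thesis .
qed

lemma card_multiples:
  fixes v d :: int
  assumes "d > 0" "d dvd v" "v > 0"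
  shows "card {w \<in> {0..<v}. d dvd w} \<le> nat (v div d)"
proof -
  have "card {w \<in> {0..<v}. d dvd w} \<le> card {0..<v div d}"
  proof (rule card_inj_on_le[where f = "\<lambda>w. w div d"])
    show "inj_on (\<lambda>w. w div d) {w \<in> {0..<v}. d dvd w}"
      by (rule inj_onI) (use assms in auto)
    show "(\<lambda>w. w div d) ` {w \<in> {0..<v}. d dvd w} \<subseteq> {0..<v div d}"
      using assms by (auto simp: pos_imp_zdiv_nonneg_iff intro!: int_div_less)
  qed simp
  then show ?thesis by simp
qed

text \<open>The term d = gcd alone gives the bound. The exact identity would weight d by Euler's
  totient; the cruder weight is affordable, since in the main count every d is 1 or exceeds
  \<open>K\<close>.\<close>

lemma gcd_le_sum_divisors:
  fixes x v :: int
  assumes "v > 0"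
  shows "real_of_int (gcd x v) \<le> (\<Sum>d | d > 0 \<and> d dvd v. if d dvd x then real_of_int d else 0)"
proof -
  have fin: "finite {d. d > 0 \<and> d dvd v}"
    by (rule finite_subset[of _ "{0..v}"]) (use assms in \<open>auto dest: zdvd_imp_le\<close>)
  have "gcd x v \<in> {d. d > 0 \<and> d dvd v}" using assms by (simp add: gcd_pos_int)
  from member_le_sum[OF this _ fin, of "\<lambda>d. if d dvd x then real_of_int d else 0"] show ?thesis by simp
qed

text \<open>Exchange the sums: (v/d)^2 pairs are divisible by d, and the weight d turns this into
  v^2/d.\<close>

lemma sum_gcd_le:
  fixes v :: int
  assumes v: "v > 0"
  shows "(\<Sum>w\<in>{0..<v}. \<Sum>r\<in>{0..<v}. real_of_int (gcd (gcd w r) v)) \<le> v ^ 2 * (\<Sum>d | d > 0 \<and> d dvd v. 1 / d)"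
proof -
  let ?D = "{d. d > 0 \<and> d dvd v}"
  have "(\<Sum>w\<in>{0..<v}. \<Sum>r\<in>{0..<v}. real_of_int (gcd (gcd w r) v)) \<le>
      (\<Sum>w\<in>{0..<v}. \<Sum>r\<in>{0..<v}. \<Sum>d\<in>?D. if d dvd gcd w r then real_of_int d else 0)"
    by (intro sum_mono gcd_le_sum_divisors v)
  also have "\<dots> = (\<Sum>w\<in>{0..<v}. \<Sum>d\<in>?D. \<Sum>r\<in>{0..<v}. if d dvd gcd w r then real_of_int d else 0)"
    by (intro sum.cong refl sum.swap)
  also have "\<dots> = (\<Sum>d\<in>?D. \<Sum>w\<in>{0..<v}. \<Sum>r\<in>{0..<v}. if d dvd gcd w r then real_of_int d else 0)"
    by (rule sum.swap)
  also have "\<dots> \<le> (\<Sum>d\<in>?D. v ^ 2 * (1 / d))"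
  proof (rule sum_mono)
    fix d assume d: "d \<in> ?D"
    define X where "X = {w \<in> {0..<v}. d dvd w}"
    have cX: "real (card X) \<le> v / d"
    proof -
      have "card X \<le> nat (v div d)" unfolding X_def using d v by (intro card_multiples) auto
      moreover have "v div d \<ge> 0" using d v by (simp add: pos_imp_zdiv_nonneg_iff)
      ultimately have "real (card X) \<le> real_of_int (v div d)" by linarith
      also have "\<dots> = v / d" using d by (simp add: real_of_int_div)
      finally show ?thesis .
    qed
    have "(\<Sum>w\<in>{0..<v}. \<Sum>r\<in>{0..<v}. if d dvd gcd w r then real_of_int d else 0)
       = (\<Sum>w\<in>{0..<v}. if d dvd w then (\<Sum>r\<in>{0..<v}. if d dvd r then real_of_int d else 0) else 0)"
      by (intro sum.cong refl) auto
    also have "\<dots> = (\<Sum>w\<in>X. \<Sum>r\<in>X. real_of_int d)"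
      unfolding X_def by (simp add: sum.inter_filter[symmetric])
    also have "\<dots> = real (card X) * real (card X) * d" by simp
    also have "\<dots> \<le> (v / d) * (v / d) * d"
      using cX d v by (intro mult_mono) auto
    also have "\<dots> = v ^ 2 * (1 / d)" using d by (simp add: field_simps power2_eq_square)
    finally show "(\<Sum>w\<in>{0..<v}. \<Sum>r\<in>{0..<v}. if d dvd gcd w r then real_of_int d else 0) \<le> v ^ 2 * (1 / d)" .
  qed
  finally show ?thesis by (simp add: sum_distrib_left)
qed

section \<open>Second differences of a sum of two quadratics modulo an integer\<close>

definition quad :: "int \<Rightarrow> int \<Rightarrow> int \<Rightarrow> int" where
  "quad A \<alpha> i = A * i ^ 2 + \<alpha> * i"

text \<open>The orientation is such that, for two points with equal value of the ternary form, this
  is \<phi>(i) - \<phi>(i').\<close>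

definition qdiff :: "int \<Rightarrow> int \<Rightarrow> int \<Rightarrow> int \<Rightarrow> int \<times> int \<times> int \<times> int \<Rightarrow> int" where
  "qdiff B \<beta> C \<gamma> = (\<lambda>(j, k, j', k'). quad B \<beta> j' + quad C \<gamma> k' - quad B \<beta> j - quad C \<gamma> k)"

definition box4 :: "int \<Rightarrow> (int \<times> int \<times> int \<times> int) set" where
  "box4 n = {0..<n} \<times> {0..<n} \<times> {0..<n} \<times> {0..<n}"

definition map4 :: "('a \<Rightarrow> 'b) \<Rightarrow> 'a \<times> 'a \<times> 'a \<times> 'a \<Rightarrow> 'b \<times> 'b \<times> 'b \<times> 'b" where
  "map4 f = (\<lambda>(j, k, j', k'). (f j, f k, f j', f k'))"

lemma finite_box4 [simp]: "finite (box4 n)"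
  by (simp add: box4_def)

lemma card_box4: "n \<ge> 0 \<Longrightarrow> card (box4 n) = nat n ^ 4"
  by (simp add: box4_def card_cartesian_product power4_eq_xxxx)

lemma quad_mod: "[quad A \<alpha> (i mod v) = quad A \<alpha> i] (mod v)"
  unfolding quad_def by (intro cong_add cong_mult cong_pow cong_refl) auto

lemma qdiff_mod: "[qdiff B \<beta> C \<gamma> (map4 (\<lambda>i. i mod v) z) = qdiff B \<beta> C \<gamma> z] (mod v)"
  by (cases z) (simp add: qdiff_def map4_def, intro cong_add cong_diff quad_mod)

lemma dvd_qdiff_mod:
  "v dvd qdiff B \<beta> C \<gamma> (map4 (\<lambda>i. i mod v) z) - \<rho> \<longleftrightarrow> v dvd qdiff B \<beta> C \<gamma> z - \<rho>"
  using qdiff_mod[of B \<beta> C \<gamma> v z] by (metis cong_iff_dvd_diff cong_trans cong_sym)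

text \<open>The quotients \<open>c\<close> name one cube of side \<open>v\<close>. Inside it a point
  is determined by its residues, so the count reduces to a full period.\<close>

lemma card_fibre_le:
  fixes v :: int
  assumes "v > 0" and P: "\<And>z. P (map4 (\<lambda>i. i mod v) z) = P z"
  shows "card {z \<in> X. map4 (\<lambda>i. i div v) z = c \<and> P z} \<le> card {z \<in> box4 v. P z}"
proof (rule card_inj_on_le[where f = "map4 (\<lambda>i. i mod v)"])
  show "inj_on (map4 (\<lambda>i. i mod v)) {z \<in> X. map4 (\<lambda>i. i div v) z = c \<and> P z}"
  proof (rule inj_onI)
    fix x y assume "x \<in> {z \<in> X. map4 (\<lambda>i. i div v) z = c \<and> P z}" "y \<in> {z \<in> X. map4 (\<lambda>i. i div v) z = c \<and> P z}"
      and m: "map4 (\<lambda>i. i mod v) x = map4 (\<lambda>i. i mod v) y"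
    then have "map4 (\<lambda>i. i div v) x = map4 (\<lambda>i. i div v) y" by simp
    with m show "x = y"
      by (cases x; cases y) (auto simp: map4_def, (metis div_mult_mod_eq)+)
  qed
  show "map4 (\<lambda>i. i mod v) ` {z \<in> X. map4 (\<lambda>i. i div v) z = c \<and> P z} \<subseteq> {z \<in> box4 v. P z}"
    using assms(1) P by (auto simp: map4_def box4_def split: prod.splits)
  show "finite {z \<in> box4 v. P z}" by simp
qed

lemma quad_diff: "quad A \<alpha> i' - quad A \<alpha> i = (i' - i) * (A * (i + i') + \<alpha>)"
  by (simp add: quad_def algebra_simps power2_eq_square)

lemma gcd_unit_multiples:
  fixes v :: int
  assumes "coprime x v" "coprime y v"
  shows "gcd (gcd (x * w) (y * r)) v = gcd (gcd w r) v"
proof -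
  have "gcd (x * w) v = gcd w v" "gcd (y * r) v = gcd r v"
    using assms by (simp_all add: gcd_mult_left_left_cancel coprime_commute)
  moreover have "gcd (gcd a b) v = gcd (gcd a v) (gcd b v)" for a b
    by (simp add: gcd.assoc gcd.commute gcd.left_commute)
  ultimately show ?thesis by metis
qed

text \<open>With w = j' - j and r = k' - k fixed modulo \<open>v\<close>, the quadratic condition
  becomes linear in \<open>(j, k)\<close> with coefficients \<open>2 * B * w\<close> and
  \<open>2 * C * r\<close>. As 2B and 2C are units, it has at most v gcd(w, r, v) solutions, and the
  gcd is averaged over \<open>w\<close> and \<open>r\<close>.\<close>

lemma card_qdiff_cong_coprime:
  fixes v :: int
  assumes v: "v > 0" and cop: "coprime (2 * B) v" "coprime (2 * C) v"
  shows "real (card {z \<in> box4 v. v dvd qdiff B \<beta> C \<gamma> z - \<rho>}) \<le> v ^ 3 * (\<Sum>d | d > 0 \<and> d dvd v. 1 / d)"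
proof -
  let ?S = "{z \<in> box4 v. v dvd qdiff B \<beta> C \<gamma> z - \<rho>}"
  define s where "s w r = \<rho> - (B * w ^ 2 + \<beta> * w + C * r ^ 2 + \<gamma> * r)" for w r
  define E where "E w r = {(j, k). j \<in> {0..<v} \<and> k \<in> {0..<v} \<and> v dvd (2 * B * w) * j + (2 * C * r) * k - s w r}" for w r
  have finE: "finite (E w r)" for w r
    by (rule finite_subset[of _ "{0..<v} \<times> {0..<v}"]) (auto simp: E_def)
  let ?T = "SIGMA w:{0..<v}. SIGMA r:{0..<v}. E w r"
  let ?f = "\<lambda>(j, k, j', k'). ((j' - j) mod v, (k' - k) mod v, j, k)"
  have "card ?S \<le> card ?T"
  proof (rule card_inj_on_le[where f = ?f])
    show "inj_on ?f ?S"
    proof (rule inj_onI)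
      fix x y assume x: "x \<in> ?S" and y: "y \<in> ?S" and f: "?f x = ?f y"
      obtain j k j' k' where x': "x = (j, k, j', k')" by (cases x)
      obtain l m l' m' where y': "y = (l, m, l', m')" by (cases y)
      have jl: "j = l" "k = m" using f by (simp_all add: x' y')
      have "(j' - j) mod v = (l' - j) mod v" "(k' - k) mod v = (m' - k) mod v"
        using f jl by (auto simp: x' y')
      then have "j' mod v = l' mod v" "k' mod v = m' mod v"
        by (simp_all add: mod_eq_dvd_iff)
      then show "x = y" using x y jl by (simp add: x' y' box4_def)
    qed
    show "?f ` ?S \<subseteq> ?T"
    proof
      fix t assume "t \<in> ?f ` ?S"
      then obtain j k j' k' where z: "(j, k, j', k') \<in> ?S"
        and t: "t = ((j' - j) mod v, (k' - k) mod v, j, k)" by auto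
      let ?w = "(j' - j) mod v" and ?r = "(k' - k) mod v"
      have D: "qdiff B \<beta> C \<gamma> (j, k, j', k')
          = (j' - j) * (B * (2 * j + (j' - j)) + \<beta>) + (k' - k) * (C * (2 * k + (k' - k)) + \<gamma>)"
        by (simp add: qdiff_def quad_def algebra_simps power2_eq_square)
      have "[?w * (B * (2 * j + ?w) + \<beta>) + ?r * (C * (2 * k + ?r) + \<gamma>)
          = qdiff B \<beta> C \<gamma> (j, k, j', k')] (mod v)"
        unfolding D by (intro cong_add cong_mult cong_refl) auto
      moreover have "[qdiff B \<beta> C \<gamma> (j, k, j', k') = \<rho>] (mod v)"
        using z by (simp add: cong_iff_dvd_diff)
      ultimately have "[?w * (B * (2 * j + ?w) + \<beta>) + ?r * (C * (2 * k + ?r) + \<gamma>) = \<rho>] (mod v)"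
        by (rule cong_trans)
      then have "v dvd ?w * (B * (2 * j + ?w) + \<beta>) + ?r * (C * (2 * k + ?r) + \<gamma>) - \<rho>"
        by (simp add: cong_iff_dvd_diff)
      also have "?w * (B * (2 * j + ?w) + \<beta>) + ?r * (C * (2 * k + ?r) + \<gamma>) - \<rho>
         = (2 * B * ?w) * j + (2 * C * ?r) * k - s ?w ?r"
        unfolding s_def by (simp add: power2_eq_square ring_distribs mult_ac)
      finally have "(j, k) \<in> E ?w ?r" using z by (simp add: E_def box4_def)
      then show "t \<in> ?T" using v by (simp add: t)
    qed
    show "finite ?T" using finE by (intro finite_SigmaI) auto
  qed
  also have "card ?T = (\<Sum>w\<in>{0..<v}. \<Sum>r\<in>{0..<v}. card (E w r))"
    using finE by (subst card_SigmaI) (auto intro!: finite_SigmaI sum.cong)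
  finally have "real (card ?S) \<le> (\<Sum>w\<in>{0..<v}. \<Sum>r\<in>{0..<v}. real (card (E w r)))"
    by (metis (mono_tags, lifting) of_nat_le_iff of_nat_sum sum.cong)
  also have "\<dots> \<le> (\<Sum>w\<in>{0..<v}. \<Sum>r\<in>{0..<v}. v * real_of_int (gcd (gcd w r) v))"
  proof (intro sum_mono)
    fix w r
    have "card (E w r) \<le> nat (v * gcd (gcd (2 * B * w) (2 * C * r)) v)"
      unfolding E_def by (rule card_linear_cong2[OF v])
    also have "gcd (gcd (2 * B * w) (2 * C * r)) v = gcd (gcd w r) v"
      using cop by (rule gcd_unit_multiples)
    finally have "card (E w r) \<le> nat (v * gcd (gcd w r) v)" .
    moreover have "v * gcd (gcd w r) v \<ge> 0" using v by simp
    ultimately have "real (card (E w r)) \<le> real_of_int (v * gcd (gcd w r) v)" by linarith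
    then show "real (card (E w r)) \<le> v * real_of_int (gcd (gcd w r) v)" by simp
  qed
  also have "\<dots> = v * (\<Sum>w\<in>{0..<v}. \<Sum>r\<in>{0..<v}. real_of_int (gcd (gcd w r) v))"
    by (simp add: sum_distrib_left)
  also have "\<dots> \<le> v * (v ^ 2 * (\<Sum>d | d > 0 \<and> d dvd v. 1 / d))"
    using v by (intro mult_left_mono sum_gcd_le) auto
  finally show ?thesis by (simp add: power3_eq_cube power2_eq_square mult.assoc)
qed


text \<open>Adding \<open>s v (1, f)\<close> to \<open>(j', k')\<close> for \<open>0 \<le> s < m\<close> moves the solution set modulo \<open>m v\<close> to \<open>m\<close> disjoint
  sets of solutions modulo \<open>v\<close>.\<close>
lemma card_qdiff_cong_shift:
  fixes m v :: int
  assumes m: "m > 0" and v: "v > 0" and cop: "coprime v m"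
    and unit: "\<And>x y. coprime (\<beta> + f * \<gamma> + B * x + C * y) m"
  shows "nat m * card {z \<in> box4 (m * v). m * v dvd qdiff B \<beta> C \<gamma> z - \<rho>}
      \<le> card {z \<in> box4 (m * v). v dvd qdiff B \<beta> C \<gamma> z - \<rho>}"
proof -
  define M where "M = m * v"
  have M: "M > 0" using m v by (simp add: M_def)
  let ?S = "{z \<in> box4 M. M dvd qdiff B \<beta> C \<gamma> z - \<rho>}"
  let ?T = "{z \<in> box4 M. v dvd qdiff B \<beta> C \<gamma> z - \<rho>}"
  define sh :: "int \<Rightarrow> int \<times> int \<times> int \<times> int \<Rightarrow> int \<times> int \<times> int \<times> int"
    where "sh = (\<lambda>s (j, k, j', k'). (j, k, j' + s * v, k' + f * (s * v)))"
  \<comment> \<open>The bracket is the derivative in direction (1, f) plus multiples of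
    \<open>B\<close> and \<open>C\<close>, so \<open>unit\<close> makes it invertible modulo
    \<open>m\<close>. This is what separates the shifted copies.\<close>
  have sh_diff: "qdiff B \<beta> C \<gamma> (sh s (j, k, j', k')) - qdiff B \<beta> C \<gamma> (j, k, j', k')
      = s * v * (\<beta> + f * \<gamma> + B * (2 * j' + s * v) + C * (f * (2 * k' + f * (s * v))))" for s j k j' k'
    by (simp add: sh_def qdiff_def quad_def power2_eq_square ring_distribs mult_ac)
  let ?f = "\<lambda>(s, z). map4 (\<lambda>i. i mod M) (sh s z)"
  have "card ({0..<m} \<times> ?S) \<le> card ?T"
  proof (rule card_inj_on_le[where f = ?f])
    show "?f ` ({0..<m} \<times> ?S) \<subseteq> ?T"
    proof (rule image_subsetI)
      fix x assume x: "x \<in> {0..<m} \<times> ?S"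
      obtain s j k j' k' where x': "x = (s, j, k, j', k')" by (cases x)
      have d: "M dvd qdiff B \<beta> C \<gamma> (j, k, j', k') - \<rho>" using x by (auto simp: x')
      have "v dvd M" by (simp add: M_def)
      then have "v dvd qdiff B \<beta> C \<gamma> (j, k, j', k') - \<rho>" using d by (rule dvd_trans)
      moreover have "v dvd qdiff B \<beta> C \<gamma> (sh s (j, k, j', k')) - qdiff B \<beta> C \<gamma> (j, k, j', k')"
        by (simp add: sh_diff)
      ultimately have "v dvd (qdiff B \<beta> C \<gamma> (sh s (j, k, j', k')) - qdiff B \<beta> C \<gamma> (j, k, j', k'))
          + (qdiff B \<beta> C \<gamma> (j, k, j', k') - \<rho>)" by (intro dvd_add)
      then have v1: "v dvd qdiff B \<beta> C \<gamma> (sh s (j, k, j', k')) - \<rho>" by simp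
      have "v dvd qdiff B \<beta> C \<gamma> (map4 (\<lambda>i. i mod M) (sh s (j, k, j', k'))) - qdiff B \<beta> C \<gamma> (sh s (j, k, j', k'))"
        using qdiff_mod[of B \<beta> C \<gamma> M "sh s (j, k, j', k')"] \<open>v dvd M\<close> unfolding cong_iff_dvd_diff by (blast intro: dvd_trans)
      then have "v dvd (qdiff B \<beta> C \<gamma> (map4 (\<lambda>i. i mod M) (sh s (j, k, j', k'))) - qdiff B \<beta> C \<gamma> (sh s (j, k, j', k')))
          + (qdiff B \<beta> C \<gamma> (sh s (j, k, j', k')) - \<rho>)" using v1 by (intro dvd_add)
      then have "v dvd qdiff B \<beta> C \<gamma> (map4 (\<lambda>i. i mod M) (sh s (j, k, j', k'))) - \<rho>" by simp
      moreover have "map4 (\<lambda>i. i mod M) (sh s (j, k, j', k')) \<in> box4 M"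
        using M by (simp add: map4_def sh_def box4_def)
      ultimately show "?f x \<in> ?T" by (simp add: x')
    qed
    show "inj_on ?f ({0..<m} \<times> ?S)"
    proof (rule inj_onI)
      fix x y assume x: "x \<in> {0..<m} \<times> ?S" and y: "y \<in> {0..<m} \<times> ?S" and f: "?f x = ?f y"
      obtain s j k j' k' where x': "x = (s, j, k, j', k')" by (cases x)
      obtain t l n l' n' where y': "y = (t, l, n, l', n')" by (cases y)
      have bx: "0 \<le> s" "s < m" "j \<in> {0..<M}" "k \<in> {0..<M}" "j' \<in> {0..<M}" "k' \<in> {0..<M}"
        using x by (auto simp: x' box4_def)
      have by': "0 \<le> t" "t < m" "l \<in> {0..<M}" "n \<in> {0..<M}" "l' \<in> {0..<M}" "n' \<in> {0..<M}"
        using y by (auto simp: y' box4_def)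
      have e: "j mod M = l mod M" "k mod M = n mod M"
        "[j' + s * v = l' + t * v] (mod M)" "[k' + f * (s * v) = n' + f * (t * v)] (mod M)"
        using f unfolding Cong.cong_def by (auto simp: x' y' map4_def sh_def)
      have jl: "j = l" "k = n" using e(1,2) bx by' by auto
      have e3: "[l' = j' + (s - t) * v] (mod M)" "[n' = k' + f * ((s - t) * v)] (mod M)"
      proof -
        have "l' - (j' + (s - t) * v) = - (j' + s * v - (l' + t * v))"
          "n' - (k' + f * ((s - t) * v)) = - (k' + f * (s * v) - (n' + f * (t * v)))"
          by (simp_all add: algebra_simps)
        then show "[l' = j' + (s - t) * v] (mod M)" "[n' = k' + f * ((s - t) * v)] (mod M)"
          using e(3,4) unfolding cong_iff_dvd_diff by (metis dvd_minus_iff)+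
      qed
      have "[qdiff B \<beta> C \<gamma> (j, k, l', n') = qdiff B \<beta> C \<gamma> (sh (s - t) (j, k, j', k'))] (mod M)"
        unfolding qdiff_def sh_def quad_def
        by (auto intro!: cong_add cong_diff cong_mult cong_pow e3)
      moreover have "[qdiff B \<beta> C \<gamma> (j, k, l', n') = \<rho>] (mod M)" "[qdiff B \<beta> C \<gamma> (j, k, j', k') = \<rho>] (mod M)"
        using x y jl by (auto simp: x' y' cong_iff_dvd_diff)
      ultimately have "[qdiff B \<beta> C \<gamma> (sh (s - t) (j, k, j', k')) = qdiff B \<beta> C \<gamma> (j, k, j', k')] (mod M)"
        by (meson cong_sym cong_trans)
      then have "M dvd (s - t) * v * (\<beta> + f * \<gamma> + B * (2 * j' + (s - t) * v) + C * (f * (2 * k' + f * ((s - t) * v))))"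
        unfolding cong_iff_dvd_diff sh_diff .
      then have "m dvd (s - t) * v * (\<beta> + f * \<gamma> + B * (2 * j' + (s - t) * v) + C * (f * (2 * k' + f * ((s - t) * v))))"
        unfolding M_def by (rule dvd_mult_left)
      then have "m dvd s - t"
        using unit cop by (metis coprime_commute coprime_dvd_mult_left_iff)
      then have "s mod m = t mod m" by (simp add: mod_eq_dvd_iff)
      then have st: "s = t" using bx(1,2) by'(1,2) by simp
      have "j' mod M = l' mod M" "k' mod M = n' mod M" using e3 st by (auto simp: Cong.cong_def)
      then have "j' = l'" "k' = n'" using bx by' by auto
      then show "x = y" using st jl by (simp add: x' y')
    qed
  qed simp
  then show ?thesis using m by (simp add: card_cartesian_product M_def)
qed

section \<open>The residue-class problem\<close>

text \<open>Strip off gcd(u, Q) repeatedly; \<open>u\<close> shrinks until it is coprime to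
  \<open>Q\<close>. The last clause expresses, without naming primes, that every prime factor of
  \<open>m\<close> divides \<open>Q\<close>.\<close>

lemma split_off_smooth_part:
  fixes u Q :: int
  assumes "u > 0"
  shows "\<exists>m v. u = m * v \<and> m > 0 \<and> v > 0 \<and> coprime v Q \<and> (\<forall>x. coprime x Q \<longrightarrow> coprime x m)"
  using assms
proof (induction "nat u" arbitrary: u rule: less_induct)
  case less
  show ?case
  proof (cases "coprime u Q")
    case True
    then show ?thesis using less.prems by (intro exI[of _ 1] exI[of _ u]) auto
  next
    case False
    define g where "g = gcd u Q"
    have g: "g > 1" using False less.prems unfolding g_def
      by (metis coprime_iff_gcd_eq_1 gcd_pos_int less_irrefl zless_imp_add1_zle zero_less_one_class.zero_less_one add_0 linorder_neqE_linordered_idom not_less)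
    obtain w where w: "u = g * w" unfolding g_def by (metis gcd_dvd1 dvd_def)
    have w0: "w > 0" using w less.prems g by (simp add: zero_less_mult_iff)
    have "w < u" using w g w0 by simp
    then have "nat w < nat u" using w0 by simp
    from less.hyps[OF this w0] obtain m v where mv: "w = m * v" "m > 0" "v > 0" "coprime v Q"
      "\<forall>x. coprime x Q \<longrightarrow> coprime x m" by blast
    have "coprime x (g * m)" if "coprime x Q" for x
    proof -
      have "g dvd Q" by (simp add: g_def)
      then have "coprime x g" using that by (rule coprime_divisors[OF dvd_refl])
      then show ?thesis using mv(5) that by simp
    qed
    then show ?thesis using mv w g by (intro exI[of _ "g * m"] exI[of _ v]) auto
  qed
qed

text \<open>For positive \<open>u\<close> this is \<sigma>(v)/v, where v is the largest divisor of
  \<open>u\<close> coprime to \<open>Q\<close>.\<close>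

definition coprime_divisor_sum :: "int \<Rightarrow> int \<Rightarrow> real" where
  "coprime_divisor_sum Q u = (\<Sum>d | d > 0 \<and> d dvd u \<and> coprime d Q. 1 / d)"

lemma card_le_blocks:
  fixes m v :: int
  assumes m: "m > 0" and v: "v > 0" and P: "\<And>z. P (map4 (\<lambda>i. i mod v) z) = P z"
  shows "card {z \<in> box4 (m * v). P z} \<le> nat m ^ 4 * card {z \<in> box4 v. P z}"
proof -
  let ?dv = "map4 (\<lambda>i. i div v)"
  let ?S = "\<lambda>c. {z \<in> box4 (m * v). ?dv z = c \<and> P z}"
  have "{z \<in> box4 (m * v). P z} \<subseteq> (\<Union>c\<in>box4 m. ?S c)"
    using v by (auto simp: box4_def map4_def pos_imp_zdiv_nonneg_iff intro!: int_div_less)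
  then have "card {z \<in> box4 (m * v). P z} \<le> card (\<Union>c\<in>box4 m. ?S c)"
    by (intro card_mono) auto
  also have "\<dots> \<le> (\<Sum>c\<in>box4 m. card (?S c))" by (intro card_UN_le) simp
  also have "\<dots> \<le> (\<Sum>c\<in>box4 m. card {z \<in> box4 v. P z})"
    by (intro sum_mono card_fibre_le v P)
  also have "\<dots> = nat m ^ 4 * card {z \<in> box4 v. P z}" using m by (simp add: card_box4)
  finally show ?thesis .
qed

text \<open>A cube of side \<open>M\<close> holds at most \<open>N\<close> points of
  \<open>S\<close>, and by \<open>sub\<close> every cube that meets \<open>S\<close> lies entirely
  in \<open>T\<close>, where it takes up \<open>M ^ 4\<close> points. The enlargement from
  \<open>S\<close> to \<open>T\<close> pays for the cubes at the boundary.\<close>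

lemma card_mult_cube_le:
  fixes M :: int
  assumes M: "M > 0" and "finite S" "finite T"
    and fib: "\<And>c. real (card {z \<in> S. map4 (\<lambda>i. i div M) z = c}) \<le> N"
    and sub: "\<And>z z'. z \<in> S \<Longrightarrow> map4 (\<lambda>i. i div M) z' = map4 (\<lambda>i. i div M) z \<Longrightarrow> z' \<in> T"
  shows "real (card S) * M ^ 4 \<le> N * real (card T)"
proof -
  let ?dv = "map4 (\<lambda>i. i div M)"
  \<comment> \<open>Any index serves here: a fibre count is nonnegative.\<close>
  have N: "N \<ge> 0" using fib[of undefined] by (meson of_nat_0_le_iff order_trans)
  have "S = (\<Union>c\<in>?dv ` S. {z \<in> S. ?dv z = c})" by auto
  then have "card S = card (\<Union>c\<in>?dv ` S. {z \<in> S. ?dv z = c})" by (rule arg_cong)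
  also have "\<dots> \<le> (\<Sum>c\<in>?dv ` S. card {z \<in> S. ?dv z = c})"
    using assms(2) by (intro card_UN_le) simp
  finally have "card S \<le> (\<Sum>c\<in>?dv ` S. card {z \<in> S. ?dv z = c})" .
  then have "real (card S) \<le> (\<Sum>c\<in>?dv ` S. real (card {z \<in> S. ?dv z = c}))"
    by (simp only: of_nat_le_iff flip: of_nat_sum)
  also have "\<dots> \<le> (\<Sum>c\<in>?dv ` S. N)" by (intro sum_mono fib)
  finally have 1: "real (card S) \<le> N * real (card (?dv ` S))" by (simp add: mult.commute)
  let ?g = "\<lambda>((a, b, c, d), (e, f, g, h)). (a * M + e, b * M + f, c * M + g, d * M + h)"
  have "card (?dv ` S \<times> box4 M) \<le> card T"
  proof (rule card_inj_on_le[where f = ?g])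
    have dm: "a = a' \<and> e = e'" if "a * M + e = a' * M + e'" "0 \<le> e" "e < M" "0 \<le> e'" "e' < M" for a e a' e'
    proof -
      have q: "(a * M + e) div M = a" if "0 \<le> e" "e < M" for a e using that M by simp
      have "a = a'" using q[of e a] q[of e' a'] that by simp
      then show ?thesis using that(1) by simp
    qed
    show "inj_on ?g (?dv ` S \<times> box4 M)"
    proof (rule inj_onI)
      fix x y assume x: "x \<in> ?dv ` S \<times> box4 M" and y: "y \<in> ?dv ` S \<times> box4 M" and eq: "?g x = ?g y"
      obtain a b c d e f g h where x': "x = ((a, b, c, d), (e, f, g, h))" by (metis prod.collapse)
      obtain a' b' c' d' e' f' g' h' where y': "y = ((a', b', c', d'), (e', f', g', h'))" by (metis prod.collapse)
      have bx: "{e, f, g, h, e', f', g', h'} \<subseteq> {0..<M}" using x y by (simp add: x' y' box4_def)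
      have "a = a' \<and> e = e'" "b = b' \<and> f = f'" "c = c' \<and> g = g'" "d = d' \<and> h = h'"
        by (rule dm; use eq bx in \<open>simp add: x' y'\<close>)+
      then show "x = y" by (simp add: x' y')
    qed
    show "?g ` (?dv ` S \<times> box4 M) \<subseteq> T"
    proof (rule image_subsetI)
      fix x assume x: "x \<in> ?dv ` S \<times> box4 M"
      then obtain z e f g h where z: "z \<in> S" "x = (?dv z, (e, f, g, h))" "(e, f, g, h) \<in> box4 M" by auto
      have "?dv (?g x) = ?dv z"
        using z M by (cases z) (simp add: map4_def box4_def)
      then show "?g x \<in> T" using sub z(1) by blast
    qed
  qed (rule assms(3))
  then have "real (card (?dv ` S) * nat M ^ 4) \<le> real (card T)"
    using M by (simp only: of_nat_le_iff card_cartesian_product card_box4 less_imp_le)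
  then have "real (card (?dv ` S)) * M ^ 4 \<le> real (card T)" using M by simp
  then have "N * (real (card (?dv ` S)) * M ^ 4) \<le> N * real (card T)" using N by (rule mult_left_mono)
  moreover have "real (card S) * M ^ 4 \<le> N * real (card (?dv ` S)) * M ^ 4"
    using 1 M by (intro mult_right_mono) auto
  ultimately show ?thesis by (simp add: mult.assoc)
qed

text \<open>The locale describes \<open>m = \<phi>(i) + \<psi>(j) + \<chi>(k)\<close> with \<open>\<phi>(i) = A i\<^sup>2 + \<alpha> i\<close> etc. It arises from
  \<open>n = a T\<^sub>x + b T\<^sub>y + c T\<^sub>z\<close> by restricting \<open>x, y, z\<close> to residue classes modulo \<open>Q = 2 q\<close>, where \<open>q\<close> is the
  product of the primes up to \<open>K\<close>: then \<open>A = Q a\<close> and \<open>\<alpha> = a (2 x\<^sub>0 + 1)\<close>. The hypothesis \<open>unit\<close> says that the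
  chosen class is nonsingular in \<open>y\<close> or \<open>z\<close> at every prime up to \<open>K\<close>; it makes these primes invisible in
  all counts.\<close>
locale ternary =
  fixes A B C \<alpha> \<beta> \<gamma> Q f K :: int
  assumes pos: "A > 0" "B > 0" "C > 0" "\<alpha> > 0" "\<beta> > 0" "\<gamma> > 0" "Q > 0" "K \<ge> 1"
    and Q_dvd: "Q dvd B" "Q dvd C"
    and cop: "\<And>x. coprime x Q \<Longrightarrow> coprime x (2 * A * B * C)"
    and unit: "coprime (\<beta> + f * \<gamma>) Q"
    and rough: "\<And>d. d > 1 \<Longrightarrow> coprime d Q \<Longrightarrow> d > K"
begin

abbreviation \<Delta> :: "int \<times> int \<times> int \<times> int \<Rightarrow> int" where
  "\<Delta> \<equiv> qdiff B \<beta> C \<gamma>"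

text \<open>The modulus comes from \<phi>(i + u) - \<phi>(i) = 2Aui + (Au^2 + \<alpha>u). It splits
  as \<open>n * v\<close>, where the primes of \<open>n\<close> divide \<open>Q\<close>. The shift
  argument gives \<open>n\<close> just the expected factor 1/n, and the coprime part
  \<open>v\<close> contributes the divisor sum.\<close>

lemma card_\<Delta>_cong:
  assumes u: "u > 0"
  shows "real (card {z \<in> box4 (2 * A * u). 2 * A * u dvd \<Delta> z - \<rho>}) \<le> (2 * A * u) ^ 3 * coprime_divisor_sum Q u"
proof -
  obtain m v where mv: "u = m * v" "m > 0" "v > 0" "coprime v Q"
    and m: "\<And>x. coprime x Q \<Longrightarrow> coprime x m" using split_off_smooth_part[OF u] by metis
  define n where "n = 2 * A * m"
  have n0: "n > 0" using pos mv by (simp add: n_def)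
  have nv: "2 * A * u = n * v" by (simp add: n_def mv)
  have n: "coprime x n" if "coprime x Q" for x
    using cop[OF that] m[OF that] by (simp add: n_def)
  have un: "coprime (\<beta> + f * \<gamma> + B * x + C * y) n" for x y
  proof (rule n)
    obtain b c where "B = Q * b" "C = Q * c" using Q_dvd by (auto elim!: dvdE)
    then have e: "\<beta> + f * \<gamma> + B * x + C * y = \<beta> + f * \<gamma> + (b * x + c * y) * Q" by (simp add: algebra_simps)
    show "coprime (\<beta> + f * \<gamma> + B * x + C * y) Q"
      using unit unfolding e coprime_iff_gcd_eq_1
      by (metis gcd.commute gcd_add_mult add.commute)
  qed
  let ?D = "(\<Sum>d | d > 0 \<and> d dvd v. 1 / real_of_int d)"
  have D: "?D \<le> coprime_divisor_sum Q u" unfolding coprime_divisor_sum_def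
  proof (rule sum_mono2)
    show "finite {d. 0 < d \<and> d dvd u \<and> coprime d Q}"
      by (rule finite_subset[of _ "{0..u}"]) (use u in \<open>auto dest: zdvd_imp_le\<close>)
    show "{d. 0 < d \<and> d dvd v} \<subseteq> {d. 0 < d \<and> d dvd u \<and> coprime d Q}"
      using mv(1) coprime_divisors[OF _ dvd_refl mv(4)] by (auto intro: dvd_mult)
  qed auto
  have copv: "coprime (2 * B) v" "coprime (2 * C) v"
    using cop[OF mv(4)] by (auto simp: coprime_commute)
  have "nat n * card {z \<in> box4 (n * v). n * v dvd \<Delta> z - \<rho>} \<le> card {z \<in> box4 (n * v). v dvd \<Delta> z - \<rho>}"
    by (rule card_qdiff_cong_shift[where f = f]) (use n0 mv n un in auto)
  also have "\<dots> \<le> nat n ^ 4 * card {z \<in> box4 v. v dvd \<Delta> z - \<rho>}"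
    by (intro card_le_blocks n0 mv(3)) (rule dvd_qdiff_mod)
  finally have "real (nat n * card {z \<in> box4 (n * v). n * v dvd \<Delta> z - \<rho>})
      \<le> real (nat n ^ 4 * card {z \<in> box4 v. v dvd \<Delta> z - \<rho>})" by (simp only: of_nat_le_iff)
  then have "n * real (card {z \<in> box4 (n * v). n * v dvd \<Delta> z - \<rho>})
      \<le> n ^ 4 * real (card {z \<in> box4 v. v dvd \<Delta> z - \<rho>})" using n0 by simp
  also have "\<dots> \<le> n ^ 4 * (v ^ 3 * ?D)"
    using n0 by (intro mult_left_mono card_qdiff_cong_coprime mv copv) auto
  also have "\<dots> \<le> n ^ 4 * (v ^ 3 * coprime_divisor_sum Q u)"
    using n0 mv D by (intro mult_left_mono) auto
  also have "\<dots> = n * ((n * v) ^ 3 * coprime_divisor_sum Q u)" by (simp add: power_mult_distrib power4_eq_xxxx power3_eq_cube mult_ac)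
  finally show ?thesis using n0 unfolding nv by (subst (asm) mult_le_cancel_left_pos) auto
qed

end

section \<open>Elementary inequalities: quadratics, integer intervals, harmonic sums\<close>

lemma quad_bounds:
  assumes "a > 0" "b > 0" "0 \<le> i" "i < H"
  shows "0 \<le> quad a b i \<and> quad a b i \<le> (a + b) * H ^ 2"
proof -
  have "i ^ 2 \<le> H ^ 2" using assms by (intro power_mono) auto
  moreover have "i * 1 \<le> H * H" using assms by (intro mult_mono) auto
  ultimately have "a * i ^ 2 \<le> a * H ^ 2 \<and> b * i \<le> b * H ^ 2"
    using assms by (intro conjI mult_left_mono) (auto simp: power2_eq_square)
  moreover have "0 \<le> a * i ^ 2" "0 \<le> b * i" using assms by simp_all
  ultimately show ?thesis unfolding quad_def distrib_right by linarith
qed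

lemma abs_quad_diff_le:
  assumes "A > 0" "\<alpha> > 0" "0 \<le> i" "i < n" "0 \<le> i'" "i' < n" "\<bar>i' - i\<bar> \<le> M"
  shows "\<bar>quad A \<alpha> i' - quad A \<alpha> i\<bar> \<le> M * (2 * A * n + \<alpha>)"
proof -
  have "A * (i + i') \<le> A * (2 * n)" using assms by (intro mult_left_mono) auto
  moreover have "0 \<le> A * (i + i')" using assms by simp
  ultimately have "\<bar>A * (i + i') + \<alpha>\<bar> \<le> 2 * A * n + \<alpha>" using assms by simp
  then have "\<bar>i' - i\<bar> * \<bar>A * (i + i') + \<alpha>\<bar> \<le> M * (2 * A * n + \<alpha>)"
    using assms(7) by (intro mult_mono) auto
  then show ?thesis by (simp add: quad_diff abs_mult)
qed

text \<open>Used as a spacing property: values at distance at most T come from indices at distance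
  at most sqrt T.\<close>

lemma quad_diff_ge_square:
  assumes "A > 0" "\<alpha> > 0" "0 \<le> i" "i \<le> i'"
  shows "(i' - i) ^ 2 \<le> quad A \<alpha> i' - quad A \<alpha> i"
proof -
  have "1 * (i + i') \<le> A * (i + i')" using assms by (intro mult_right_mono) auto
  then have "i' - i \<le> A * (i + i') + \<alpha>" using assms by simp
  then have "(i' - i) * (i' - i) \<le> (i' - i) * (A * (i + i') + \<alpha>)" using assms by (intro mult_left_mono) auto
  then show ?thesis by (simp add: quad_diff power2_eq_square)
qed

text \<open>If a > b the set is empty, and the first hypothesis keeps the bound nonnegative in that
  case.\<close>

lemma card_int_interval_le:
  fixes a b :: real
  assumes "a \<le> b + 1" "\<And>w. w \<in> W \<Longrightarrow> a \<le> real_of_int w \<and> real_of_int w \<le> b"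
  shows "real (card W) \<le> b - a + 1"
proof -
  have "W \<subseteq> {\<lceil>a\<rceil>..\<lfloor>b\<rfloor>}" using assms(2) by (auto simp: ceiling_le_iff le_floor_iff)
  then have "card W \<le> card {\<lceil>a\<rceil>..\<lfloor>b\<rfloor>}" by (intro card_mono) auto
  then have "card W \<le> nat (\<lfloor>b\<rfloor> - \<lceil>a\<rceil> + 1)" by (simp add: algebra_simps)
  moreover have "real (nat (\<lfloor>b\<rfloor> - \<lceil>a\<rceil> + 1)) \<le> b - a + 1"
    using assms(1) by (cases "\<lfloor>b\<rfloor> - \<lceil>a\<rceil> + 1 \<ge> 0") (simp_all, linarith)
  ultimately show ?thesis by linarith
qed

text \<open>A logarithm would be sharper, but the square root has the scaling that makes the error
  in \<open>sum_coprime_divisor_sum_over_le\<close> a multiple of sqrt(P1 / D), which is easy to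
  average over a box.\<close>

lemma sum_inverse_le_sqrt: "(\<Sum>d=1..n. 1 / real d) \<le> 2 * sqrt n"
proof (induction n)
  case (Suc n)
  have "1 / real (Suc n) \<le> 2 * sqrt (Suc n) - 2 * sqrt n"
  proof -
    let ?a = "sqrt (Suc n)" and ?b = "sqrt n"
    have a: "?a \<ge> 1" "?b \<le> ?a" "?b \<ge> 0" by auto
    have "(?a - ?b) * (?a + ?b) = 1" by (simp add: algebra_simps)
    then have "?a - ?b = 1 / (?a + ?b)" using a by (intro eq_divide_imp) auto
    moreover have "1 / (2 * ?a) \<le> 1 / (?a + ?b)" using a by (intro divide_left_mono mult_pos_pos add_pos_nonneg) auto
    moreover have "1 / real (Suc n) \<le> 1 / ?a"
    proof -
      have "?a * 1 \<le> ?a * ?a" using a by (intro mult_left_mono) auto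
      then show ?thesis using a by (intro divide_left_mono) auto
    qed
    ultimately show ?thesis by simp
  qed
  then show ?case using Suc by simp
qed simp

lemma sum_inverse_int_le_sqrt:
  assumes "N \<ge> 0"
  shows "(\<Sum>d\<in>{1..N}. 1 / real_of_int d) \<le> 2 * sqrt N"
proof -
  have "(\<Sum>d\<in>{1..N}. 1 / real_of_int d) = (\<Sum>d=1..nat N. 1 / real d)"
    by (rule sum.reindex_bij_witness[of _ int nat]) (use assms in auto)
  then show ?thesis using sum_inverse_le_sqrt[of "nat N"] assms by simp
qed

text \<open>Telescoping: 1/d^2 is at most 1/(d - 1) - 1/d.\<close>

lemma sum_inverse_square_tail:
  fixes K :: int
  assumes "K \<ge> 1"
  shows "(\<Sum>d\<in>{K<..N}. 1 / real_of_int d ^ 2) \<le> 1 / K"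
proof (cases "N \<ge> K")
  case True
  have "(\<Sum>d\<in>{K<..N}. 1 / real_of_int d ^ 2) \<le> 1 / K - 1 / N"
    using True
  proof (induction N rule: int_ge_induct)
    case (step N)
    have "{K<..N + 1} = insert (N + 1) {K<..N}" using step by auto
    then have "(\<Sum>d\<in>{K<..N + 1}. 1 / real_of_int d ^ 2) = 1 / real_of_int (N + 1) ^ 2 + (\<Sum>d\<in>{K<..N}. 1 / real_of_int d ^ 2)"
      by simp
    moreover have "1 / real_of_int (N + 1) ^ 2 \<le> 1 / N - 1 / real_of_int (N + 1)"
    proof -
      have N: "real_of_int N \<ge> 1" using step assms by linarith
      then have "1 / N - 1 / real_of_int (N + 1) = 1 / (N * real_of_int (N + 1))" by (simp add: field_simps)
      moreover have "1 / real_of_int (N + 1) ^ 2 \<le> 1 / (N * real_of_int (N + 1))"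
        using N by (intro divide_left_mono) (auto simp: power2_eq_square)
      ultimately show ?thesis by simp
    qed
    ultimately show ?case using step.IH by linarith
  qed simp
  also have "\<dots> \<le> 1 / K" using True assms by simp
  finally show ?thesis .
next
  case False
  then show ?thesis using assms by simp
qed

lemma finite_divisors_int: "u > 0 \<Longrightarrow> finite {d::int. d > 0 \<and> d dvd u \<and> P d}"
  by (rule finite_subset[of _ "{0..u}"]) (auto dest: zdvd_imp_le)

section \<open>Averages of the coprime divisor sum\<close>

context ternary
begin

lemma coprime_divisor_sum_nonneg: "coprime_divisor_sum Q u \<ge> 0"
  unfolding coprime_divisor_sum_def by (intro sum_nonneg) auto

text \<open>By \<open>rough\<close> each d is 1 or exceeds \<open>K\<close>; this is the origin of
  the constant 1 + 1/K.\<close>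

lemma sum_rough_inverse_square: "(\<Sum>d | d \<in> {1..N} \<and> coprime d Q. 1 / real_of_int d ^ 2) \<le> 1 + 1 / K"
proof -
  have "{d \<in> {1..N}. coprime d Q} \<subseteq> insert 1 {K<..N}"
    using rough by force
  then have "(\<Sum>d | d \<in> {1..N} \<and> coprime d Q. 1 / real_of_int d ^ 2) \<le> (\<Sum>d\<in>insert 1 {K<..N}. 1 / real_of_int d ^ 2)"
    by (intro sum_mono2) auto
  also have "\<dots> \<le> 1 + (\<Sum>d\<in>{K<..N}. 1 / real_of_int d ^ 2)" using pos by (simp add: sum.insert_if)
  also have "\<dots> \<le> 1 + 1 / K" using sum_inverse_square_tail[of K N] pos by simp
  finally show ?thesis .
qed

text \<open>The \<open>u\<close> in question are those whose cofactor D/u lies between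
  \<open>P1\<close> and \<open>P2\<close>, an interval from D/P2 to D/P1. After an exchange of sums,
  the multiples of d in it number at most its length over d, plus one. Weighted by 1/d, the lengths
  give the main term and the extra ones a harmonic sum.\<close>

lemma sum_coprime_divisor_sum_le:
  fixes D P1 P2 :: int
  assumes P: "0 < P1" "P1 \<le> P2" and D: "P1 \<le> D"
  shows "(\<Sum>u | u > 0 \<and> P1 * u \<le> D \<and> D \<le> P2 * u. coprime_divisor_sum Q u)
     \<le> (real_of_int D / P1 - real_of_int D / P2) * (1 + 1 / K) + 2 * sqrt (real_of_int D / P1)"
proof -
  let ?U = "{u. u > 0 \<and> P1 * u \<le> D \<and> D \<le> P2 * u}"
  define x where "x = real_of_int D / P1"
  define x' where "x' = real_of_int D / P2"
  have xx: "x' \<le> x" unfolding x_def x'_def using P D by (intro divide_left_mono) auto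
  define N where "N = \<lfloor>x\<rfloor>"
  have ux: "x' \<le> real_of_int u" "real_of_int u \<le> x" "u \<le> N" if "u \<in> ?U" for u
  proof -
    have "real_of_int (P1 * u) \<le> D" "real_of_int D \<le> real_of_int (P2 * u)" using that by (simp_all only: of_int_le_iff mem_Collect_eq)
    then show "x' \<le> real_of_int u" "real_of_int u \<le> x" unfolding x_def x'_def using P by (simp_all add: field_simps)
    then show "u \<le> N" by (simp add: N_def le_floor_iff)
  qed
  have finU: "finite ?U" by (rule finite_subset[of _ "{0..N}"]) (use ux in force, simp)
  have N0: "N \<ge> 0" using P D by (simp add: N_def x_def)
  have x0: "x \<ge> 0" using P D by (simp add: x_def)
  let ?R = "{d. d \<in> {1..N} \<and> coprime d Q}"
  have finR: "finite ?R" by (rule finite_subset[of _ "{1..N}"]) auto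
  have "(\<Sum>u\<in>?U. coprime_divisor_sum Q u) \<le> (\<Sum>u\<in>?U. \<Sum>d\<in>?R. if d dvd u then 1 / real_of_int d else 0)"
  proof (rule sum_mono)
    fix u assume u: "u \<in> ?U"
    then have u0: "u > 0" by simp
    have eq: "(\<Sum>d\<in>?R. if d dvd u then 1 / real_of_int d else 0) = (\<Sum>d | d \<in> ?R \<and> d dvd u. 1 / real_of_int d)"
      by (rule sum.inter_filter[OF finR, symmetric])
    have "{d. d > 0 \<and> d dvd u \<and> coprime d Q} \<subseteq> {d. d \<in> ?R \<and> d dvd u}"
    proof
      fix d assume d: "d \<in> {d. d > 0 \<and> d dvd u \<and> coprime d Q}"
      then have "d \<le> u" using u0 by (auto dest: zdvd_imp_le)
      then show "d \<in> {d. d \<in> ?R \<and> d dvd u}" using d ux(3)[OF u] by auto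
    qed
    moreover have "finite {d. d \<in> ?R \<and> d dvd u}" by (rule finite_subset[OF _ finR]) auto
    ultimately have "coprime_divisor_sum Q u \<le> (\<Sum>d | d \<in> ?R \<and> d dvd u. 1 / real_of_int d)"
      unfolding coprime_divisor_sum_def by (intro sum_mono2) auto
    then show "coprime_divisor_sum Q u \<le> (\<Sum>d\<in>?R. if d dvd u then 1 / real_of_int d else 0)"
      using eq by simp
  qed
  also have "\<dots> = (\<Sum>d\<in>?R. \<Sum>u\<in>?U. if d dvd u then 1 / real_of_int d else 0)" by (rule sum.swap)
  also have "\<dots> \<le> (\<Sum>d\<in>?R. (x - x') * (1 / real_of_int d ^ 2) + 1 / real_of_int d)"
  proof (rule sum_mono)
    fix d assume d: "d \<in> ?R"
    then have d0: "real_of_int d > 0" by simp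
    have "(\<Sum>u\<in>?U. if d dvd u then 1 / real_of_int d else 0) = real (card {u \<in> ?U. d dvd u}) * (1 / d)"
      using finU by (simp add: sum.inter_filter[symmetric])
    also have "card {u \<in> ?U. d dvd u} = card ((\<lambda>u. u div d) ` {u \<in> ?U. d dvd u})"
      by (rule card_image[symmetric], rule inj_onI) (metis (no_types, lifting) dvd_mult_div_cancel mem_Collect_eq)
    also have "real (card ((\<lambda>u. u div d) ` {u \<in> ?U. d dvd u})) \<le> x / d - x' / d + 1"
    proof (rule card_int_interval_le)
      show "x' / d \<le> x / d + 1" using xx d0 by (simp add: field_simps)
      show "x' / d \<le> real_of_int w \<and> real_of_int w \<le> x / d" if w: "w \<in> (\<lambda>u. u div d) ` {u \<in> ?U. d dvd u}" for w
      proof -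
        obtain u where u: "u \<in> ?U" "d dvd u" "w = u div d" using w by blast
        then have uw: "real_of_int u = d * w" by (metis dvd_mult_div_cancel of_int_mult)
        show ?thesis using ux(1,2)[OF u(1)] d0 unfolding uw by (simp add: field_simps)
      qed
    qed
    finally have "(\<Sum>u\<in>?U. if d dvd u then 1 / real_of_int d else 0) \<le> (x / d - x' / d + 1) * (1 / d)"
      using d0 by (simp add: divide_right_mono)
    also have "\<dots> = (x - x') * (1 / real_of_int d ^ 2) + 1 / real_of_int d"
      using d0 by (simp add: field_simps power2_eq_square)
    finally show "(\<Sum>u\<in>?U. if d dvd u then 1 / real_of_int d else 0) \<le> (x - x') * (1 / real_of_int d ^ 2) + 1 / real_of_int d" .
  qed
  also have "\<dots> = (x - x') * (\<Sum>d\<in>?R. 1 / real_of_int d ^ 2) + (\<Sum>d\<in>?R. 1 / real_of_int d)"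
    by (simp add: sum.distrib sum_distrib_left)
  also have "\<dots> \<le> (x - x') * (1 + 1 / K) + 2 * sqrt x"
  proof (rule add_mono)
    show "(x - x') * (\<Sum>d\<in>?R. 1 / real_of_int d ^ 2) \<le> (x - x') * (1 + 1 / K)"
      using xx sum_rough_inverse_square[of N] by (intro mult_left_mono) auto
    have "(\<Sum>d\<in>?R. 1 / real_of_int d) \<le> (\<Sum>d\<in>{1..N}. 1 / real_of_int d)" by (intro sum_mono2) auto
    also have "\<dots> \<le> 2 * sqrt N" using N0 by (rule sum_inverse_int_le_sqrt)
    also have "\<dots> \<le> 2 * sqrt x" by (simp add: N_def)
    finally show "(\<Sum>d\<in>?R. 1 / real_of_int d) \<le> 2 * sqrt x" .
  qed
  finally show ?thesis unfolding x_def x'_def .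
qed

text \<open>Each 1/u is replaced by its upper bound P2/D, so the main term is P2/P1 - 1 rather than
  ln(P2/P1). On the tile with index t these are about 1/t and ln(1 + 1/t); their difference is of
  order 1/t^2, which the loss allowed per tile can bear.\<close>

lemma sum_coprime_divisor_sum_over_le:
  fixes D P1 P2 :: int
  assumes P: "0 < P1" "P1 \<le> P2" and D: "P1 \<le> D"
  shows "(\<Sum>u | u > 0 \<and> P1 * u \<le> D \<and> D \<le> P2 * u. coprime_divisor_sum Q u / u)
     \<le> (real_of_int P2 / P1 - 1) * (1 + 1 / K) + 2 * (real_of_int P2 / P1) * sqrt (real_of_int P1 / D)"
proof -
  let ?U = "{u. u > 0 \<and> P1 * u \<le> D \<and> D \<le> P2 * u}"
  have D0: "D > 0" using P D by simp
  have "(\<Sum>u\<in>?U. coprime_divisor_sum Q u / u) \<le> (\<Sum>u\<in>?U. coprime_divisor_sum Q u * (P2 / D))"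
  proof (rule sum_mono)
    fix u assume u: "u \<in> ?U"
    then have "real_of_int D \<le> real_of_int (P2 * u)" by (simp only: of_int_le_iff mem_Collect_eq)
    then have "1 / real_of_int u \<le> P2 / D" using u D0 by (simp add: field_simps)
    then have "coprime_divisor_sum Q u * (1 / u) \<le> coprime_divisor_sum Q u * (P2 / D)" using coprime_divisor_sum_nonneg by (rule mult_left_mono)
    then show "coprime_divisor_sum Q u / u \<le> coprime_divisor_sum Q u * (P2 / D)" by simp
  qed
  also have "\<dots> = (\<Sum>u\<in>?U. coprime_divisor_sum Q u) * (P2 / D)" by (rule sum_distrib_right[symmetric])
  also have "\<dots> \<le> ((real_of_int D / P1 - real_of_int D / P2) * (1 + 1 / K) + 2 * sqrt (real_of_int D / P1)) * (P2 / D)"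
    using sum_coprime_divisor_sum_le[OF P D] P D0 by (intro mult_right_mono) auto
  also have "\<dots> = (real_of_int D / P1 - real_of_int D / P2) * (P2 / D) * (1 + 1 / K) + 2 * (sqrt (real_of_int D / P1) * (P2 / D))"
  proof -
    have "(y * k + 2 * s) * p = y * p * k + 2 * (s * p)" for y k s p :: real by (simp add: algebra_simps)
    then show ?thesis .
  qed
  also have "(real_of_int D / P1 - real_of_int D / P2) * (P2 / D) = real_of_int P2 / P1 - 1"
    using P D0 by (simp add: field_simps)
  also have "sqrt (real_of_int D / P1) * (P2 / D) = (real_of_int P2 / P1) * sqrt (real_of_int P1 / D)"
  proof -
    have "sqrt (real_of_int D / P1) * (P2 / D) = (real_of_int P2 / P1) * (sqrt (real_of_int D / P1) / (real_of_int D / P1))"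
      using P D0 by (simp add: field_simps)
    also have "sqrt (real_of_int D / P1) / (real_of_int D / P1) = 1 / sqrt (real_of_int D / P1)"
      using P D0 by (subst sqrt_divide_self_eq) (auto simp: inverse_eq_divide)
    also have "\<dots> = sqrt (real_of_int P1 / D)" by (simp add: real_sqrt_divide)
    finally show ?thesis .
  qed
  finally show ?thesis by (simp add: mult.assoc)
qed

end

lemma card_le_diameter:
  fixes J :: "int set" and r :: real
  assumes "finite J" "r \<ge> 0" "\<And>i j. i \<in> J \<Longrightarrow> j \<in> J \<Longrightarrow> i \<le> j \<Longrightarrow> real_of_int (j - i) \<le> r"
  shows "real (card J) \<le> r + 1"
proof (cases "J = {}")
  case False
  have m: "Min J \<in> J" "\<And>j. j \<in> J \<Longrightarrow> Min J \<le> j" using assms(1) False by auto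
  have "real (card J) \<le> (real_of_int (Min J) + r) - real_of_int (Min J) + 1"
  proof (rule card_int_interval_le)
    fix w assume w: "w \<in> J"
    then show "real_of_int (Min J) \<le> real_of_int w \<and> real_of_int w \<le> real_of_int (Min J) + r"
      using m assms(3)[OF m(1) w] by simp
  qed (use assms(2) in simp)
  then show ?thesis by simp
qed (use assms(2) in simp)

lemma qdiff_swap: "qdiff B \<beta> C \<gamma> (j', k', j, k) = - qdiff B \<beta> C \<gamma> (j, k, j', k')"
  by (simp add: qdiff_def)

text \<open>Exchanging the two points negates the difference. The factor 1/2 gained here offsets the
  factor 2 for the order of a pair in \<open>second_moment_le\<close>.\<close>

lemma card_qdiff_pos_le:
  "2 * card {z \<in> box4 n. qdiff B \<beta> C \<gamma> z > 0} \<le> card (box4 n)"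
proof -
  let ?P = "{z \<in> box4 n. qdiff B \<beta> C \<gamma> z > 0}" and ?N = "{z \<in> box4 n. qdiff B \<beta> C \<gamma> z < 0}"
  have "card ?P \<le> card ?N"
  proof (rule card_inj_on_le[where f = "\<lambda>(j, k, j', k'). (j', k', j, k)"])
    show "(\<lambda>(j, k, j', k'). (j', k', j, k)) ` ?P \<subseteq> ?N"
    proof (rule image_subsetI)
      fix z assume z: "z \<in> ?P"
      obtain j k j' k' where z': "z = (j, k, j', k')" by (metis prod_cases4)
      show "(case z of (j, k, j', k') \<Rightarrow> (j', k', j, k)) \<in> ?N"
        using z qdiff_swap[of B \<beta> C \<gamma> j' k' j k] by (simp add: z' box4_def)
    qed
  qed (simp_all add: inj_on_def split_paired_all)
  moreover have "card ?P + card ?N = card (?P \<union> ?N)"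
    by (rule card_Un_disjoint[symmetric]) auto
  moreover have "card (?P \<union> ?N) \<le> card (box4 n)" by (rule card_mono) auto
  ultimately show ?thesis by linarith
qed

section \<open>Size of the differences \<Delta>, and the slices with fixed u\<close>

context ternary
begin

definition \<Gamma> :: int where "\<Gamma> = B + C + \<beta> + \<gamma>"

lemma \<Gamma>_pos: "\<Gamma> > 0" using pos by (simp add: \<Gamma>_def)

lemma \<Delta>_le:
  assumes "z \<in> box4 H" "H > 0"
  shows "\<Delta> z \<le> \<Gamma> * H ^ 2"
proof -
  obtain j k j' k' where z: "z = (j, k, j', k')" by (metis prod_cases4)
  have "0 \<le> quad B \<beta> j" "0 \<le> quad C \<gamma> k" "quad B \<beta> j' \<le> (B + \<beta>) * H ^ 2" "quad C \<gamma> k' \<le> (C + \<gamma>) * H ^ 2"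
    using quad_bounds[of B \<beta> j H] quad_bounds[of C \<gamma> k H] quad_bounds[of B \<beta> j' H] quad_bounds[of C \<gamma> k' H]
      assms pos by (auto simp: z box4_def)
  then have "\<Delta> z \<le> (B + \<beta>) * H ^ 2 + (C + \<gamma>) * H ^ 2" by (simp add: z qdiff_def)
  then show ?thesis by (simp add: \<Gamma>_def algebra_simps)
qed

text \<open>For fixed \<open>j\<close>, \<open>k\<close>, \<open>k'\<close> the admissible values of
  \<Delta> lie within \<open>T\<close> of each other, so by quadratic spacing \<open>j'\<close> is
  confined to a range of length sqrt T.\<close>

lemma card_\<Delta>_small:
  assumes T: "T \<ge> 0" and n: "n \<ge> 0"
  shows "real (card {z \<in> box4 n. 0 < \<Delta> z \<and> real_of_int (\<Delta> z) \<le> T}) \<le> real_of_int n ^ 3 * (sqrt T + 1)"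
proof -
  let ?S = "{z \<in> box4 n. 0 < \<Delta> z \<and> real_of_int (\<Delta> z) \<le> T}"
  let ?b = "{0..<n} \<times> {0..<n} \<times> {0..<n}"
  define J where "J = (\<lambda>(j, k, k'). {j'. (j, k, j', k') \<in> ?S})"
  have finJ: "finite (J x)" for x
    by (rule finite_subset[of _ "{0..<n}"]) (auto simp: J_def box4_def split: prod.splits)
  have cJ: "real (card (J x)) \<le> sqrt T + 1" for x
  proof (rule card_le_diameter[OF finJ])
    fix i i' assume i: "i \<in> J x" "i' \<in> J x" "i \<le> i'"
    obtain j k k' where x: "x = (j, k, k')" by (cases x)
    have "0 \<le> i" using i by (auto simp: J_def x box4_def)
    then have "(i' - i) ^ 2 \<le> quad B \<beta> i' - quad B \<beta> i" using i pos by (intro quad_diff_ge_square) auto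
    also have "\<dots> = \<Delta> (j, k, i', k') - \<Delta> (j, k, i, k')" by (simp add: qdiff_def)
    finally have "real_of_int ((i' - i) ^ 2) \<le> real_of_int (\<Delta> (j, k, i', k') - \<Delta> (j, k, i, k'))"
      by (simp only: of_int_le_iff)
    also have "\<dots> \<le> T" using i by (auto simp: J_def x)
    finally show "real_of_int (i' - i) \<le> sqrt T" by (intro real_le_rsqrt) simp
  qed (use T in simp)
  have "card ?S \<le> card (SIGMA x:?b. J x)"
  proof (rule card_inj_on_le[where f = "\<lambda>(j, k, j', k'). ((j, k, k'), j')"])
    show "inj_on (\<lambda>(j, k, j', k'). ((j, k, k'), j')) ?S" by (simp add: inj_on_def split_paired_all)
    show "(\<lambda>(j, k, j', k'). ((j, k, k'), j')) ` ?S \<subseteq> (SIGMA x:?b. J x)"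
    proof (rule image_subsetI)
      fix z assume "z \<in> ?S"
      then show "(case z of (j, k, j', k') \<Rightarrow> ((j, k, k'), j')) \<in> (SIGMA x:?b. J x)"
        by (cases z) (simp add: J_def box4_def)
    qed
    show "finite (SIGMA x:?b. J x)" by (rule finite_SigmaI[OF _ finJ]) simp
  qed
  also have "\<dots> = (\<Sum>x\<in>?b. card (J x))" using finJ by (intro card_SigmaI) auto
  finally have "real (card ?S) \<le> (\<Sum>x\<in>?b. real (card (J x)))" by (simp only: of_nat_le_iff flip: of_nat_sum)
  also have "\<dots> \<le> (\<Sum>x\<in>?b. sqrt T + 1)" by (intro sum_mono cJ)
  also have "\<dots> = real_of_int n ^ 3 * (sqrt T + 1)" using n by (simp add: card_cartesian_product power3_eq_cube)
  finally show ?thesis .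
qed

text \<open>Split at \<Delta> = X P1. Below it every summand is at most 1 and
  \<open>card_\<Delta>_small\<close> counts the points; above it every summand is at most 1/sqrt X.
  The free \<open>X\<close> is chosen later to balance the two parts.\<close>

lemma sum_sqrt_\<Delta>_le:
  assumes P1: "P1 > (0::int)" and X: "X > (0::real)" and n: "n \<ge> 0"
  shows "(\<Sum>z | z \<in> box4 n \<and> P1 \<le> \<Delta> z. sqrt (real_of_int P1 / \<Delta> z)) \<le> real_of_int n ^ 3 * (sqrt (X * P1) + 1) + real_of_int n ^ 4 / sqrt X"
proof -
  let ?S = "{z. z \<in> box4 n \<and> P1 \<le> \<Delta> z}"
  let ?T = "{z \<in> box4 n. 0 < \<Delta> z \<and> real_of_int (\<Delta> z) \<le> X * P1}"
  have fin: "finite ?S" by (rule finite_subset[of _ "box4 n"]) auto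
  have "(\<Sum>z\<in>?S. sqrt (real_of_int P1 / \<Delta> z)) \<le> (\<Sum>z\<in>?S. (if z \<in> ?T then 1 else 0) + 1 / sqrt X)"
  proof (rule sum_mono)
    fix z assume z: "z \<in> ?S"
    then have d: "real_of_int P1 \<le> \<Delta> z" "real_of_int (\<Delta> z) > 0" using P1 by auto
    show "sqrt (real_of_int P1 / \<Delta> z) \<le> (if z \<in> ?T then 1 else 0) + 1 / sqrt X"
    proof (cases "z \<in> ?T")
      case True
      have "real_of_int P1 / \<Delta> z \<le> 1" using d by simp
      then have "sqrt (real_of_int P1 / \<Delta> z) \<le> 1" by simp
      then show ?thesis using True X by (simp add: add_increasing2)
    next
      case False
      then have "X * P1 \<le> \<Delta> z" using z d by auto
      then have "real_of_int P1 / \<Delta> z \<le> 1 / X" using X d by (simp add: field_simps)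
      then have "sqrt (real_of_int P1 / \<Delta> z) \<le> sqrt (1 / X)" by (rule real_sqrt_le_mono)
      then show ?thesis using False by (simp add: real_sqrt_divide)
    qed
  qed
  also have "\<dots> = (\<Sum>z\<in>?S. if z \<in> ?T then 1 else 0) + real (card ?S) * (1 / sqrt X)"
    by (simp only: sum.distrib sum_constant)
  also have "(\<Sum>z\<in>?S. if z \<in> ?T then 1 else 0 :: real) = real (card (?S \<inter> ?T))"
    by (subst sum.inter_restrict[OF fin, symmetric]) simp
  also have "real (card (?S \<inter> ?T)) \<le> real (card ?T)" by (intro of_nat_mono card_mono) auto
  also have "\<dots> \<le> real_of_int n ^ 3 * (sqrt (X * P1) + 1)" using X P1 n by (intro card_\<Delta>_small) auto
  also have "real (card ?S) * (1 / sqrt X) \<le> real_of_int n ^ 4 * (1 / sqrt X)"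
  proof (rule mult_right_mono)
    have "card ?S \<le> card (box4 n)" by (rule card_mono) auto
    then have "real (card ?S) \<le> real (nat n ^ 4)" using n by (simp only: of_nat_le_iff card_box4)
    then show "real (card ?S) \<le> real_of_int n ^ 4" using n by simp
  qed (use X in simp)
  finally show ?thesis by simp
qed

text \<open>The pairs of solutions of \<open>\<phi>(i) + \<psi>(j) + \<chi>(k) = \<phi>(i') + \<psi>(j') + \<chi>(k')\<close> with \<open>i - i' = u\<close>.\<close>
definition slice :: "int \<Rightarrow> int \<Rightarrow> int \<Rightarrow> int \<Rightarrow> (int \<times> int \<times> int \<times> int) set" where
  "slice P L H u = {z \<in> box4 H. \<exists>i. P \<le> i \<and> i + u < P + L \<and> quad A \<alpha> (i + u) - quad A \<alpha> i = \<Delta> z}"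

text \<open>On the slice \<Delta> = u (A(2i + u) + \<alpha>), so \<Delta> lies in a fixed class
  modulo \<open>M = 2 * A * u\<close> and in a range proportional to \<open>u\<close>. The
  congruence is traded for the density factor \<open>coprime_divisor_sum Q u / M\<close>, at the
  price of enlarging box and range to whole cubes. Across a cube of side \<open>M\<close>, \<Delta>
  changes by at most 8A\<Gamma>H'u; divided by \<open>u\<close>, this moves \<open>P1\<close> and
  \<open>P2\<close> by an amount independent of \<open>u\<close>.\<close>

lemma card_slice_le:
  assumes u: "u > 0" and H: "H \<ge> 0" "2 * A * u + H \<le> H'"
    and P1: "P1 \<le> 2 * A * P - 8 * A * \<Gamma> * H'" and P2: "P2 \<ge> 2 * A * (P + L) + \<alpha> + 8 * A * \<Gamma> * H'"
  shows "2 * A * real (card (slice P L H u)) \<le> coprime_divisor_sum Q u / u * real (card {z \<in> box4 H'. P1 * u \<le> \<Delta> z \<and> \<Delta> z \<le> P2 * u})"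
proof -
  define M where "M = 2 * A * u"
  have M: "M > 0" using pos u by (simp add: M_def)
  have H': "H' > 0" using H M by (simp add: M_def)
  define \<rho> where "\<rho> = A * u ^ 2 + \<alpha> * u"
  let ?S = "slice P L H u" and ?T = "{z \<in> box4 H'. P1 * u \<le> \<Delta> z \<and> \<Delta> z \<le> P2 * u}"
  have S: "M dvd \<Delta> z - \<rho>" "2 * A * P * u \<le> \<Delta> z" "\<Delta> z \<le> (2 * A * (P + L) + \<alpha>) * u" "z \<in> box4 H" if z: "z \<in> ?S" for z
  proof -
    obtain i where i: "P \<le> i" "i + u < P + L" "quad A \<alpha> (i + u) - quad A \<alpha> i = \<Delta> z" using z by (auto simp: slice_def)
    have e: "\<Delta> z = u * (A * (2 * i + u) + \<alpha>)"
      using i(3) quad_diff[of A \<alpha> "i + u" i] by (simp add: algebra_simps)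
    have "\<Delta> z - \<rho> = M * i" by (simp add: e \<rho>_def M_def algebra_simps power2_eq_square)
    then show "M dvd \<Delta> z - \<rho>" by simp
    have "A * (2 * P) \<le> A * (2 * i + u)" using i u pos by (intro mult_left_mono) auto
    moreover have "2 * A * P = A * (2 * P)" by simp
    ultimately have "2 * A * P \<le> A * (2 * i + u) + \<alpha>" using pos by linarith
    then have "u * (2 * A * P) \<le> u * (A * (2 * i + u) + \<alpha>)" using u by (intro mult_left_mono) auto
    then show "2 * A * P * u \<le> \<Delta> z" by (simp add: e mult_ac)
    have "A * (2 * i + u) \<le> A * (2 * (P + L))" using i u pos by (intro mult_left_mono) auto
    moreover have "A * (2 * (P + L)) = 2 * A * (P + L)" by simp
    ultimately have "A * (2 * i + u) + \<alpha> \<le> 2 * A * (P + L) + \<alpha>" by linarith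
    then have "u * (A * (2 * i + u) + \<alpha>) \<le> u * (2 * A * (P + L) + \<alpha>)" using u by (intro mult_left_mono) auto
    then show "\<Delta> z \<le> (2 * A * (P + L) + \<alpha>) * u" by (simp add: e mult_ac)
    show "z \<in> box4 H" using z by (simp add: slice_def)
  qed
  have "real (card ?S) * real_of_int (M ^ 4) \<le> (real_of_int M ^ 3 * coprime_divisor_sum Q u) * real (card ?T)"
  proof (rule card_mult_cube_le[OF M])
    show "finite ?S" unfolding slice_def by simp
    show "finite ?T" by simp
    fix c
    have "card {z \<in> ?S. map4 (\<lambda>i. i div M) z = c} \<le> card {z \<in> ?S. map4 (\<lambda>i. i div M) z = c \<and> M dvd \<Delta> z - \<rho>}"
    proof (rule card_mono)
      show "finite {z \<in> ?S. map4 (\<lambda>i. i div M) z = c \<and> M dvd \<Delta> z - \<rho>}"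
        by (rule finite_subset[of _ "box4 H"]) (auto simp: slice_def)
    qed (use S(1) in blast)
    also have "\<dots> \<le> card {z \<in> box4 M. M dvd \<Delta> z - \<rho>}"
      by (intro card_fibre_le M) (rule dvd_qdiff_mod)
    finally have "real (card {z \<in> ?S. map4 (\<lambda>i. i div M) z = c}) \<le> real (card {z \<in> box4 M. M dvd \<Delta> z - \<rho>})"
      by (simp only: of_nat_le_iff)
    also have "\<dots> \<le> real_of_int M ^ 3 * coprime_divisor_sum Q u" using card_\<Delta>_cong[OF u, of \<rho>] by (simp add: M_def)
    finally show "real (card {z \<in> ?S. map4 (\<lambda>i. i div M) z = c}) \<le> real_of_int M ^ 3 * coprime_divisor_sum Q u" .
  next
    fix z z' assume z: "z \<in> ?S" and zz: "map4 (\<lambda>i. i div M) z' = map4 (\<lambda>i. i div M) z"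
    obtain j k j' k' where z1: "z = (j, k, j', k')" by (metis prod_cases4)
    obtain l m l' m' where z2: "z' = (l, m, l', m')" by (metis prod_cases4)
    \<comment> \<open>Points of one cube differ by less than \<open>M\<close> in each coordinate,
      and the margin H' - H keeps them in the larger box.\<close>
    have near: "0 \<le> y \<and> y < H' \<and> \<bar>y - x\<bar> \<le> M" if "0 \<le> x" "x < H" "y div M = x div M" for x y
    proof -
      have "y div M \<ge> 0" using that M by (simp add: pos_imp_zdiv_nonneg_iff)
      then have "y \<ge> 0" using M by (simp add: pos_imp_zdiv_nonneg_iff)
      moreover have "y - x = y mod M - x mod M"
        using that(3) by (metis add_diff_cancel_right' add_diff_cancel_left diff_diff_eq2 minus_mod_eq_mult_div diff_add_cancel add.commute)
      moreover have "0 \<le> y mod M" "y mod M < M" "0 \<le> x mod M" "x mod M < M" using M by simp_all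
      moreover have "M + H \<le> H'" using H by (simp add: M_def)
      ultimately show ?thesis using that(1,2) by (intro conjI; linarith)
    qed
    have HH: "H \<le> H'" using H M by (simp add: M_def)
    have bx: "{j, k, j', k'} \<subseteq> {0..<H}" using S(4)[OF z] by (simp add: z1 box4_def)
    have n: "0 \<le> l \<and> l < H' \<and> \<bar>l - j\<bar> \<le> M" "0 \<le> m \<and> m < H' \<and> \<bar>m - k\<bar> \<le> M"
      "0 \<le> l' \<and> l' < H' \<and> \<bar>l' - j'\<bar> \<le> M" "0 \<le> m' \<and> m' < H' \<and> \<bar>m' - k'\<bar> \<le> M"
      by (rule near; use bx zz in \<open>simp add: z1 z2 map4_def\<close>)+
    have "\<bar>quad B \<beta> l - quad B \<beta> j\<bar> \<le> M * (2 * B * H' + \<beta>)" "\<bar>quad B \<beta> l' - quad B \<beta> j'\<bar> \<le> M * (2 * B * H' + \<beta>)"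
      "\<bar>quad C \<gamma> m - quad C \<gamma> k\<bar> \<le> M * (2 * C * H' + \<gamma>)" "\<bar>quad C \<gamma> m' - quad C \<gamma> k'\<bar> \<le> M * (2 * C * H' + \<gamma>)"
      by (rule abs_quad_diff_le; use pos n bx HH in simp)+
    then have "\<bar>\<Delta> z' - \<Delta> z\<bar> \<le> 2 * (M * (2 * B * H' + \<beta>)) + 2 * (M * (2 * C * H' + \<gamma>))"
      by (simp add: z1 z2 qdiff_def)
    also have "\<dots> = 4 * M * ((B + C) * H') + 2 * M * (\<beta> + \<gamma>)" by (simp add: algebra_simps)
    also have "\<dots> \<le> 4 * M * ((B + C) * H') + 4 * M * ((\<beta> + \<gamma>) * H')"
    proof -
      have "(\<beta> + \<gamma>) * 1 \<le> (\<beta> + \<gamma>) * H'" using pos H' by (intro mult_left_mono) auto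
      then have "M * (\<beta> + \<gamma>) \<le> M * ((\<beta> + \<gamma>) * H')" using M by (intro mult_left_mono) auto
      moreover have "0 \<le> M * (\<beta> + \<gamma>)" using M pos by simp
      ultimately show ?thesis by linarith
    qed
    also have "\<dots> = 8 * A * \<Gamma> * H' * u" by (simp add: \<Gamma>_def M_def algebra_simps)
    finally have d: "\<bar>\<Delta> z' - \<Delta> z\<bar> \<le> 8 * A * \<Gamma> * H' * u" .
    have "P1 * u \<le> (2 * A * P - 8 * A * \<Gamma> * H') * u" using P1 u by (intro mult_right_mono) auto
    then have "P1 * u \<le> \<Delta> z'" using d S(2)[OF z] by (simp add: left_diff_distrib)
    moreover have "(2 * A * (P + L) + \<alpha> + 8 * A * \<Gamma> * H') * u \<le> P2 * u" using P2 u by (intro mult_right_mono) auto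
    then have "\<Delta> z' \<le> P2 * u" using d S(3)[OF z] by (simp add: distrib_right)
    ultimately show "z' \<in> ?T" using n by (simp add: z2 box4_def)
  qed
  then have "real_of_int M ^ 3 * (M * real (card ?S)) \<le> real_of_int M ^ 3 * (coprime_divisor_sum Q u * real (card ?T))"
    by (simp add: power4_eq_xxxx power3_eq_cube mult_ac)
  then have "M * real (card ?S) \<le> coprime_divisor_sum Q u * real (card ?T)"
    using M by (subst (asm) mult_le_cancel_left_pos) auto
  then show ?thesis using u by (simp add: M_def field_simps)
qed

end

section \<open>The diagonal\<close>

text \<open>The square root bound would not do here: squared in
  \<open>card_\<Delta>_zero_pos\<close> it gives a factor \<open>H\<close>, and the bound for the
  diagonal would then have the order of the main term.\<close>

lemma sum_inverse_int_le_ln: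
  assumes "N \<ge> 1"
  shows "(\<Sum>d\<in>{1..N}. 1 / real_of_int d) \<le> 1 + ln N"
  using assms
proof (induction N rule: int_ge_induct)
  case (step N)
  have "{1..N + 1} = insert (N + 1) {1..N}" using step by auto
  then have "(\<Sum>d\<in>{1..N + 1}. 1 / real_of_int d) = 1 / real_of_int (N + 1) + (\<Sum>d\<in>{1..N}. 1 / real_of_int d)"
    by simp
  moreover have "1 / real_of_int (N + 1) \<le> ln (real_of_int (N + 1)) - ln N"
  proof -
    have N: "real_of_int N \<ge> 1" using step by simp
    have "ln (N / real_of_int (N + 1)) \<le> N / real_of_int (N + 1) - 1"
      using N by (intro ln_le_minus_one) auto
    moreover have "ln (N / real_of_int (N + 1)) = ln N - ln (real_of_int (N + 1))"
      using N by (intro ln_divide_pos) auto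
    moreover have "N / real_of_int (N + 1) - 1 = - (1 / real_of_int (N + 1))"
      using N by (simp add: field_simps)
    ultimately show ?thesis by linarith
  qed
  ultimately show ?case using step.IH by linarith
qed simp

text \<open>Exchange the sums: a divisor d of \<open>w\<close> has weight d and at most H/d
  multiples up to \<open>H\<close>.\<close>

lemma sum_gcd_le_divisors:
  fixes w H :: int
  assumes w: "w > 0" and H: "H \<ge> 0"
  shows "(\<Sum>r\<in>{1..H}. real_of_int (gcd r w)) \<le> H * real (card {d. d > 0 \<and> d dvd w})"
proof -
  let ?D = "{d. d > 0 \<and> d dvd w}"
  have finD: "finite ?D" using finite_divisors_int[OF w, of "\<lambda>_. True"] by simp
  have "(\<Sum>r\<in>{1..H}. real_of_int (gcd r w)) \<le> (\<Sum>r\<in>{1..H}. \<Sum>d\<in>?D. if d dvd r then real_of_int d else 0)"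
    by (intro sum_mono gcd_le_sum_divisors w)
  also have "\<dots> = (\<Sum>d\<in>?D. \<Sum>r\<in>{1..H}. if d dvd r then real_of_int d else 0)" by (rule sum.swap)
  also have "\<dots> \<le> (\<Sum>d\<in>?D. real_of_int H)"
  proof (rule sum_mono)
    fix d assume d: "d \<in> ?D"
    have "(\<Sum>r\<in>{1..H}. if d dvd r then real_of_int d else 0) = (\<Sum>r | r \<in> {1..H} \<and> d dvd r. real_of_int d)"
      by (rule sum.inter_filter[symmetric]) simp
    also have "\<dots> = real (card {r \<in> {1..H}. d dvd r}) * d" by simp
    also have "card {r \<in> {1..H}. d dvd r} \<le> card {1..H div d}"
    proof (rule card_inj_on_le[where f = "\<lambda>r. r div d"])
      show "inj_on (\<lambda>r. r div d) {r \<in> {1..H}. d dvd r}"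
        by (rule inj_onI) (metis (no_types, lifting) dvd_mult_div_cancel mem_Collect_eq)
      show "(\<lambda>r. r div d) ` {r \<in> {1..H}. d dvd r} \<subseteq> {1..H div d}"
      proof (rule image_subsetI)
        fix r assume r: "r \<in> {r \<in> {1..H}. d dvd r}"
        then have "d * (r div d) = r" by simp
        then have "r div d > 0" using r d by (metis (no_types, lifting) mem_Collect_eq atLeastAtMost_iff zero_less_mult_pos zless_add1_eq zless_imp_add1_zle order_less_le_trans zero_less_one)
        moreover have "r div d \<le> H div d" using r d by (intro zdiv_mono1) auto
        ultimately show "r div d \<in> {1..H div d}" by simp
      qed
    qed simp
    then have "real (card {r \<in> {1..H}. d dvd r}) * d \<le> real_of_int (H div d) * d"
      using d H by (intro mult_right_mono) (auto simp: pos_imp_zdiv_nonneg_iff nat_le_iff le_nat_iff)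
    also have "\<dots> = real_of_int (H div d * d)" by simp
    also have "\<dots> \<le> H" using d by (simp only: of_int_le_iff) (simp add: minus_mod_eq_div_mult [symmetric])
    finally show "(\<Sum>r\<in>{1..H}. if d dvd r then real_of_int d else 0) \<le> real_of_int H" .
  qed
  also have "\<dots> = H * real (card ?D)" by simp
  finally show ?thesis .
qed

text \<open>Write w = d e: the weight 1/w factors, and d and e both stay below
  \<open>H\<close>.\<close>

lemma sum_divisors_over_w_le:
  fixes H :: int
  assumes H: "H \<ge> 0"
  shows "(\<Sum>w\<in>{1..H}. real (card {d. d > 0 \<and> d dvd w}) / w) \<le> (\<Sum>d\<in>{1..H}. 1 / real_of_int d) ^ 2"
proof -
  let ?I = "{1..H}"
  have "(\<Sum>w\<in>?I. real (card {d. d > 0 \<and> d dvd w}) / w) = (\<Sum>w\<in>?I. \<Sum>d\<in>?I. if d dvd w then 1 / real_of_int w else 0)"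
  proof (rule sum.cong[OF refl])
    fix w assume w: "w \<in> ?I"
    have "{d. d > 0 \<and> d dvd w} = {d \<in> ?I. d dvd w}" using w by (auto dest: zdvd_imp_le)
    then have "real (card {d. d > 0 \<and> d dvd w}) / w = (\<Sum>d | d \<in> ?I \<and> d dvd w. 1 / real_of_int w)" by simp
    also have "\<dots> = (\<Sum>d\<in>?I. if d dvd w then 1 / real_of_int w else 0)" by (rule sum.inter_filter) simp
    finally show "real (card {d. d > 0 \<and> d dvd w}) / w = (\<Sum>d\<in>?I. if d dvd w then 1 / real_of_int w else 0)" .
  qed
  also have "\<dots> = (\<Sum>d\<in>?I. \<Sum>w\<in>?I. if d dvd w then 1 / real_of_int w else 0)" by (rule sum.swap)
  also have "\<dots> \<le> (\<Sum>d\<in>?I. 1 / real_of_int d * (\<Sum>e\<in>?I. 1 / real_of_int e))"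
  proof (rule sum_mono)
    fix d assume d: "d \<in> ?I"
    have "(\<Sum>w\<in>?I. if d dvd w then 1 / real_of_int w else 0) = (\<Sum>w | w \<in> ?I \<and> d dvd w. 1 / real_of_int w)"
      by (rule sum.inter_filter[symmetric]) simp
    also have "\<dots> \<le> (\<Sum>w\<in>(\<lambda>e. d * e) ` ?I. 1 / real_of_int w)"
    proof (rule sum_mono2)
      show "{w \<in> ?I. d dvd w} \<subseteq> (\<lambda>e. d * e) ` ?I"
      proof
        fix w assume w: "w \<in> {w \<in> ?I. d dvd w}"
        then obtain e where e: "w = d * e" by auto
        have "0 < d * e" "0 < d" using w d e by auto
        then have "e > 0" by (rule zero_less_mult_pos)
        then have "1 * e \<le> d * e" using d by (intro mult_right_mono) auto
        moreover have "d * e \<le> H" using w e by simp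
        ultimately have "e \<le> H" by linarith
        then show "w \<in> (\<lambda>e. d * e) ` ?I" using \<open>e > 0\<close> e by (intro image_eqI[of _ _ e]) auto
      qed
    qed (use d in auto)
    also have "\<dots> = (\<Sum>e\<in>?I. 1 / real_of_int (d * e))"
      using d by (subst sum.reindex) (auto simp: inj_on_def)
    also have "\<dots> = 1 / real_of_int d * (\<Sum>e\<in>?I. 1 / real_of_int e)" by (simp add: sum_distrib_left)
    finally show "(\<Sum>w\<in>?I. if d dvd w then 1 / real_of_int w else 0) \<le> 1 / real_of_int d * (\<Sum>e\<in>?I. 1 / real_of_int e)" .
  qed
  also have "\<dots> = (\<Sum>d\<in>?I. 1 / real_of_int d) ^ 2" by (simp add: sum_distrib_right power2_eq_square)
  finally show ?thesis .
qed

text \<open>The interval is covered by \<open>H div w + 1\<close> full periods.\<close>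

lemma card_linear_cong_interval:
  fixes w x s H :: int
  assumes w: "w > 0" and H: "H \<ge> 0"
  shows "card {k \<in> {0..<H}. w dvd x * k - s} \<le> nat (H div w + 1) * nat (gcd x w)"
proof -
  let ?P = "\<lambda>k. w dvd x * k - s"
  have "H < (H div w + 1) * w" using w
    by (metis add.commute distrib_right mult_1 pos_mod_bound add_less_cancel_left div_mult_mod_eq)
  then have "card {k \<in> {0..<H}. ?P k} \<le> card {k \<in> {0..<(H div w + 1) * w}. ?P k}"
  proof (intro card_mono)
    show "finite {k \<in> {0..<(H div w + 1) * w}. ?P k}"
      by (rule finite_subset[of _ "{0..<(H div w + 1) * w}"]) auto
  qed auto
  also have "\<dots> \<le> nat (H div w + 1) * card {k \<in> {0..<w}. ?P k}"
  proof (rule card_residue_class_le[OF w])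
    show "H div w + 1 \<ge> 0" using w H by (simp add: pos_imp_zdiv_nonneg_iff add_nonneg_pos)
    show "?P (k mod w) = ?P k" for k
      by (metis mod_eq_dvd_iff mod_mult_right_eq mod_diff_left_eq dvd_eq_mod_eq_0)
  qed
  also have "\<dots> \<le> nat (H div w + 1) * nat (gcd x w)" by (intro mult_left_mono card_linear_cong w) simp
  finally show ?thesis .
qed

context ternary
begin

text \<open>Put w = j' - j > 0 and r = k - k'. The equation reads w (B(j + j') + \<beta>) = r (C(2k'
  + r) + \<gamma>): hence r > 0, \<open>k'\<close> satisfies a linear congruence modulo w, and w, r,
  \<open>k'\<close> determine the point. There are at most (2H/w) 2C gcd(r, w) choices of
  \<open>k'\<close>, and summing over r and w costs two logarithms.\<close>

lemma card_\<Delta>_zero_pos: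
  assumes H: "H > 0"
  shows "real (card {z \<in> box4 H. \<Delta> z = 0 \<and> fst z < fst (snd (snd z))}) \<le> 4 * C * real_of_int H ^ 2 * (1 + ln H) ^ 2"
proof -
  let ?S = "{z \<in> box4 H. \<Delta> z = 0 \<and> fst z < fst (snd (snd z))}"
  define E where "E = (\<lambda>(w, r). {k' \<in> {0..<H}. w dvd (2 * C * r) * k' - (- (r * (C * r + \<gamma>)))})"
  let ?I = "{1..H} \<times> {1..H}"
  have finE: "finite (E x)" for x by (rule finite_subset[of _ "{0..<H}"]) (auto simp: E_def split: prod.splits)
  let ?f = "\<lambda>(j, k, j', k'). ((j' - j, k - k'), k')"
  have eq: "(j' - j) * (B * (j + j') + \<beta>) = (k - k') * (C * (k' + k) + \<gamma>)"
    if "(j, k, j', k') \<in> ?S" for j k j' k'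
  proof -
    have "quad B \<beta> j' - quad B \<beta> j = quad C \<gamma> k - quad C \<gamma> k'" using that by (simp add: qdiff_def)
    then show ?thesis by (simp add: quad_diff)
  qed
  have "card ?S \<le> card (SIGMA x:?I. E x)"
  proof (rule card_inj_on_le[where f = ?f])
    show "inj_on ?f ?S"
    proof (rule inj_onI)
      fix x y assume x: "x \<in> ?S" and y: "y \<in> ?S" and f: "?f x = ?f y"
      obtain j k j' k' where x': "x = (j, k, j', k')" by (metis prod_cases4)
      obtain l m l' m' where y': "y = (l, m, l', m')" by (metis prod_cases4)
      have kk: "k' = m'" "k = m" and w: "j' - j = l' - l" using f by (auto simp: x' y')
      have "(j' - j) * (B * (j + j') + \<beta>) = (j' - j) * (B * (l + l') + \<beta>)"
        using eq[of j k j' k'] eq[of l m l' m'] x y kk w by (simp add: x' y')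
      then have "j + j' = l + l'" using x pos by (simp add: x')
      then show "x = y" using w kk by (simp add: x' y')
    qed
    show "?f ` ?S \<subseteq> (SIGMA x:?I. E x)"
    proof (rule image_subsetI)
      fix z assume z: "z \<in> ?S"
      obtain j k j' k' where z': "z = (j, k, j', k')" by (metis prod_cases4)
      have b: "{j, k, j', k'} \<subseteq> {0..<H}" "j < j'" using z by (auto simp: z' box4_def)
      have e: "(j' - j) * (B * (j + j') + \<beta>) = (k - k') * (C * (k' + k) + \<gamma>)" using eq z z' by blast
      have "0 \<le> B * (j + j')" using b pos by simp
      then have "0 < B * (j + j') + \<beta>" using pos by linarith
      then have "0 < (j' - j) * (B * (j + j') + \<beta>)" using b by simp
      then have "0 < (k - k') * (C * (k' + k) + \<gamma>)" using e by simp
      moreover have "0 \<le> C * (k' + k)" using b pos by simp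
      then have "0 < C * (k' + k) + \<gamma>" using pos by linarith
      ultimately have "k - k' > 0" by (simp add: zero_less_mult_iff)
      moreover have "j' - j dvd (k - k') * (C * (k' + k) + \<gamma>)" using e by (metis dvd_triv_left)
      then have "j' - j dvd (2 * C * (k - k')) * k' - (- ((k - k') * (C * (k - k') + \<gamma>)))"
        by (simp add: algebra_simps)
      ultimately show "?f z \<in> (SIGMA x:?I. E x)" using b by (simp add: z' E_def)
    qed
    show "finite (SIGMA x:?I. E x)" by (rule finite_SigmaI[OF _ finE]) simp
  qed
  also have "\<dots> = (\<Sum>x\<in>?I. card (E x))" using finE by (intro card_SigmaI) auto
  finally have "real (card ?S) \<le> (\<Sum>x\<in>?I. real (card (E x)))" by (simp only: of_nat_le_iff flip: of_nat_sum)
  also have "\<dots> \<le> (\<Sum>(w, r)\<in>?I. 4 * C * H / w * real_of_int (gcd r w))"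
  proof (intro sum_mono)
    fix x assume x: "x \<in> ?I"
    obtain w r where wr: "x = (w, r)" by (cases x)
    have w: "w \<ge> 1" "w \<le> H" using x wr by auto
    have "card (E x) \<le> nat (H div w + 1) * nat (gcd (2 * C * r) w)"
      unfolding E_def wr prod.case using w H by (intro card_linear_cong_interval) auto
    then have "real (card (E x)) \<le> real (nat (H div w + 1) * nat (gcd (2 * C * r) w))" by (simp only: of_nat_le_iff)
    also have "\<dots> = real_of_int (H div w + 1) * real_of_int (gcd (2 * C * r) w)"
      using w H by (simp add: pos_imp_zdiv_nonneg_iff)
    also have "\<dots> \<le> (2 * H / w) * (2 * C * real_of_int (gcd r w))"
    proof (rule mult_mono)
      have "real_of_int (H div w) \<le> H / w" by (rule real_of_int_div4)
      moreover have "1 \<le> real_of_int H / w" using w by simp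
      ultimately show "real_of_int (H div w + 1) \<le> 2 * H / w" by simp
      have "gcd (2 * C * r) w dvd (2 * C) * gcd r w"
        by (metis dvd_def gcd_mult_distrib_int gcd_greatest gcd_dvd1 gcd_dvd2 dvd_mult abs_of_pos gcd_mult_left normalize_mult dvd_normalize_iff)
      then have "gcd (2 * C * r) w \<le> (2 * C) * gcd r w" using pos w by (intro zdvd_imp_le) (auto simp: gcd_pos_int)
      then have "real_of_int (gcd (2 * C * r) w) \<le> real_of_int ((2 * C) * gcd r w)" by (simp only: of_int_le_iff)
      then show "real_of_int (gcd (2 * C * r) w) \<le> 2 * C * real_of_int (gcd r w)" by simp
    qed (use w in auto)
    finally show "real (card (E x)) \<le> (case x of (w, r) \<Rightarrow> 4 * C * H / w * real_of_int (gcd r w))"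
      by (simp add: wr field_simps)
  qed
  also have "\<dots> = (\<Sum>w\<in>{1..H}. 4 * C * H / w * (\<Sum>r\<in>{1..H}. real_of_int (gcd r w)))"
    by (simp add: sum.cartesian_product[symmetric] sum_distrib_left)
  also have "\<dots> \<le> (\<Sum>w\<in>{1..H}. 4 * C * H / w * (H * real (card {d. d > 0 \<and> d dvd w})))"
    using pos H by (intro sum_mono mult_left_mono sum_gcd_le_divisors) auto
  also have "\<dots> = 4 * C * real_of_int H ^ 2 * (\<Sum>w\<in>{1..H}. real (card {d. d > 0 \<and> d dvd w}) / w)"
    by (simp add: sum_distrib_left power2_eq_square mult_ac)
  also have "\<dots> \<le> 4 * C * real_of_int H ^ 2 * (\<Sum>d\<in>{1..H}. 1 / real_of_int d) ^ 2"
    using pos H by (intro mult_left_mono sum_divisors_over_w_le) auto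
  also have "\<dots> \<le> 4 * C * real_of_int H ^ 2 * (1 + ln H) ^ 2"
    using pos H by (intro mult_left_mono power_mono sum_inverse_int_le_ln sum_nonneg) auto
  finally show ?thesis .
qed

text \<open>The case j > j' mirrors j < j'. The case j = j' forces k = k', since \<chi> is injective
  on nonnegative arguments, and accounts for the first summand.\<close>

lemma card_\<Delta>_zero:
  assumes H: "H > 0"
  shows "real (card {z \<in> box4 H. \<Delta> z = 0}) \<le> real_of_int H ^ 2 + 8 * C * real_of_int H ^ 2 * (1 + ln H) ^ 2"
proof -
  let ?Z = "{z \<in> box4 H. \<Delta> z = 0}"
  let ?S = "{z \<in> box4 H. \<Delta> z = 0 \<and> fst z < fst (snd (snd z))}"
  let ?S' = "{z \<in> box4 H. \<Delta> z = 0 \<and> fst (snd (snd z)) < fst z}"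
  let ?E = "{z \<in> box4 H. \<Delta> z = 0 \<and> fst (snd (snd z)) = fst z}"
  have "card ?Z = card (?S \<union> ?S' \<union> ?E)" by (rule arg_cong[where f = card]) auto
  also have "\<dots> \<le> card ?S + card ?S' + card ?E" by (meson card_Un_le order_trans add_right_mono)
  also have "card ?S' \<le> card ?S"
  proof (rule card_inj_on_le[where f = "\<lambda>(j, k, j', k'). (j', k', j, k)"])
    show "(\<lambda>(j, k, j', k'). (j', k', j, k)) ` ?S' \<subseteq> ?S"
    proof (rule image_subsetI)
      fix z assume z: "z \<in> ?S'"
      obtain j k j' k' where z': "z = (j, k, j', k')" by (metis prod_cases4)
      show "(case z of (j, k, j', k') \<Rightarrow> (j', k', j, k)) \<in> ?S"
        using z qdiff_swap[of B \<beta> C \<gamma> j' k' j k] by (simp add: z' box4_def)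
    qed
  qed (simp_all add: inj_on_def split_paired_all)
  also have "card ?E \<le> card ({0..<H} \<times> {0..<H})"
  proof (rule card_inj_on_le[where f = "\<lambda>(j, k, j', k'). (j, k)"])
    show "inj_on (\<lambda>(j, k, j', k'). (j, k)) ?E"
    proof (rule inj_onI)
      fix x y assume x: "x \<in> ?E" and y: "y \<in> ?E" and f: "(\<lambda>(j, k, j', k'). (j, k)) x = (\<lambda>(j, k, j', k'). (j, k)) y"
      obtain j k j' k' where x': "x = (j, k, j', k')" by (metis prod_cases4)
      obtain l m l' m' where y': "y = (l, m, l', m')" by (metis prod_cases4)
      have "k' = k" if "quad C \<gamma> k' = quad C \<gamma> k" "0 \<le> k" "0 \<le> k'" for k k'
      proof -
        have "(k' - k) * (C * (k + k') + \<gamma>) = 0" using that(1) quad_diff[of C \<gamma> k' k] by simp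
        moreover have "C * (k + k') \<ge> 0" using that pos by simp
        ultimately show ?thesis using pos by auto
      qed
      then have "k' = k" "m' = m" using x y by (auto simp: x' y' qdiff_def box4_def)
      then show "x = y" using f x y by (simp add: x' y')
    qed
    show "(\<lambda>(j, k, j', k'). (j, k)) ` ?E \<subseteq> {0..<H} \<times> {0..<H}" by (auto simp: box4_def)
  qed simp
  finally have "card ?Z \<le> 2 * card ?S + nat H ^ 2" by (simp add: card_cartesian_product power2_eq_square)
  then have "real (card ?Z) \<le> real (2 * card ?S + nat H ^ 2)" by (simp only: of_nat_le_iff)
  also have "\<dots> = 2 * real (card ?S) + real_of_int H ^ 2" using H by simp
  finally show ?thesis using card_\<Delta>_zero_pos[OF H] by simp
qed

end

section \<open>The second moment\<close>

text \<open>Cauchy--Schwarz for the fibre sizes, whose squares add up to the number of pairs with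
  equal image.\<close>

lemma card_image_second_moment:
  assumes "finite X"
  shows "real (card X) ^ 2 \<le> real (card (g ` X)) * real (card {(x, y). x \<in> X \<and> y \<in> X \<and> g x = g y})"
proof -
  define c where "c m = card {x \<in> X. g x = m}" for m
  have X: "X = (\<Union>m\<in>g ` X. {x \<in> X. g x = m})" by auto
  have "card X = (\<Sum>m\<in>g ` X. c m)" unfolding c_def
    by (subst X, rule card_UN_disjoint) (use assms in auto)
  then have "real (card X) = (\<Sum>m\<in>g ` X. real (c m))" by simp
  then have "real (card X) ^ 2 \<le> (\<Sum>m\<in>g ` X. real (c m) ^ 2) * real (card (g ` X))"
    using sum_squared_le_sum_of_squares[of "\<lambda>m. real (c m)" "g ` X"] by simp
  moreover have "(\<Sum>m\<in>g ` X. c m ^ 2) = card {(x, y). x \<in> X \<and> y \<in> X \<and> g x = g y}"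
  proof -
    have "{(x, y). x \<in> X \<and> y \<in> X \<and> g x = g y} = (\<Union>m\<in>g ` X. {x \<in> X. g x = m} \<times> {x \<in> X. g x = m})" by auto
    also have "card \<dots> = (\<Sum>m\<in>g ` X. card ({x \<in> X. g x = m} \<times> {x \<in> X. g x = m}))"
      by (rule card_UN_disjoint) (use assms in auto)
    also have "\<dots> = (\<Sum>m\<in>g ` X. c m ^ 2)" by (simp add: c_def card_cartesian_product power2_eq_square)
    finally show ?thesis by simp
  qed
  then have "(\<Sum>m\<in>g ` X. real (c m) ^ 2) = real (card {(x, y). x \<in> X \<and> y \<in> X \<and> g x = g y})"
    by (simp flip: of_nat_power of_nat_sum)
  ultimately show ?thesis by (simp add: mult.commute)
qed

context ternary
begin

lemma finite_slice [simp]: "finite (slice P L H u)"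
  by (simp add: slice_def)

text \<open>Exchange the sums over \<open>u\<close> and over the points of the box: for a fixed
  point, the admissible \<open>u\<close> are handled by
  \<open>sum_coprime_divisor_sum_over_le\<close>. Only points with \<Delta> at least
  \<open>P1\<close> occur, and these fill at most half of the box.\<close>

lemma sum_card_slice_le:
  assumes P: "P > 0" and H: "H > 0" "\<Gamma> * H ^ 2 \<le> P * (H' - H)"
    and P1: "0 < P1" "P1 \<le> 2 * A * P - 8 * A * \<Gamma> * H'" and P2: "P2 \<ge> 2 * A * (P + L) + \<alpha> + 8 * A * \<Gamma> * H'"
    and L: "L \<ge> 0" and X: "X > (0::real)"
  shows "2 * A * (\<Sum>u\<in>{1..L}. real (card (slice P L H u))) \<le>
    real_of_int H' ^ 4 / 2 * ((real_of_int P2 / P1 - 1) * (1 + 1 / K))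
    + 2 * (real_of_int P2 / P1) * (real_of_int H' ^ 3 * (sqrt (X * P1) + 1) + real_of_int H' ^ 4 / sqrt X)"
proof -
  have "0 < \<Gamma> * H ^ 2" using \<Gamma>_pos H by simp
  then have "0 < P * (H' - H)" using H(2) by linarith
  then have HH: "H' > H" using P by (simp add: zero_less_mult_iff)
  have nn: "0 \<le> A * L" "0 \<le> A * \<Gamma> * H'" using pos L \<Gamma>_pos HH H by simp_all
  have "2 * A * (P + L) = 2 * A * P + 2 * (A * L)" by (simp add: algebra_simps)
  then have P12: "P1 \<le> P2" using P1 P2 nn pos by linarith
  define c1 where "c1 = (real_of_int P2 / P1 - 1) * (1 + 1 / K)"
  define c2 where "c2 = 2 * (real_of_int P2 / P1)"
  have c1: "c1 \<ge> 0" unfolding c1_def using P1 P12 pos by (intro mult_nonneg_nonneg) auto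
  have c2: "c2 \<ge> 0" unfolding c2_def using P1 P12 by simp
  let ?T = "\<lambda>u. {z \<in> box4 H'. P1 * u \<le> \<Delta> z \<and> \<Delta> z \<le> P2 * u}"
  let ?I = "{1..L}"
  let ?G = "{z. z \<in> box4 H' \<and> P1 \<le> \<Delta> z}"
  have "2 * A * (\<Sum>u\<in>?I. real (card (slice P L H u))) = (\<Sum>u\<in>?I. 2 * A * real (card (slice P L H u)))"
    by (simp add: sum_distrib_left)
  also have "\<dots> \<le> (\<Sum>u\<in>?I. coprime_divisor_sum Q u / u * real (card (?T u)))"
  proof (rule sum_mono)
    fix u assume u: "u \<in> ?I"
    show "2 * A * real (card (slice P L H u)) \<le> coprime_divisor_sum Q u / u * real (card (?T u))"
    proof (cases "slice P L H u = {}")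
      case True
      then show ?thesis using coprime_divisor_sum_nonneg u by (simp add: divide_nonneg_pos)
    next
      case False
      \<comment> \<open>A nonempty slice bounds \<open>u\<close>: 2APu is at most \<Delta>, hence at
        most \<Gamma>H^2, so the cube side 2Au fits into the margin H' - H.\<close>
      then obtain z i where z: "z \<in> box4 H" "P \<le> i" "quad A \<alpha> (i + u) - quad A \<alpha> i = \<Delta> z" by (auto simp: slice_def)
      have "\<Delta> z = u * (A * (2 * i + u) + \<alpha>)"
        using z(3) quad_diff[of A \<alpha> "i + u" i] by (simp add: algebra_simps)
      moreover have "A * (2 * P) \<le> A * (2 * i + u)" using z u pos by (intro mult_left_mono) auto
      then have "A * (2 * P) \<le> A * (2 * i + u) + \<alpha>" using pos by linarith
      then have "u * (A * (2 * P)) \<le> u * (A * (2 * i + u) + \<alpha>)" using u by (intro mult_left_mono) auto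
      ultimately have "u * (A * (2 * P)) \<le> P * (H' - H)" using \<Delta>_le[OF z(1) H(1)] H(2) by linarith
      then have "P * (2 * A * u) \<le> P * (H' - H)" by (simp add: mult_ac)
      then have "2 * A * u \<le> H' - H" using P by simp
      then show ?thesis using u H P1 P2 by (intro card_slice_le) auto
    qed
  qed
  also have "\<dots> = (\<Sum>u\<in>?I. \<Sum>z\<in>?T u. coprime_divisor_sum Q u / u)" by (simp add: mult.commute)
  also have "\<dots> = (\<Sum>u\<in>?I. \<Sum>z\<in>?G. if z \<in> ?T u then coprime_divisor_sum Q u / u else 0)"
  proof (rule sum.cong[OF refl])
    fix u assume u: "u \<in> ?I"
    have "?T u \<subseteq> ?G"
    proof
      fix z assume z: "z \<in> ?T u"
      have "P1 * 1 \<le> P1 * u" using u P1 by (intro mult_left_mono) auto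
      then show "z \<in> ?G" using z by simp
    qed
    then have "?G \<inter> ?T u = ?T u" by auto
    then show "(\<Sum>z\<in>?T u. coprime_divisor_sum Q u / u) = (\<Sum>z\<in>?G. if z \<in> ?T u then coprime_divisor_sum Q u / u else 0)"
      using sum.inter_restrict[of ?G "\<lambda>z. coprime_divisor_sum Q u / u" "?T u"] by simp
  qed
  also have "\<dots> = (\<Sum>z\<in>?G. \<Sum>u\<in>?I. if z \<in> ?T u then coprime_divisor_sum Q u / u else 0)" by (rule sum.swap)
  also have "\<dots> \<le> (\<Sum>z\<in>?G. c1 + c2 * sqrt (real_of_int P1 / \<Delta> z))"
  proof (rule sum_mono)
    fix z assume z: "z \<in> ?G"
    have D: "0 < \<Delta> z" using z P1 by simp
    have "(\<Sum>u\<in>?I. if z \<in> ?T u then coprime_divisor_sum Q u / u else 0) = (\<Sum>u | u \<in> ?I \<and> z \<in> ?T u. coprime_divisor_sum Q u / u)"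
      by (rule sum.inter_filter[symmetric]) simp
    also have "\<dots> \<le> (\<Sum>u | u > 0 \<and> P1 * u \<le> \<Delta> z \<and> \<Delta> z \<le> P2 * u. coprime_divisor_sum Q u / u)"
    proof (rule sum_mono2)
      show "finite {u. u > 0 \<and> P1 * u \<le> \<Delta> z \<and> \<Delta> z \<le> P2 * u}"
      proof (rule finite_subset)
        show "{u. u > 0 \<and> P1 * u \<le> \<Delta> z \<and> \<Delta> z \<le> P2 * u} \<subseteq> {0..\<Delta> z}"
        proof
          fix u assume u: "u \<in> {u. u > 0 \<and> P1 * u \<le> \<Delta> z \<and> \<Delta> z \<le> P2 * u}"
          then have "1 * u \<le> P1 * u" using P1 by (intro mult_right_mono) auto
          moreover have "0 < u" "P1 * u \<le> \<Delta> z" using u by simp_all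
          ultimately have "0 \<le> u" "u \<le> \<Delta> z" by linarith+
          then show "u \<in> {0..\<Delta> z}" by simp
        qed
      qed simp
      show "{u. u \<in> ?I \<and> z \<in> ?T u} \<subseteq> {u. u > 0 \<and> P1 * u \<le> \<Delta> z \<and> \<Delta> z \<le> P2 * u}" by auto
      show "coprime_divisor_sum Q u / real_of_int u \<ge> 0" if "u \<in> {u. u > 0 \<and> P1 * u \<le> \<Delta> z \<and> \<Delta> z \<le> P2 * u} - {u. u \<in> ?I \<and> z \<in> ?T u}" for u
        using that coprime_divisor_sum_nonneg by (simp add: divide_nonneg_pos)
    qed
    also have "\<dots> \<le> c1 + c2 * sqrt (real_of_int P1 / \<Delta> z)"
      unfolding c1_def c2_def using z by (intro sum_coprime_divisor_sum_over_le P1 P12) simp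
    finally show "(\<Sum>u\<in>?I. if z \<in> ?T u then coprime_divisor_sum Q u / u else 0) \<le> c1 + c2 * sqrt (real_of_int P1 / \<Delta> z)" .
  qed
  also have "\<dots> = real (card ?G) * c1 + c2 * (\<Sum>z\<in>?G. sqrt (real_of_int P1 / \<Delta> z))"
    by (simp add: sum.distrib sum_distrib_left)
  also have "\<dots> \<le> real_of_int H' ^ 4 / 2 * c1
      + c2 * (real_of_int H' ^ 3 * (sqrt (X * P1) + 1) + real_of_int H' ^ 4 / sqrt X)"
  proof (intro add_mono mult_right_mono mult_left_mono sum_sqrt_\<Delta>_le P1 X c1 c2)
    have "card ?G \<le> card {z \<in> box4 H'. \<Delta> z > 0}" by (rule card_mono) (use P1 in auto)
    moreover have "card (box4 H') = nat H' ^ 4" using HH H by (intro card_box4) simp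
    ultimately have "2 * card ?G \<le> nat H' ^ 4" using card_qdiff_pos_le[of H' B \<beta> C \<gamma>] by linarith
    then have "real (2 * card ?G) \<le> real (nat H' ^ 4)" by (simp only: of_nat_le_iff)
    then show "real (card ?G) \<le> real_of_int H' ^ 4 / 2" using HH H by simp
    show "H' \<ge> 0" using HH H by simp
  qed
  finally show ?thesis unfolding c1_def c2_def .
qed

definition ternary_form :: "int \<times> int \<times> int \<Rightarrow> int" where
  "ternary_form = (\<lambda>(i, j, k). quad A \<alpha> i + quad B \<beta> j + quad C \<gamma> k)"

text \<open>Later \<open>H\<close> is taken far below \<open>L\<close>: then \<open>j\<close> and
  \<open>k\<close> displace the values of \<phi> on the tile by at most \<Gamma>H^2, little compared
  with the range of \<phi> there.\<close>

definition ternary_box :: "int \<Rightarrow> int \<Rightarrow> int \<Rightarrow> (int \<times> int \<times> int) set" where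
  "ternary_box P L H = {P..<P + L} \<times> {0..<H} \<times> {0..<H}"

lemma card_ternary_box: "L \<ge> 0 \<Longrightarrow> H \<ge> 0 \<Longrightarrow> real (card (ternary_box P L H)) = L * real_of_int H ^ 2"
  by (simp add: ternary_box_def card_cartesian_product power2_eq_square)

lemma ternary_form_eq_iff:
  "ternary_form (i, j, k) = ternary_form (i', j', k') \<longleftrightarrow> quad A \<alpha> i - quad A \<alpha> i' = \<Delta> (j, k, j', k')"
  by (auto simp: ternary_form_def qdiff_def)

text \<open>Sort the pairs by u = i - i'. For u = 0 the condition is \<Delta> = 0, and the two signs
  of u correspond to each other. For u > 0 the values of u and \<Delta> determine i + i', because A
  > 0, so the map from pairs to slices is injective.\<close>

lemma second_moment_le:
  assumes P: "P > 0" and L: "L \<ge> 0"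
  shows "real (card {(x, y). x \<in> ternary_box P L H \<and> y \<in> ternary_box P L H \<and> ternary_form x = ternary_form y})
    \<le> L * real (card {z \<in> box4 H. \<Delta> z = 0}) + 2 * (\<Sum>u\<in>{1..L}. real (card (slice P L H u)))"
proof -
  let ?X = "ternary_box P L H"
  let ?N = "{(x, y). x \<in> ?X \<and> y \<in> ?X \<and> ternary_form x = ternary_form y}"
  let ?E = "{(x, y). x \<in> ?X \<and> y \<in> ?X \<and> ternary_form x = ternary_form y \<and> fst x = fst y}"
  let ?G = "{(x, y). x \<in> ?X \<and> y \<in> ?X \<and> ternary_form x = ternary_form y \<and> fst y < fst x}"
  let ?G' = "{(x, y). x \<in> ?X \<and> y \<in> ?X \<and> ternary_form x = ternary_form y \<and> fst x < fst y}"
  have finX: "finite ?X" by (simp add: ternary_box_def)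
  have fin: "finite {(x, y). x \<in> ?X \<and> y \<in> ?X \<and> R x y}" for R
    by (rule finite_subset[of _ "?X \<times> ?X"]) (use finX in auto)
  have "card ?N = card (?E \<union> ?G \<union> ?G')" by (rule arg_cong[where f = card]) auto
  also have "\<dots> \<le> card ?E + card ?G + card ?G'" by (meson card_Un_le order_trans add_right_mono)
  also have "card ?G' \<le> card ?G"
    by (rule card_inj_on_le[where f = "\<lambda>(x, y). (y, x)", OF _ _ fin]) (auto intro!: inj_onI)
  also have "card ?E \<le> card ({P..<P + L} \<times> {z \<in> box4 H. \<Delta> z = 0})"
  proof (rule card_inj_on_le[where f = "\<lambda>((i, j, k), (i', j', k')). (i, (j, k, j', k'))"])
    show "inj_on (\<lambda>((i, j, k), (i', j', k')). (i, (j, k, j', k'))) ?E"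
      by (rule inj_onI) auto
    show "(\<lambda>((i, j, k), (i', j', k')). (i, (j, k, j', k'))) ` ?E \<subseteq> {P..<P + L} \<times> {z \<in> box4 H. \<Delta> z = 0}"
      by (auto simp: ternary_form_eq_iff ternary_box_def box4_def)
  qed simp
  also have "card ?G \<le> card (SIGMA u:{1..L}. slice P L H u)"
  proof (rule card_inj_on_le[where f = "\<lambda>((i, j, k), (i', j', k')). (i - i', (j, k, j', k'))"])
    show "inj_on (\<lambda>((i, j, k), (i', j', k')). (i - i', (j, k, j', k'))) ?G"
    proof (rule inj_onI)
      fix x y assume x: "x \<in> ?G" and y: "y \<in> ?G"
        and f: "(\<lambda>((i, j, k), (i', j', k')). (i - i', (j, k, j', k'))) x = (\<lambda>((i, j, k), (i', j', k')). (i - i', (j, k, j', k'))) y"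
      obtain i j k i' j' k' where x': "x = ((i, j, k), (i', j', k'))" by (metis prod.collapse)
      obtain r l m r' l' m' where y': "y = ((r, l, m), (r', l', m'))" by (metis prod.collapse)
      have e: "i - i' = r - r'" "j = l" "k = m" "j' = l'" "k' = m'" using f by (auto simp: x' y')
      have "quad A \<alpha> i - quad A \<alpha> i' = quad A \<alpha> r - quad A \<alpha> r'"
        using x y e by (simp add: x' y' ternary_form_eq_iff)
      then have "(i - i') * (A * (i' + i) + \<alpha>) = (r - r') * (A * (r' + r) + \<alpha>)" by (simp only: quad_diff)
      then have "i' + i = r' + r" using e x pos by (simp add: x')
      then show "x = y" using e by (simp add: x' y')
    qed
    show "(\<lambda>((i, j, k), (i', j', k')). (i - i', (j, k, j', k'))) ` ?G \<subseteq> (SIGMA u:{1..L}. slice P L H u)"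
    proof (rule image_subsetI)
      fix x assume x: "x \<in> ?G"
      obtain i j k i' j' k' where x': "x = ((i, j, k), (i', j', k'))" by (metis prod.collapse)
      have "P \<le> i'" "i' + (i - i') < P + L" "quad A \<alpha> (i' + (i - i')) - quad A \<alpha> i' = \<Delta> (j, k, j', k')"
        "(j, k, j', k') \<in> box4 H" "i - i' \<in> {1..L}"
        using x by (auto simp: x' ternary_form_eq_iff ternary_box_def box4_def)
      then show "(\<lambda>((i, j, k), (i', j', k')). (i - i', (j, k, j', k'))) x \<in> (SIGMA u:{1..L}. slice P L H u)"
        by (auto simp: x' slice_def)
    qed
    show "finite (SIGMA u:{1..L}. slice P L H u)" by (rule finite_SigmaI) auto
  qed
  finally have "card ?N \<le> nat L * card {z \<in> box4 H. \<Delta> z = 0} + 2 * (\<Sum>u\<in>{1..L}. card (slice P L H u))"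
    by (simp add: card_cartesian_product)
  then have "real (card ?N) \<le> real (nat L * card {z \<in> box4 H. \<Delta> z = 0} + 2 * (\<Sum>u\<in>{1..L}. card (slice P L H u)))"
    by (simp only: of_nat_le_iff)
  then show ?thesis using L by simp
qed

end

section \<open>Missing values\<close>

text \<open>The parameter \<open>X\<close> of \<open>sum_sqrt_\<Delta>_le\<close> is sqrt G here. As
  \<open>P1\<close> grows like G, both pieces of that bound are of order G^(-1/4) relative to G^4,
  while the diagonal is of order (ln G)^2 / G.\<close>

lemma error_term_tendsto:
  fixes c1 c2 c3 c4 c5 c6 g :: real
  assumes "g > 0" "c5 > 0"
  shows "((\<lambda>G. c1 * (1 + c2 * (1 + ln (g * G)) ^ 2) / G
    + c3 * (c4 * (sqrt (sqrt G * (c5 * G)) + 1) / G + c6 / sqrt (sqrt G))) \<longlongrightarrow> 0) at_top"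
proof -
  have "((\<lambda>G. c1 * (1 + c2 * (1 + ln (g * G)) ^ 2) / G) \<longlongrightarrow> 0) at_top"
    using assms by real_asymp
  moreover have "((\<lambda>G. c3 * (c4 * (sqrt (sqrt G * (c5 * G)) + 1) / G + c6 / sqrt (sqrt G))) \<longlongrightarrow> 0) at_top"
    using assms by real_asymp
  ultimately show ?thesis using tendsto_add by force
qed

lemma main_term_tendsto:
  fixes t K :: real
  assumes "t > 0"
  shows "((\<lambda>g. ((g + 1) / g) ^ 4 * (((2 * (t + 1) * g ^ 3 + 9 * (g + 1)) / (2 * t * g ^ 3 - 8 * (g + 1)) - 1) * (1 + 1 / K)))
    \<longlongrightarrow> (1 + 1 / K) / t) at_top"
proof -
  have 1: "((\<lambda>g::real. ((g + 1) / g) ^ 4) \<longlongrightarrow> 1) at_top" by real_asymp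
  have 2: "((\<lambda>g. (2 * (t + 1) * g ^ 3 + 9 * (g + 1)) / (2 * t * g ^ 3 - 8 * (g + 1))) \<longlongrightarrow> (t + 1) / t) at_top"
    using assms by real_asymp (simp add: field_simps)
  have "((\<lambda>g. ((g + 1) / g) ^ 4 * (((2 * (t + 1) * g ^ 3 + 9 * (g + 1)) / (2 * t * g ^ 3 - 8 * (g + 1)) - 1) * (1 + 1 / K)))
    \<longlongrightarrow> 1 * (((t + 1) / t - 1) * (1 + 1 / K))) at_top"
    by (intro tendsto_intros 1 2)
  then show ?thesis using assms by (simp add: field_simps)
qed

text \<open>In the limit the left side is (1 + 1/K)/t, and (1 + 1/K)(t - 6/5) < t because t/K is at
  most 1. The shift 6/5 is more than enough for this and small enough for the constant 4 in
  \<open>eventually_missing_tiles\<close>. One \<open>g\<close> serves the finitely many t at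
  once.\<close>

lemma eventually_main_term_less:
  fixes K :: int
  assumes "K \<ge> 1"
  shows "\<exists>g\<ge>4::int. \<forall>t\<in>{2..K}. real_of_int (2 * t * g ^ 3 - 8 * (g + 1)) > 0 \<and>
    ((real_of_int g + 1) / g) ^ 4 * ((real_of_int (2 * (t + 1) * g ^ 3 + 9 * (g + 1)) / real_of_int (2 * t * g ^ 3 - 8 * (g + 1)) - 1) * (1 + 1 / K))
    < 1 / (t - 6 / 5)"
proof -
  have ev: "\<forall>\<^sub>F g in sequentially. ((real g + 1) / g) ^ 4 * (((2 * (real_of_int t + 1) * real g ^ 3 + 9 * (real g + 1)) / (2 * real_of_int t * real g ^ 3 - 8 * (real g + 1)) - 1) * (1 + 1 / K))
    < 1 / (t - 6 / 5)" if t: "t \<in> {2..K}" for t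
  proof -
    have "(1 + 1 / real_of_int K) * (t - 6 / 5) = t - 6 / 5 + t / K - 6 / 5 / K"
      using assms by (simp add: field_simps)
    moreover have "real_of_int t / K \<le> 1" "6 / 5 / real_of_int K \<ge> 0" using t assms by simp_all
    ultimately have "(1 + 1 / real_of_int K) * (t - 6 / 5) < t" by linarith
    moreover have t': "real_of_int t - 6 / 5 > 0" "real_of_int t > 0" using t by auto
    ultimately have "(1 + 1 / real_of_int K) / t < 1 / (t - 6 / 5)" by (simp add: divide_less_eq less_divide_eq mult.commute)
    with main_term_tendsto[OF t'(2), of "real_of_int K"]
    have "\<forall>\<^sub>F g in at_top. ((g + 1) / g) ^ 4 * (((2 * (real_of_int t + 1) * g ^ 3 + 9 * (g + 1)) / (2 * real_of_int t * g ^ 3 - 8 * (g + 1)) - 1) * (1 + 1 / K))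
      < 1 / (t - 6 / 5)" by (rule order_tendstoD(2))
    then show ?thesis by (rule eventually_compose_filterlim[OF _ filterlim_real_sequentially])
  qed
  have "\<forall>\<^sub>F g in sequentially. \<forall>t\<in>{2..K}. ((real g + 1) / g) ^ 4 * (((2 * (real_of_int t + 1) * real g ^ 3 + 9 * (real g + 1)) / (2 * real_of_int t * real g ^ 3 - 8 * (real g + 1)) - 1) * (1 + 1 / K))
    < 1 / (t - 6 / 5)" using ev by (intro eventually_ball_finite) auto
  from eventually_conj[OF this eventually_ge_at_top[of 4]]
  obtain g :: nat where g: "g \<ge> 4" "\<forall>t\<in>{2..K}. ((real g + 1) / g) ^ 4 * (((2 * (real_of_int t + 1) * real g ^ 3 + 9 * (real g + 1)) / (2 * real_of_int t * real g ^ 3 - 8 * (real g + 1)) - 1) * (1 + 1 / K))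
    < 1 / (t - 6 / 5)" by (auto simp: eventually_sequentially)
  show ?thesis
  proof (intro exI[of _ "int g"] conjI ballI)
    show "4 \<le> int g" using g by simp
    fix t assume t: "t \<in> {2..K}"
    have "4 * (int g * (int g * int g)) \<ge> 4 * (4 * (4 * int g))" using g by (intro mult_mono) auto
    moreover have "2 * t * int g ^ 3 \<ge> 4 * int g ^ 3" using t by (intro mult_right_mono) auto
    ultimately have "2 * t * int g ^ 3 \<ge> 64 * int g" by (simp add: power3_eq_cube)
    moreover have "int g \<ge> 4" using g(1) by simp
    moreover have "0 < x - 8 * (y + 1)" if "64 * y \<le> x" "4 \<le> y" for x y :: int using that by (simp add: algebra_simps)
    ultimately have "0 < 2 * t * int g ^ 3 - 8 * (int g + 1)" by blast
    then show "0 < real_of_int (2 * t * int g ^ 3 - 8 * (int g + 1))" by (simp only: of_int_0_less_iff)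
    show "((real_of_int (int g) + 1) / real_of_int (int g)) ^ 4 * ((real_of_int (2 * (t + 1) * int g ^ 3 + 9 * (int g + 1)) / real_of_int (2 * t * int g ^ 3 - 8 * (int g + 1)) - 1) * (1 + 1 / K))
      < 1 / (t - 6 / 5)" using g(2) t by simp
  qed
qed

context ternary
begin

definition missing :: "int \<Rightarrow> int \<Rightarrow> int set" where
  "missing a b = {m \<in> {a..<b}. m \<notin> range ternary_form}"

lemma finite_missing [simp]: "finite (missing a b)"
  by (rule finite_subset[of _ "{a..<b}"]) (auto simp: missing_def)

lemma card_missing_le: "card (missing a b) \<le> nat (b - a)"
proof -
  have "card (missing a b) \<le> card {a..<b}" by (rule card_mono) (auto simp: missing_def)
  then show ?thesis by simp
qed

lemma quad_mono: "0 \<le> i \<Longrightarrow> i \<le> i' \<Longrightarrow> quad A \<alpha> i \<le> quad A \<alpha> i'"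
  using quad_diff_ge_square[of A \<alpha> i i'] pos by (smt (verit) zero_le_power2)

text \<open>\<open>N2\<close> bounds the collisions by H^4 / (2As), so at least 2AL^2s distinct
  values occur. They lie in an interval of length \<phi>(P + L) - \<phi>(P) + \<Gamma>H^2, and what
  remains of it bounds the missing values.\<close>

lemma card_missing_second_moment:
  assumes P: "P > 0" and L: "L > 0" and H: "H > 0"
    and N2: "2 * A * real (card {(x, y). x \<in> ternary_box P L H \<and> y \<in> ternary_box P L H \<and> ternary_form x = ternary_form y}) * s \<le> real_of_int H ^ 4"
    and s: "s > 0"
  shows "real (card (missing (quad A \<alpha> P) (quad A \<alpha> (P + L))))
    \<le> quad A \<alpha> (P + L) - quad A \<alpha> P + \<Gamma> * real_of_int H ^ 2 - 2 * A * real_of_int L ^ 2 * s"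
proof -
  let ?X = "ternary_box P L H"
  let ?n = "real (card {(x, y). x \<in> ?X \<and> y \<in> ?X \<and> ternary_form x = ternary_form y})"
  let ?J = "{quad A \<alpha> P..<quad A \<alpha> (P + L) + \<Gamma> * H ^ 2}"
  have fin: "finite ?X" by (simp add: ternary_box_def)
  have "(L * real_of_int H ^ 2) ^ 2 \<le> real (card (ternary_form ` ?X)) * ?n"
    using card_image_second_moment[OF fin, of ternary_form] card_ternary_box[of L H P] L H by simp
  then have "2 * A * s * (L * real_of_int H ^ 2) ^ 2 \<le> 2 * A * s * (real (card (ternary_form ` ?X)) * ?n)"
    using s pos by (intro mult_left_mono) auto
  also have "\<dots> = real (card (ternary_form ` ?X)) * (2 * A * ?n * s)" by (simp add: mult_ac)
  also have "\<dots> \<le> real (card (ternary_form ` ?X)) * real_of_int H ^ 4" by (intro mult_left_mono N2) auto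
  finally have "(2 * A * real_of_int L ^ 2 * s) * real_of_int H ^ 4 \<le> real (card (ternary_form ` ?X)) * real_of_int H ^ 4"
    by (simp add: power_mult_distrib mult_ac flip: power_mult)
  then have lower: "2 * A * real_of_int L ^ 2 * s \<le> real (card (ternary_form ` ?X))" using H by simp
  have sub: "ternary_form ` ?X \<subseteq> ?J"
  proof (rule image_subsetI)
    fix x assume x: "x \<in> ?X"
    obtain i j k where x': "x = (i, j, k)" by (cases x)
    have b: "P \<le> i" "i < P + L" "0 \<le> j" "j < H" "0 \<le> k" "k < H" using x by (auto simp: x' ternary_box_def)
    have "quad A \<alpha> P \<le> quad A \<alpha> i" using b P by (intro quad_mono) auto
    moreover have "quad A \<alpha> (i + 1) \<le> quad A \<alpha> (P + L)" using b P by (intro quad_mono) auto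
    moreover have "quad A \<alpha> i < quad A \<alpha> (i + 1)"
      using quad_diff_ge_square[of A \<alpha> i "i + 1"] b P pos by simp
    moreover have "0 \<le> quad B \<beta> j" "quad B \<beta> j \<le> (B + \<beta>) * H ^ 2" "0 \<le> quad C \<gamma> k" "quad C \<gamma> k \<le> (C + \<gamma>) * H ^ 2"
      using b pos by (simp_all add: quad_bounds)
    moreover have "\<Gamma> * H ^ 2 = (B + \<beta>) * H ^ 2 + (C + \<gamma>) * H ^ 2" by (simp add: \<Gamma>_def algebra_simps)
    ultimately show "ternary_form x \<in> ?J" by (simp add: x' ternary_form_def)
  qed
  have pos': "quad A \<alpha> P \<le> quad A \<alpha> (P + L)" using P L by (intro quad_mono) auto
  have G0: "\<Gamma> * H ^ 2 \<ge> 0" using \<Gamma>_pos by simp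
  have "card (missing (quad A \<alpha> P) (quad A \<alpha> (P + L))) \<le> card (?J - ternary_form ` ?X)"
    using G0 by (intro card_mono) (auto simp: missing_def)
  also have "\<dots> = card ?J - card (ternary_form ` ?X)" using fin sub by (intro card_Diff_subset) auto
  finally have "real (card (missing (quad A \<alpha> P) (quad A \<alpha> (P + L)))) \<le> real (card ?J - card (ternary_form ` ?X))"
    by (simp only: of_nat_le_iff)
  also have "\<dots> = real (card ?J) - real (card (ternary_form ` ?X))" using sub by (intro of_nat_diff card_mono) auto
  also have "real (card ?J) = quad A \<alpha> (P + L) - quad A \<alpha> P + \<Gamma> * real_of_int H ^ 2" using pos' G0 by simp
  finally show ?thesis using lower by linarith
qed

text \<open>All ranges are fixed multiples of a scale \<open>G \<rightarrow> \<infinity>\<close>. The lower order terms relative to \<open>H\<^sup>4\<close> come from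
  the cubes (\<open>H' = (g + 1) G\<close>) and from the curvature of \<open>\<phi>\<close>, and vanish as \<open>g \<rightarrow> \<infinity>\<close>.\<close>
lemma eventually_second_moment:
  fixes t g :: int
  assumes t: "t \<ge> 2" and g: "g \<ge> 4"
  defines "p1 \<equiv> 2 * t * g ^ 3 - 8 * (g + 1)" and "p2 \<equiv> 2 * (t + 1) * g ^ 3 + 9 * (g + 1)"
  assumes p1: "p1 > 0"
    and less: "((real_of_int g + 1) / g) ^ 4 * ((real_of_int p2 / p1 - 1) * (1 + 1 / K)) < \<mu>"
  shows "\<forall>\<^sub>F G in sequentially. let L = \<Gamma> * g ^ 3 * int G; P = t * L; H = g * int G in
    2 * A * real (card {(x, y). x \<in> ternary_box P L H \<and> y \<in> ternary_box P L H \<and> ternary_form x = ternary_form y}) \<le> \<mu> * real_of_int H ^ 4"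
proof -
  define m where "m = ((real_of_int g + 1) / g) ^ 4 * ((real_of_int p2 / p1 - 1) * (1 + 1 / K))"
  \<comment> \<open>The diagonal and the square root terms, divided by G^4, with \<open>X\<close>
    set to sqrt G. On the same scale the main term is \<open>m * g ^ 4\<close>.\<close>
  define err where "err G = (2 * A * \<Gamma> * real_of_int g ^ 5) * (1 + (8 * C) * (1 + ln (g * G)) ^ 2) / G
    + (4 * (real_of_int p2 / p1)) * ((real_of_int g + 1) ^ 3 * (sqrt (sqrt G * ((real_of_int (A * \<Gamma> * p1)) * G)) + 1) / G + (real_of_int g + 1) ^ 4 / sqrt (sqrt G))" for G :: real
  have "(err \<longlongrightarrow> 0) at_top" unfolding err_def
    using g p1 pos \<Gamma>_pos by (intro error_term_tendsto) auto
  moreover have "0 < (\<mu> - m) * real_of_int g ^ 4" using less g unfolding m_def by simp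
  ultimately have "\<forall>\<^sub>F G in at_top. err G < (\<mu> - m) * real_of_int g ^ 4" by (rule order_tendstoD(2))
  then have "\<forall>\<^sub>F G in sequentially. err (real G) < (\<mu> - m) * real_of_int g ^ 4"
    by (rule eventually_compose_filterlim[OF _ filterlim_real_sequentially])
  then show ?thesis using eventually_ge_at_top[of "nat \<alpha> + 1"]
  proof eventually_elim
    case (elim G)
    define L where "L = \<Gamma> * g ^ 3 * int G"
    define P where "P = t * L"
    define H where "H = g * int G"
    define H' where "H' = (g + 1) * int G"
    define P1 where "P1 = A * \<Gamma> * p1 * int G"
    define P2 where "P2 = A * \<Gamma> * p2 * int G"
    have G: "int G > 0" "int G \<ge> \<alpha>" using elim(2) by auto
    have G': "real G > 0" using G by simp
    have L0: "L > 0" using G g \<Gamma>_pos by (simp add: L_def)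
    have P0: "P > 0" using L0 t by (simp add: P_def)
    have H0: "H > 0" "H' > 0" using G g by (simp_all add: H_def H'_def)
    let ?Z = "real (card {z \<in> box4 H. \<Delta> z = 0})"
    let ?S = "\<Sum>u\<in>{1..L}. real (card (slice P L H u))"
    let ?n = "real (card {(x, y). x \<in> ternary_box P L H \<and> y \<in> ternary_box P L H \<and> ternary_form x = ternary_form y})"
    have S: "2 * A * ?S \<le> real_of_int H' ^ 4 / 2 * ((real_of_int P2 / P1 - 1) * (1 + 1 / K))
      + 2 * (real_of_int P2 / P1) * (real_of_int H' ^ 3 * (sqrt (sqrt (real G) * P1) + 1) + real_of_int H' ^ 4 / sqrt (sqrt (real G)))"
    proof (rule sum_card_slice_le[OF P0 H0(1)])
      have "1 * (\<Gamma> * g ^ 2 * int G ^ 2) \<le> t * g * (\<Gamma> * g ^ 2 * int G ^ 2)"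
      proof (rule mult_right_mono)
        show "1 \<le> t * g" using t g by (metis mult_mono mult_1 one_le_numeral order_trans zero_le_one zero_le_numeral)
      qed (use \<Gamma>_pos g in simp)
      then show "\<Gamma> * H ^ 2 \<le> P * (H' - H)"
        by (simp add: P_def L_def H_def H'_def algebra_simps power2_eq_square power3_eq_cube)
      show "0 < P1" using pos \<Gamma>_pos p1 G by (simp add: P1_def)
      show "P1 \<le> 2 * A * P - 8 * A * \<Gamma> * H'"
        by (simp add: P1_def p1_def P_def L_def H'_def algebra_simps)
      \<comment> \<open>The coefficient 9 in \<open>p2\<close> is the 8 needed for the cubes plus
        one more that absorbs \<alpha>, as G is at least \<alpha>.\<close>
      have "1 * \<alpha> \<le> (A * \<Gamma> * (g + 1)) * int G"
      proof (rule mult_mono)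
        have "0 < A * \<Gamma> * (g + 1)" using pos \<Gamma>_pos g by simp
        then show "1 \<le> A * \<Gamma> * (g + 1)" by simp
      qed (use G pos \<Gamma>_pos g in auto)
      moreover have "P2 = 2 * A * (P + L) + 8 * A * \<Gamma> * H' + (A * \<Gamma> * (g + 1)) * int G"
        by (simp add: P2_def p2_def P_def L_def H'_def algebra_simps)
      ultimately show "2 * A * (P + L) + \<alpha> + 8 * A * \<Gamma> * H' \<le> P2" by linarith
    qed (use L0 G in auto)
    have ratio: "real_of_int P2 / P1 = real_of_int p2 / p1"
      using pos \<Gamma>_pos G p1 by (simp add: P1_def P2_def)
    have Z: "?Z \<le> real_of_int H ^ 2 * (1 + 8 * C * (1 + ln H) ^ 2)"
      using card_\<Delta>_zero[OF H0(1)] by (simp add: algebra_simps)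
    have "2 * A * ?n \<le> 2 * A * (L * ?Z + 2 * ?S)"
      using second_moment_le[OF P0, of L H] L0 pos by (intro mult_left_mono) auto
    also have "\<dots> = 2 * A * L * ?Z + 2 * (2 * A * ?S)" by (simp add: algebra_simps)
    also have "\<dots> \<le> 2 * A * L * (real_of_int H ^ 2 * (1 + 8 * C * (1 + ln H) ^ 2))
      + 2 * (real_of_int H' ^ 4 / 2 * ((real_of_int p2 / p1 - 1) * (1 + 1 / K))
      + 2 * (real_of_int p2 / p1) * (real_of_int H' ^ 3 * (sqrt (sqrt (real G) * P1) + 1) + real_of_int H' ^ 4 / sqrt (sqrt (real G))))"
      using S Z L0 pos unfolding ratio by (intro add_mono mult_left_mono) auto
    also have "\<dots> = (m * real_of_int g ^ 4 + err (real G)) * real G ^ 4"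
    proof -
      have T: "2 * A * L * (real_of_int H ^ 2 * (1 + 8 * C * (1 + ln H) ^ 2))
          = (2 * A * \<Gamma> * real_of_int g ^ 5) * (1 + (8 * C) * (1 + ln (g * real G)) ^ 2) / real G * real G ^ 4"
        using G' by (simp add: L_def H_def eval_nat_numeral)
      have h: "real_of_int H' ^ 4 = (real_of_int g + 1) ^ 4 * real G ^ 4"
        "real_of_int H' ^ 3 = (real_of_int g + 1) ^ 3 / real G * real G ^ 4"
        using G' by (simp_all add: H'_def power_mult_distrib eval_nat_numeral)
      have m: "m * real_of_int g ^ 4 = (real_of_int g + 1) ^ 4 * ((real_of_int p2 / p1 - 1) * (1 + 1 / K))"
        unfolding m_def using g by (simp add: power_divide)
      have P1: "real_of_int P1 = real_of_int (A * \<Gamma> * p1) * real G" by (simp add: P1_def)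
      have "c * Y / x * y + 2 * (u * y / 2 * M + 2 * r * (v / x * y * s + u * y / q))
          = (u * M + (c * Y / x + (4 * r) * (v * s / x + u / q))) * y" for c Y x y u M r v s q :: real
        by (simp add: algebra_simps)
      then show ?thesis unfolding err_def T h m P1 .
    qed
    also have "\<dots> \<le> (\<mu> * real_of_int g ^ 4) * real G ^ 4"
      using elim(1) by (intro mult_right_mono) (auto simp: algebra_simps)
    also have "\<dots> = \<mu> * real_of_int H ^ 4" by (simp add: H_def power_mult_distrib)
    finally show ?case unfolding Let_def L_def P_def H_def .
  qed
qed


lemma quad_tile: "quad A \<alpha> (t * L + L) - quad A \<alpha> (t * L) = A * (2 * t + 1) * L ^ 2 + \<alpha> * L"
  by (simp add: quad_def algebra_simps power2_eq_square)

text \<open>For t at least 2 a tile misses at most (17/5)AL^2 + \<alpha>L + \<Gamma>H^2 values. The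
  last two terms are at most AL^2/2 and AL^2/16, so 4AL^2 suffices. For t = 0 and t = 1 this bound
  holds for the number of all integers in the image range of the tile. The total is linear in
  \<open>K\<close>, whereas the whole range has length about AK^2L^2.\<close>

lemma eventually_missing_tiles:
  obtains l :: int and G0 :: nat where "l > 0"
    "\<And>G. G \<ge> G0 \<Longrightarrow> real (card (missing 0 (quad A \<alpha> (K * (l * int G))))) \<le> 4 * A * K * real_of_int (l * int G) ^ 2"
proof -
  obtain g :: int where g: "g \<ge> 4" and
    p1: "\<And>t. t \<in> {2..K} \<Longrightarrow> 2 * t * g ^ 3 - 8 * (g + 1) > 0" and
    mt: "\<And>t. t \<in> {2..K} \<Longrightarrow> ((real_of_int g + 1) / g) ^ 4 *
      ((real_of_int (2 * (t + 1) * g ^ 3 + 9 * (g + 1)) / real_of_int (2 * t * g ^ 3 - 8 * (g + 1)) - 1) * (1 + 1 / K)) < 1 / (t - 6 / 5)"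
    using eventually_main_term_less[of K] pos(8) by (auto simp del: of_int_diff of_int_add of_int_mult)
  define l where "l = \<Gamma> * g ^ 3"
  have l0: "l > 0" using \<Gamma>_pos g by (simp add: l_def)
  define good where "good t G \<longleftrightarrow> 2 * A * real (card {(x, y). x \<in> ternary_box (t * (l * int G)) (l * int G) (g * int G)
      \<and> y \<in> ternary_box (t * (l * int G)) (l * int G) (g * int G) \<and> ternary_form x = ternary_form y}) \<le> 1 / (t - 6 / 5) * real_of_int (g * int G) ^ 4"
    for t :: int and G :: nat
  have "\<forall>\<^sub>F G in sequentially. \<forall>t\<in>{2..K}. good t G"
  proof (intro eventually_ball_finite ballI)
    fix t assume t: "t \<in> {2..K}"
    then have "t \<ge> 2" by simp
    from eventually_second_moment[OF this g p1[OF t] mt[OF t]]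
    show "\<forall>\<^sub>F G in sequentially. good t G" unfolding Let_def good_def l_def .
  qed simp
  from eventually_conj[OF this eventually_ge_at_top[of "nat (2 * \<alpha>) + 1"]]
  obtain G0 where "\<And>G. G \<ge> G0 \<Longrightarrow> (\<forall>t\<in>{2..K}. good t G) \<and> G \<ge> nat (2 * \<alpha>) + 1"
    unfolding eventually_sequentially by blast
  then have G0: "\<And>G. G \<ge> G0 \<Longrightarrow> G \<ge> nat (2 * \<alpha>) + 1" "\<And>G t. G \<ge> G0 \<Longrightarrow> t \<in> {2..K} \<Longrightarrow> good t G"
    by blast+
  have "real (card (missing 0 (quad A \<alpha> (K * (l * int G))))) \<le> 4 * A * K * real_of_int (l * int G) ^ 2" if G: "G \<ge> G0" for G
  proof -
    define L where "L = l * int G"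
    define H where "H = g * int G"
    have Gp: "int G > 0" "2 * \<alpha> \<le> int G" using G0(1)[OF G] by auto
    have L0: "L > 0" using l0 Gp by (simp add: L_def)
    have H0: "H > 0" using g Gp by (simp add: H_def)
    have "1 * int G \<le> l * int G" using l0 Gp by (intro mult_right_mono) auto
    then have "2 * \<alpha> \<le> L" using Gp(2) unfolding L_def by linarith
    then have "2 * \<alpha> * L \<le> L * L" using L0 by (intro mult_right_mono) auto
    moreover have AL: "1 * L ^ 2 \<le> A * L ^ 2" using pos by (intro mult_right_mono) auto
    ultimately have aL: "2 * (\<alpha> * L) \<le> A * L ^ 2" by (simp add: power2_eq_square)
    have HL: "16 * (\<Gamma> * H ^ 2) \<le> A * L ^ 2"
    proof -
      have "4 ^ 4 \<le> g ^ 4" using g by (intro power_mono) auto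
      then have "16 * 1 \<le> g ^ 4 * \<Gamma>" using \<Gamma>_pos by (intro mult_mono) auto
      then have "16 * (\<Gamma> * g ^ 2 * int G ^ 2) \<le> (g ^ 4 * \<Gamma>) * (\<Gamma> * g ^ 2 * int G ^ 2)"
        using \<Gamma>_pos g by (intro mult_right_mono) auto
      also have "\<dots> = L ^ 2"
        by (simp only: L_def l_def power4_eq_xxxx power3_eq_cube power2_eq_square mult_ac)
      finally show ?thesis using AL by (simp add: H_def power_mult_distrib mult_ac)
    qed
    have aL': "2 * (\<alpha> * real_of_int L) \<le> A * real_of_int L ^ 2" "16 * (\<Gamma> * real_of_int H ^ 2) \<le> A * real_of_int L ^ 2"
    proof -
      have "real_of_int (2 * (\<alpha> * L)) \<le> real_of_int (A * L ^ 2)" "real_of_int (16 * (\<Gamma> * H ^ 2)) \<le> real_of_int (A * L ^ 2)"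
        using aL HL by (simp_all only: of_int_le_iff)
      then show "2 * (\<alpha> * real_of_int L) \<le> A * real_of_int L ^ 2" "16 * (\<Gamma> * real_of_int H ^ 2) \<le> A * real_of_int L ^ 2"
        by simp_all
    qed
    have tile: "real (card (missing (quad A \<alpha> (t * L)) (quad A \<alpha> (t * L + L)))) \<le> 4 * A * real_of_int L ^ 2" if t: "t \<in> {0..K - 1}" for t
    proof (cases "t \<ge> 2")
      case True
      have s: "real_of_int t - 6 / 5 > 0" using True by simp
      have "2 * A * real (card {(x, y). x \<in> ternary_box (t * L) L H \<and> y \<in> ternary_box (t * L) L H \<and> ternary_form x = ternary_form y}) * (real_of_int t - 6 / 5)
          \<le> real_of_int H ^ 4"
        using G0(2)[OF G, of t] True t s by (simp add: good_def L_def H_def field_simps)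
      moreover have "t * L > 0" using True L0 by simp
      ultimately have "real (card (missing (quad A \<alpha> (t * L)) (quad A \<alpha> (t * L + L))))
        \<le> real_of_int (quad A \<alpha> (t * L + L)) - quad A \<alpha> (t * L) + \<Gamma> * real_of_int H ^ 2 - 2 * A * real_of_int L ^ 2 * (real_of_int t - 6 / 5)"
        using card_missing_second_moment[of "t * L" L H "real_of_int t - 6 / 5"] L0 H0 s by simp
      also have "real_of_int (quad A \<alpha> (t * L + L)) - quad A \<alpha> (t * L) = A * (2 * t + 1) * real_of_int L ^ 2 + \<alpha> * real_of_int L"
        using quad_tile[of t L] by (simp flip: of_int_diff)
      also have "A * (2 * t + 1) * real_of_int L ^ 2 + \<alpha> * real_of_int L + \<Gamma> * real_of_int H ^ 2 - 2 * A * real_of_int L ^ 2 * (real_of_int t - 6 / 5)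
         = 17 / 5 * (A * real_of_int L ^ 2) + \<alpha> * real_of_int L + \<Gamma> * real_of_int H ^ 2" by (simp add: algebra_simps)
      also have "\<dots> \<le> 4 * (A * real_of_int L ^ 2)"
      proof -
        have "0 \<le> A * real_of_int L ^ 2" using pos by simp
        then show ?thesis using aL' by linarith
      qed
      finally show ?thesis by simp
    next
      case False
      have "card (missing (quad A \<alpha> (t * L)) (quad A \<alpha> (t * L + L))) \<le> nat (quad A \<alpha> (t * L + L) - quad A \<alpha> (t * L))"
        by (rule card_missing_le)
      also have "\<dots> = nat (A * (2 * t + 1) * L ^ 2 + \<alpha> * L)" by (simp only: quad_tile)
      also have "\<dots> \<le> nat (4 * (A * L ^ 2))"
      proof (rule nat_mono)
        have "A * L ^ 2 * (2 * t + 1) \<le> A * L ^ 2 * 3" using False pos by (intro mult_left_mono) auto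
        moreover have "0 \<le> \<alpha> * L" using pos L0 by simp
        ultimately show "A * (2 * t + 1) * L ^ 2 + \<alpha> * L \<le> 4 * (A * L ^ 2)" using aL by (simp add: mult_ac)
      qed
      finally have "real (card (missing (quad A \<alpha> (t * L)) (quad A \<alpha> (t * L + L)))) \<le> real (nat (4 * (A * L ^ 2)))"
        by (simp only: of_nat_le_iff)
      then show ?thesis using pos by simp
    qed
    have "real (card (missing 0 (quad A \<alpha> (int n * L)))) \<le> n * (4 * A * real_of_int L ^ 2)" if "int n \<le> K" for n
      using that
    proof (induction n)
      case 0
      have "missing 0 0 = {}" by (auto simp: missing_def)
      then show ?case by (simp add: quad_def)
    next
      case (Suc n)
      have e: "int (Suc n) * L = int n * L + L" by (simp add: algebra_simps)
      have "missing 0 (quad A \<alpha> (int (Suc n) * L)) \<subseteq> missing 0 (quad A \<alpha> (int n * L)) \<union> missing (quad A \<alpha> (int n * L)) (quad A \<alpha> (int n * L + L))"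
        unfolding e by (auto simp: missing_def)
      then have "card (missing 0 (quad A \<alpha> (int (Suc n) * L))) \<le> card (missing 0 (quad A \<alpha> (int n * L)) \<union> missing (quad A \<alpha> (int n * L)) (quad A \<alpha> (int n * L + L)))"
        by (intro card_mono) auto
      also have "\<dots> \<le> card (missing 0 (quad A \<alpha> (int n * L))) + card (missing (quad A \<alpha> (int n * L)) (quad A \<alpha> (int n * L + L)))"
        by (rule card_Un_le)
      finally have "real (card (missing 0 (quad A \<alpha> (int (Suc n) * L)))) \<le>
          real (card (missing 0 (quad A \<alpha> (int n * L)))) + real (card (missing (quad A \<alpha> (int n * L)) (quad A \<alpha> (int n * L + L))))"
        by linarith
      moreover have "real (card (missing (quad A \<alpha> (int n * L)) (quad A \<alpha> (int n * L + L)))) \<le> 4 * A * real_of_int L ^ 2"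
        using Suc.prems by (intro tile) auto
      ultimately show ?case using Suc by (simp add: algebra_simps)
    qed
    from this[of "nat K"] show ?thesis using pos(8) by (simp add: L_def mult_ac)
  qed
  with l0 show ?thesis by (rule that)
qed

text \<open>A general N lies between consecutive endpoints, h(G - 1) < N \<le> h(G). As G - 1 is at
  least G/2, this costs a factor 4 and turns 4/K into 16/K.\<close>

theorem eventually_card_missing_le:
  "\<forall>\<^sub>F N in sequentially. real (card (missing 0 (int N))) \<le> 16 / K * N"
proof -
  obtain l G0 where l0: "l > 0" and
    G0: "\<And>G. G \<ge> G0 \<Longrightarrow> real (card (missing 0 (quad A \<alpha> (K * (l * int G))))) \<le> 4 * A * K * real_of_int (l * int G) ^ 2"
    by (rule eventually_missing_tiles) blast
  define h where "h G = quad A \<alpha> (K * (l * int G))" for G :: nat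
  define G1 where "G1 = max G0 2"
  show ?thesis using eventually_ge_at_top[of "nat (h G1) + 1"]
  proof eventually_elim
    case (elim N)
    have Kl: "K * l > 0" using l0 pos by simp
    have hge: "int G \<le> h G" for G
    proof -
      have "1 * int G \<le> (K * l) * int G" using Kl by (intro mult_right_mono) auto
      moreover have "1 * (K * (l * int G)) \<le> \<alpha> * (K * (l * int G))" using l0 pos by (intro mult_right_mono) auto
      moreover have "0 \<le> A * (K * (l * int G)) ^ 2" using pos by simp
      ultimately show ?thesis by (simp add: h_def quad_def mult.assoc)
    qed
    define G where "G = (LEAST G. int N \<le> h G)"
    have G: "int N \<le> h G" unfolding G_def by (rule LeastI_ex) (use hge in blast)
    have hmono: "h x \<le> h y" if "x \<le> y" for x y
      unfolding h_def using that l0 pos by (intro quad_mono mult_left_mono) auto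
    have "G > G1"
    proof (rule ccontr)
      assume "\<not> G > G1"
      then have "h G \<le> h G1" by (intro hmono) simp
      then show False using G elim by simp
    qed
    then have G2: "G \<ge> G0" "G \<ge> 2" by (auto simp: G1_def)
    have "\<not> int N \<le> h (G - 1)" unfolding G_def by (rule not_less_Least) (use G2 G_def in simp)
    then have "h (G - 1) < int N" by simp
    moreover have "A * (K * (l * int (G - 1))) ^ 2 \<le> h (G - 1)" using l0 pos by (simp add: h_def quad_def)
    ultimately have "real_of_int (A * (K * (l * int (G - 1))) ^ 2) \<le> real_of_int (int N)" by (simp only: of_int_le_iff)
    then have N: "A * (K * (l * real (G - 1))) ^ 2 \<le> real N" by simp
    have "A * (K * (l * (real G / 2))) ^ 2 \<le> A * (K * (l * real (G - 1))) ^ 2"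
      using G2 l0 pos by (intro mult_left_mono power_mono) (auto simp: of_nat_diff)
    with N have N2: "A * (K * (l * (real G / 2))) ^ 2 \<le> real N" by linarith
    have "card (missing 0 (int N)) \<le> card (missing 0 (h G))"
      using G by (intro card_mono finite_missing) (auto simp: missing_def)
    then have "real (card (missing 0 (int N))) \<le> 4 * A * K * real_of_int (l * int G) ^ 2"
      using G0[OF G2(1)] by (simp add: h_def)
    also have "\<dots> = 16 / K * (A * (K * (l * (real G / 2))) ^ 2)"
      using pos by (simp add: power2_eq_square field_simps)
    also have "\<dots> \<le> 16 / K * real N" using N2 pos by (intro mult_left_mono) auto
    finally show ?case .
  qed
qed

end

section \<open>Local solvability\<close>

text \<open>Nonsingularity is required in the last two variables only: the first variable plays a special role
  in the second moment.\<close>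
definition nonsingular_solution :: "int \<Rightarrow> int \<Rightarrow> int \<Rightarrow> int \<Rightarrow> int \<Rightarrow> bool" where
  "nonsingular_solution p a b c n \<longleftrightarrow> (\<exists>x y z. p dvd tri_form a b c x y z - n \<and> \<not> (p dvd b * (2 * y + 1) \<and> p dvd c * (2 * z + 1)))"

text \<open>Completing the square by 8 T_u + 1 = (2u + 1)^2; at odd primes local questions thus
  concern a diagonal quadratic form.\<close>

lemma eight_tri_form:
  "8 * tri_form a b c x y z = a * (2 * x + 1) ^ 2 + b * (2 * y + 1) ^ 2 + c * (2 * z + 1) ^ 2 - (a + b + c)"
proof -
  have "8 * triangular u = (2 * u + 1) ^ 2 - 1" for u
    using two_times_triangular[of u] by (simp add: power2_eq_square algebra_simps)
  then have "a * (8 * triangular x) + b * (8 * triangular y) + c * (8 * triangular z)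
    = a * ((2 * x + 1) ^ 2 - 1) + b * ((2 * y + 1) ^ 2 - 1) + c * ((2 * z + 1) ^ 2 - 1)" by simp
  then show ?thesis unfolding tri_form_def by (simp add: algebra_simps)
qed

lemma odd_prime_not_dvd_2:
  fixes p :: int
  assumes "prime p" "p \<noteq> 2"
  shows "\<not> p dvd 2" "\<not> p dvd 4" "\<not> p dvd 8"
proof -
  show 2: "\<not> p dvd 2"
    using assms primes_dvd_imp_eq[of p 2] by auto
  have "(4::int) = 2 * 2" "(8::int) = 2 * (2 * 2)" by simp_all
  then show "\<not> p dvd 4" "\<not> p dvd 8" using 2 assms(1) by (metis prime_dvd_multD)+
qed

lemma prime_inverse_mod:
  fixes p x :: int
  assumes "prime p" "\<not> p dvd x"
  obtains y where "p dvd x * y - 1"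
proof -
  have "coprime x p" using assms prime_imp_coprime coprime_commute by blast
  then obtain y where "[x * y = 1] (mod p)" using cong_solve_coprime_int by blast
  then show ?thesis using that by (simp add: cong_iff_dvd_diff)
qed

text \<open>Modulo an odd prime every residue has the form 2x + 1, so \<open>X\<close>,
  \<open>Y\<close>, \<open>Z\<close> are unrestricted.\<close>

lemma nonsingular_solutionI:
  fixes p :: int
  assumes p: "prime p" "p \<noteq> 2" and d: "p dvd a * X ^ 2 + b * Y ^ 2 + c * Z ^ 2 - (8 * n + (a + b + c))"
    and ns: "\<not> (p dvd b * Y \<and> p dvd c * Z)"
  shows "nonsingular_solution p a b c n"
proof -
  obtain h where h: "p dvd 2 * h - 1" using prime_inverse_mod[OF p(1) odd_prime_not_dvd_2(1)[OF p]] by blast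
  have c: "[2 * ((X - 1) * h) + 1 = X] (mod p)" for X
  proof -
    have "2 * ((X - 1) * h) + 1 - X = (X - 1) * (2 * h - 1)" by (simp add: algebra_simps)
    then show ?thesis using h by (simp add: cong_iff_dvd_diff)
  qed
  let ?x = "(X - 1) * h" and ?y = "(Y - 1) * h" and ?z = "(Z - 1) * h"
  have "[a * (2 * ?x + 1) ^ 2 + b * (2 * ?y + 1) ^ 2 + c * (2 * ?z + 1) ^ 2 = a * X ^ 2 + b * Y ^ 2 + c * Z ^ 2] (mod p)"
    by (intro cong_add cong_mult cong_pow c cong_refl)
  moreover have "[a * X ^ 2 + b * Y ^ 2 + c * Z ^ 2 = 8 * n + (a + b + c)] (mod p)" using d by (simp add: cong_iff_dvd_diff)
  ultimately have "[a * (2 * ?x + 1) ^ 2 + b * (2 * ?y + 1) ^ 2 + c * (2 * ?z + 1) ^ 2 = 8 * n + (a + b + c)] (mod p)"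
    by (rule cong_trans)
  then have "p dvd 8 * tri_form a b c ?x ?y ?z - 8 * n"
    unfolding eight_tri_form cong_iff_dvd_diff by (simp add: algebra_simps)
  then have "p dvd 8 * (tri_form a b c ?x ?y ?z - n)" by (simp add: algebra_simps)
  then have "p dvd tri_form a b c ?x ?y ?z - n" using p odd_prime_not_dvd_2(3)[OF p] by (metis prime_dvd_multD)
  moreover have "[b * (2 * ?y + 1) = b * Y] (mod p)" "[c * (2 * ?z + 1) = c * Z] (mod p)"
    by (intro cong_mult c cong_refl)+
  then have "\<not> (p dvd b * (2 * ?y + 1) \<and> p dvd c * (2 * ?z + 1))"
    using ns by (simp add: cong_dvd_iff)
  ultimately show ?thesis unfolding nonsingular_solution_def by blast
qed

lemma nonsingular_solution_swap: "nonsingular_solution p a b c n \<longleftrightarrow> nonsingular_solution p a c b n"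
proof -
  have "tri_form a b c x y z = tri_form a c b x z y" for b c x y z by (simp add: tri_form_def)
  then show ?thesis unfolding nonsingular_solution_def by metis
qed

text \<open>Pigeonhole: a X^2 and m - c Z^2 each take (p + 1)/2 values modulo \<open>p\<close>, so
  the two sets of values meet.\<close>

lemma binary_form_surj_mod:
  fixes p a c m :: int
  assumes p: "prime p" "p \<noteq> 2" and a: "\<not> p dvd a" and c: "\<not> p dvd c"
  shows "\<exists>X Z. p dvd a * X ^ 2 + c * Z ^ 2 - m"
proof -
  have p2: "p > 2" using p prime_ge_2_int[of p] by simp
  have "odd p" using p prime_odd_int p2 by blast
  then obtain h where h: "p = 2 * h + 1" by (elim oddE)
  have h0: "h \<ge> 0" using h p2 by simp
  let ?I = "{0..h}"
  have sq: "x = y" if "p dvd a * x ^ 2 - a * y ^ 2" "\<not> p dvd a" "x \<in> ?I" "y \<in> ?I" for a x y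
  proof -
    have "a * x ^ 2 - a * y ^ 2 = a * ((x - y) * (x + y))" by (simp add: algebra_simps power2_eq_square)
    then have "p dvd (x - y) * (x + y)" using that(1,2) p by (metis prime_dvd_multD)
    then have "p dvd x - y \<or> p dvd x + y" using p by (simp add: prime_dvd_mult_iff)
    then show ?thesis
    proof
      assume "p dvd x - y"
      then have "x mod p = y mod p" by (simp add: mod_eq_dvd_iff)
      then show ?thesis using that h by simp
    next
      assume d: "p dvd x + y"
      have "x + y < p" using that h by simp
      then have "\<not> x + y > 0" using d zdvd_imp_le by fastforce
      then show ?thesis using that by simp
    qed
  qed
  let ?f = "\<lambda>x. (a * x ^ 2) mod p" and ?g = "\<lambda>z. (m - c * z ^ 2) mod p"
  have f: "inj_on ?f ?I"
    by (rule inj_onI) (use sq a in \<open>auto simp: mod_eq_dvd_iff\<close>)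
  have g: "inj_on ?g ?I"
  proof (rule inj_onI)
    fix x y assume xy: "x \<in> ?I" "y \<in> ?I" "?g x = ?g y"
    then have "p dvd c * y ^ 2 - c * x ^ 2" by (simp add: mod_eq_dvd_iff algebra_simps)
    then show "x = y" using sq[of c y x] c xy by simp
  qed
  have "?f ` ?I \<inter> ?g ` ?I \<noteq> {}"
  proof
    assume "?f ` ?I \<inter> ?g ` ?I = {}"
    then have "card (?f ` ?I \<union> ?g ` ?I) = card (?f ` ?I) + card (?g ` ?I)" by (intro card_Un_disjoint) auto
    also have "\<dots> = 2 * nat (h + 1)" using f g by (simp add: card_image)
    finally have "card (?f ` ?I \<union> ?g ` ?I) = 2 * nat (h + 1)" .
    moreover have "card (?f ` ?I \<union> ?g ` ?I) \<le> card {0..<p}"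
      by (rule card_mono) (use p2 in auto)
    ultimately show False using h h0 by simp
  qed
  then obtain X Z where "(a * X ^ 2) mod p = (m - c * Z ^ 2) mod p" by auto
  then have "p dvd a * X ^ 2 - (m - c * Z ^ 2)" by (simp add: mod_eq_dvd_iff)
  then show ?thesis by (intro exI[of _ X] exI[of _ Z]) (simp add: algebra_simps)
qed

text \<open>Y = 1 secures nonsingularity, and the other two variables supply the required
  residue.\<close>

lemma nonsingular_solution_generic:
  assumes "prime p" "p \<noteq> 2" "\<not> p dvd a" "\<not> p dvd b" "\<not> p dvd c"
  shows "nonsingular_solution p a b c n"
proof -
  obtain X Z where "p dvd a * X ^ 2 + c * Z ^ 2 - (8 * n + (a + b + c) - b)"
    using binary_form_surj_mod assms by blast
  then have "p dvd a * X ^ 2 + b * 1 ^ 2 + c * Z ^ 2 - (8 * n + (a + b + c))" by (simp add: algebra_simps)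
  then show ?thesis by (rule nonsingular_solutionI[OF assms(1,2)]) (use assms in simp)
qed

text \<open>Modulo \<open>p\<close> the form \<open>b Y\<^sup>2 + c Z\<^sup>2\<close> splits as \<open>(b Y - h Z) (b Y + h Z) / b\<close>; \<open>s\<close> and \<open>s'\<close> are the
  prescribed values of the two factors.\<close>
lemma split_form_solution:
  fixes p b c h m s s' :: int
  assumes p: "prime p" "p \<noteq> 2" and b: "\<not> p dvd b" and c: "\<not> p dvd c" and h: "p dvd h ^ 2 + b * c"
    and s: "p dvd s * s' - b * m"
  obtains Y Z where "p dvd b * Y ^ 2 + c * Z ^ 2 - m" "p dvd 2 * b * Y - (s + s')" "p dvd 2 * h * Z - (s' - s)"
proof -
  have nh: "\<not> p dvd h"
  proof
    assume "p dvd h"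
    then have "p dvd h ^ 2" by (simp add: power2_eq_square)
    then have "p dvd b * c" using h by (simp add: dvd_add_right_iff)
    then show False using p b c by (simp add: prime_dvd_mult_iff)
  qed
  have "\<not> p dvd 2 * b" "\<not> p dvd 2 * h" using p b nh odd_prime_not_dvd_2(1)[OF p] by (simp_all add: prime_dvd_mult_iff)
  then obtain u v where u: "p dvd (2 * b) * u - 1" and v: "p dvd (2 * h) * v - 1" using prime_inverse_mod[OF p(1)] by metis
  define Y where "Y = (s + s') * u"
  define Z where "Z = (s' - s) * v"
  have "2 * b * Y - (s + s') = (s + s') * ((2 * b) * u - 1)" by (simp add: Y_def algebra_simps)
  then have Y: "p dvd 2 * b * Y - (s + s')" using u by simp
  have "2 * h * Z - (s' - s) = (s' - s) * ((2 * h) * v - 1)" by (simp add: Z_def algebra_simps)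
  then have Z: "p dvd 2 * h * Z - (s' - s)" using v by simp
  have "(4 * b) * (b * Y ^ 2 + c * Z ^ 2 - m)
      = (2 * b * Y - (s + s')) * (2 * b * Y + (s + s')) - (2 * h * Z - (s' - s)) * (2 * h * Z + (s' - s))
        + (h ^ 2 + b * c) * (4 * Z ^ 2) + 4 * (s * s' - b * m)"
    by (simp add: algebra_simps power2_eq_square)
  also have "p dvd \<dots>" by (rule dvd_add[OF dvd_add[OF dvd_diff[OF dvd_mult2[OF Y] dvd_mult2[OF Z]] dvd_mult2[OF h]] dvd_mult[OF s]])
  finally have "p dvd (4 * b) * (b * Y ^ 2 + c * Z ^ 2 - m)" .
  moreover have "\<not> p dvd 4 * b" using p b odd_prime_not_dvd_2(2)[OF p] by (simp add: prime_dvd_mult_iff)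
  ultimately have "p dvd b * Y ^ 2 + c * Z ^ 2 - m" using p by (metis prime_dvd_multD)
  with Y Z show ?thesis using that by blast
qed

text \<open>Prescribe the two factors as 1 and \<open>b * ?m\<close>. If \<open>p\<close> divided
  \<open>Y\<close> and \<open>Z\<close>, then the sum and the difference of the factors would vanish
  modulo \<open>p\<close>, which forces \<open>p\<close> to divide 2.\<close>

lemma nonsingular_solution_dvd_first:
  assumes p: "prime p" "p \<noteq> 2" and a: "p dvd a" and b: "\<not> p dvd b" and c: "\<not> p dvd c" and h: "p dvd h ^ 2 + b * c"
  shows "nonsingular_solution p a b c n"
proof -
  let ?m = "8 * n + (a + b + c)"
  obtain Y Z where YZ: "p dvd b * Y ^ 2 + c * Z ^ 2 - ?m" "p dvd 2 * b * Y - (1 + b * ?m)" "p dvd 2 * h * Z - (b * ?m - 1)"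
    by (rule split_form_solution[OF p b c h, of 1 "b * ?m" ?m]) auto
  have "p dvd a * 0 ^ 2 + b * Y ^ 2 + c * Z ^ 2 - ?m" using YZ(1) by simp
  then show ?thesis
  proof (rule nonsingular_solutionI[OF p])
    show "\<not> (p dvd b * Y \<and> p dvd c * Z)"
    proof
      assume "p dvd b * Y \<and> p dvd c * Z"
      then have "p dvd Y" "p dvd Z" using p b c by (auto simp: prime_dvd_mult_iff)
      then have "p dvd 1 + b * ?m" "p dvd b * ?m - 1" using YZ(2,3)
        by (metis dvd_diff_commute dvd_mult dvd_diff_right_iff)+
      then have "p dvd (1 + b * ?m) - (b * ?m - 1)" by (rule dvd_diff)
      then show False using odd_prime_not_dvd_2(1)[OF p] by simp
    qed
  qed
qed

text \<open>As \<open>p\<close> divides \<open>b\<close>, nonsingularity has to come from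
  \<open>Z\<close>, that is, the two factors must differ. The factors 1 and \<open>a * ?m\<close> do
  so unless the latter is 1 modulo \<open>p\<close>; then 2 and its inverse are taken, which differ
  because \<open>p\<close> is not 3.\<close>

lemma nonsingular_solution_dvd_second:
  assumes p: "prime p" "p \<noteq> 2" "p \<noteq> 3" and b: "p dvd b" and a: "\<not> p dvd a" and c: "\<not> p dvd c" and h: "p dvd h ^ 2 + a * c"
  shows "nonsingular_solution p a b c n"
proof -
  let ?m = "8 * n + (a + b + c)"
  have "\<exists>s s'. p dvd s * s' - a * ?m \<and> \<not> p dvd s' - s"
  proof (cases "p dvd a * ?m - 1")
    case False
    then show ?thesis by (intro exI[of _ 1] exI[of _ "a * ?m"]) simp
  next
    case True
    obtain t where t: "p dvd 2 * t - 1" using prime_inverse_mod[OF p(1) odd_prime_not_dvd_2(1)[OF p(1,2)]] by blast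
    have "p dvd (2 * t - 1) - (a * ?m - 1)" using t True by (rule dvd_diff)
    moreover have "\<not> p dvd t - 2"
    proof
      assume "p dvd t - 2"
      then have "p dvd (2 * t - 1) - 2 * (t - 2)" by (rule dvd_diff[OF t dvd_mult])
      then have "p dvd 3" by simp
      then show False using p primes_dvd_imp_eq[of p 3] by auto
    qed
    ultimately show ?thesis by (intro exI[of _ 2] exI[of _ t]) simp
  qed
  then obtain s s' where s: "p dvd s * s' - a * ?m" "\<not> p dvd s' - s" by blast
  obtain X Z where XZ: "p dvd a * X ^ 2 + c * Z ^ 2 - ?m" "p dvd 2 * h * Z - (s' - s)"
    using split_form_solution[OF p(1,2) a c h s(1)] by metis
  have "p dvd a * X ^ 2 + b * 0 ^ 2 + c * Z ^ 2 - ?m" using XZ(1) by simp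
  then show ?thesis
  proof (rule nonsingular_solutionI[OF p(1,2)])
    have "\<not> p dvd Z"
    proof
      assume "p dvd Z"
      then have "p dvd 2 * h * Z" by simp
      then have "p dvd 2 * h * Z - (2 * h * Z - (s' - s))" using XZ(2) by (rule dvd_diff)
      then show False using s(2) by simp
    qed
    then show "\<not> (p dvd b * 0 \<and> p dvd c * Z)" using p c by (simp add: prime_dvd_mult_iff)
  qed
qed

text \<open>Modulo 3 the hypotheses force c = -a. A target congruent to \<open>a\<close> is reached
  only with \<open>Z\<close> divisible by 3, which is singular for this special variable but not
  after \<open>a\<close> and \<open>c\<close> trade places. All other targets admit Z = 1.\<close>

lemma nonsingular_solution_3:
  assumes b: "3 dvd b" and a: "\<not> 3 dvd a" and c: "\<not> 3 dvd c" and h: "3 dvd h ^ 2 + a * c"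
  shows "nonsingular_solution 3 a b c n \<or> nonsingular_solution 3 c b a n"
proof -
  have p: "prime (3::int)" "(3::int) \<noteq> 2" by simp_all
  let ?m = "8 * n + (a + b + c)"
  have ac: "3 dvd a + c"
  proof -
    have sq: "x ^ 2 mod 3 = (if 3 dvd x then 0 else 1)" for x :: int
    proof -
      have "x mod 3 = 0 \<or> x mod 3 = 1 \<or> x mod 3 = 2" by presburger
      moreover have "x ^ 2 mod 3 = (x mod 3) ^ 2 mod 3" by (simp add: power_mod)
      ultimately show ?thesis by (elim disjE) (simp_all add: dvd_eq_mod_eq_0)
    qed
    have "3 dvd a + c \<or> 3 dvd c - a" using a c by presburger
    then show ?thesis
    proof
      assume "3 dvd c - a"
      then have "3 dvd h ^ 2 + a * c - a * (c - a)" by (rule dvd_diff[OF h dvd_mult])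
      then have "3 dvd h ^ 2 + a ^ 2" by (simp add: algebra_simps power2_eq_square)
      moreover have "h ^ 2 mod 3 = 0 \<or> h ^ 2 mod 3 = 1" "a ^ 2 mod 3 = 1" using sq[of h] sq[of a] a by simp_all
      moreover have nd: "\<not> 3 dvd x + y" if "x mod 3 = 0 \<or> x mod 3 = 1" "y mod 3 = 1" for x y :: int
      proof -
        have "(x + y) mod 3 = (x mod 3 + y mod 3) mod 3" by (simp only: mod_add_eq)
        then have "(x + y) mod 3 = 1 \<or> (x + y) mod 3 = 2" using that by (elim disjE) simp_all
        then show ?thesis by (simp only: dvd_eq_mod_eq_0) linarith
      qed
      ultimately have False using nd[of "h ^ 2" "a ^ 2"] by simp
      then show ?thesis ..
    qed
  qed
  show ?thesis
  proof (cases "3 dvd ?m - a")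
    case True
    then have "3 dvd c * 0 ^ 2 + b * 0 ^ 2 + a * 1 ^ 2 - (8 * n + (c + b + a))" by (simp add: algebra_simps) presburger
    then have "nonsingular_solution 3 c b a n" by (rule nonsingular_solutionI[OF p]) (use a in simp)
    then show ?thesis ..
  next
    case False
    show ?thesis
    proof (cases "3 dvd ?m")
      case True
      then have "3 dvd a * 1 ^ 2 + b * 0 ^ 2 + c * 1 ^ 2 - ?m" using dvd_diff[OF ac True] by simp
      then have "nonsingular_solution 3 a b c n" by (rule nonsingular_solutionI[OF p]) (use c in simp)
      then show ?thesis ..
    next
      case F: False
      have "3 dvd c - ?m" using False F ac a by presburger
      then have "3 dvd a * 0 ^ 2 + b * 0 ^ 2 + c * 1 ^ 2 - ?m" by simp
      then have "nonsingular_solution 3 a b c n" by (rule nonsingular_solutionI[OF p]) (use c in simp)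
      then show ?thesis ..
    qed
  qed
qed

text \<open>Since 2y + 1 is odd, an odd coefficient is nonsingular at once, and T_0 = 0, T_1 = 1
  provide both parities.\<close>

lemma nonsingular_solution_2:
  assumes "odd b \<or> odd c"
  shows "nonsingular_solution 2 a b c n"
proof -
  have *: "nonsingular_solution 2 a b c n" if b: "odd b" for b c
  proof -
    have t: "triangular 0 = 0" "triangular 1 = 1" by (simp_all add: triangular_def)
    have "even (tri_form a b c 0 (if even n then 0 else 1) 0 - n)" using b by (simp add: tri_form_def t)
    moreover have "odd (b * (2 * y + 1))" for y using b by simp
    ultimately show ?thesis unfolding nonsingular_solution_def by blast
  qed
  show ?thesis using assms *[of b c] *[of c b] nonsingular_solution_swap by blast
qed

text \<open>The condition at \<open>a\<close> in Legendre's theorem on a X^2 + b Y^2 + c Z^2 = 0,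
  read prime by prime; \<open>quad_residue_iff_legendre\<close> links it to the modulus
  \<open>odd_part a\<close>.\<close>

definition legendre :: "int \<Rightarrow> int \<Rightarrow> int \<Rightarrow> bool" where
  "legendre a b c \<longleftrightarrow> (\<forall>p. prime p \<and> p \<noteq> 2 \<and> p dvd a \<longrightarrow> \<not> p dvd b \<and> \<not> p dvd c \<and> (\<exists>h. p dvd h ^ 2 + b * c))"

text \<open>At \<open>p = 2\<close> and at \<open>p = 3\<close> at most one of the three choices of the special variable fails, and at larger
  primes none does; so some choice works everywhere.\<close>
lemma exists_nonsingular_solutions:
  assumes L: "legendre a b c" "legendre b a c" "legendre c a b" and odd: "odd a \<or> odd b \<or> odd c"
  shows "\<exists>(a', b', c') \<in> {(a, b, c), (b, a, c), (c, a, b)}. \<forall>p. prime p \<longrightarrow> nonsingular_solution p a' b' c' n"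
proof -
  have large: "nonsingular_solution p a b c n"
    if p: "prime p" "p \<noteq> 2" "p \<noteq> 3" and L: "legendre a b c" "legendre b a c" "legendre c a b" for p a b c
  proof (cases "p dvd a \<or> p dvd b \<or> p dvd c")
    case False
    then show ?thesis using p nonsingular_solution_generic by blast
  next
    case True
    then show ?thesis
    proof (elim disjE)
      assume a: "p dvd a"
      then show ?thesis using L(1) p nonsingular_solution_dvd_first unfolding legendre_def by blast
    next
      assume b: "p dvd b"
      then show ?thesis using L(2) p nonsingular_solution_dvd_second unfolding legendre_def by blast
    next
      assume c: "p dvd c"
      then have "nonsingular_solution p a c b n" using L(3) p nonsingular_solution_dvd_second unfolding legendre_def by blast
      then show ?thesis by (simp add: nonsingular_solution_swap)
    qed
  qed
  have sw: "legendre a c b \<longleftrightarrow> legendre a b c" for a b c by (auto simp: legendre_def mult.commute)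
  define S where "S p = (nonsingular_solution p a b c n, nonsingular_solution p b a c n, nonsingular_solution p c a b n)" for p
  define maj where "maj = (\<lambda>(x, y, z). (x \<or> y) \<and> (x \<or> z) \<and> (y \<or> z))"
  have S2: "maj (S 2)" using odd nonsingular_solution_2 by (auto simp: S_def maj_def)
  have S3: "maj (S 3)"
  proof -
    have p: "prime (3::int)" "(3::int) \<noteq> 2" by simp_all
    have one: "nonsingular_solution 3 a b c n \<and> (nonsingular_solution 3 b a c n \<or> nonsingular_solution 3 c a b n)"
      if d: "3 dvd a" and l: "legendre a b c" for a b c
    proof -
      obtain h where "\<not> 3 dvd b" "\<not> 3 dvd c" "3 dvd h ^ 2 + b * c" using l[unfolded legendre_def, rule_format, of 3] d p by blast
      then show ?thesis using nonsingular_solution_dvd_first[OF p d] nonsingular_solution_3[OF d] by blast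
    qed
    show ?thesis
    proof (cases "3 dvd a \<or> 3 dvd b \<or> 3 dvd c")
      case False
      then show ?thesis using nonsingular_solution_generic[OF p] by (auto simp: S_def maj_def)
    next
      case True
      then show ?thesis using one[of a b c] one[of b a c] one[of c a b] L nonsingular_solution_swap
        unfolding S_def maj_def by blast
    qed
  qed
  have "(fst (S 2) \<and> fst (S 3)) \<or> (fst (snd (S 2)) \<and> fst (snd (S 3))) \<or> (snd (snd (S 2)) \<and> snd (snd (S 3)))"
    using S2 S3 by (auto simp: maj_def split: prod.splits)
  moreover have s: "nonsingular_solution p a b c n" "nonsingular_solution p b a c n" "nonsingular_solution p c a b n"
    if "prime p" "p \<noteq> 2" "p \<noteq> 3" for p
    using large[OF that L] large[of p b a c] large[of p c a b] that L sw by blast+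
  ultimately have "(\<forall>p. prime p \<longrightarrow> nonsingular_solution p a b c n) \<or> (\<forall>p. prime p \<longrightarrow> nonsingular_solution p b a c n)
      \<or> (\<forall>p. prime p \<longrightarrow> nonsingular_solution p c a b n)"
    (is "?A \<or> ?B \<or> ?C")
    unfolding S_def fst_conv snd_conv
  proof (elim disjE)
    assume "nonsingular_solution 2 a b c n \<and> nonsingular_solution 3 a b c n"
    then have ?A using s by blast
    then show ?thesis ..
  next
    assume "nonsingular_solution 2 b a c n \<and> nonsingular_solution 3 b a c n"
    then have ?B using s by blast
    then show ?thesis by blast
  next
    assume "nonsingular_solution 2 c a b n \<and> nonsingular_solution 3 c a b n"
    then have ?C using s by blast
    then show ?thesis by blast
  qed
  then show ?thesis by simp
qed

section \<open>Gluing local solutions by the Chinese remainder theorem\<close>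

lemma coprime_int_primesI:
  fixes a b :: int
  assumes "\<And>p. prime p \<Longrightarrow> p dvd a \<Longrightarrow> p dvd b \<Longrightarrow> False"
  shows "coprime a b"
proof (rule ccontr)
  assume "\<not> coprime a b"
  then have "\<not> is_unit (gcd a b)" by (simp add: coprime_iff_gcd_eq_1)
  then obtain p where "prime p" "p dvd gcd a b"
    by (metis prime_divisor_exists gcd_eq_0_iff dvd_0_right two_is_prime_nat prime_elem_not_unit prime_int_numeral_eq prime_imp_prime_elem)
  then show False using assms[of p] by simp
qed

text \<open>Squares serve as moduli because the parity of T_x depends on \<open>x\<close> modulo 4;
  at odd primes they do no harm and keep the treatment uniform.\<close>

lemma crt_prime_squares:
  fixes P :: "nat set" and u :: "nat \<Rightarrow> int"
  assumes "finite P" "\<And>p. p \<in> P \<Longrightarrow> prime p"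
  obtains x where "x \<ge> 0" "\<And>p. p \<in> P \<Longrightarrow> int p ^ 2 dvd x - u p"
proof -
  have "\<exists>x. \<forall>p\<in>P. [x = nat (u p mod int p ^ 2)] (mod p ^ 2)"
    by (rule chinese_remainder_nat[OF assms(1)]) (use assms(2) in \<open>auto simp: primes_coprime\<close>)
  then obtain x where x: "\<And>p. p \<in> P \<Longrightarrow> [x = nat (u p mod int p ^ 2)] (mod p ^ 2)" by blast
  have "int p ^ 2 dvd int x - u p" if p: "p \<in> P" for p
  proof -
    have p0: "int p ^ 2 > 0" using assms(2)[OF p] prime_gt_0_nat by simp
    have "[int x = int (nat (u p mod int p ^ 2))] (mod int (p ^ 2))" using x[OF p] by (simp only: cong_int_iff)
    also have "int (nat (u p mod int p ^ 2)) = u p mod int p ^ 2" using p0 by simp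
    finally have "[int x = u p] (mod int p ^ 2)" by (simp add: Cong.cong_def)
    then show ?thesis by (simp add: cong_iff_dvd_diff)
  qed
  then show ?thesis using that[of "int x"] by simp
qed

lemma prod_primes_dvd:
  fixes P :: "nat set" and E :: int
  assumes "finite P" "\<And>p. p \<in> P \<Longrightarrow> prime p" "\<And>p. p \<in> P \<Longrightarrow> int p dvd E"
  shows "(\<Prod>p\<in>P. int p) dvd E"
  using assms
proof (induction P rule: finite_induct)
  case (insert p P)
  have "coprime (int p) (\<Prod>p\<in>P. int p)"
    by (rule prod_coprime_right) (use insert in \<open>auto intro: primes_coprime\<close>)
  then show ?case using insert by (simp add: divides_mult)
qed simp

lemma triangular_cong_prime:
  fixes p x x' :: int
  assumes p: "prime p" and d: "p ^ 2 dvd x - x'"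
  shows "p dvd triangular x - triangular x'"
proof -
  have "2 * (triangular x - triangular x') = (x - x') * (x + x' + 1)"
    using two_times_triangular[of x] two_times_triangular[of x'] by (simp add: algebra_simps)
  then have e: "p ^ 2 dvd 2 * (triangular x - triangular x')" using d by simp
  show ?thesis
  proof (cases "p = 2")
    case True
    then have "2 * 2 dvd 2 * (triangular x - triangular x')" using e by (simp add: power2_eq_square)
    then have "2 dvd triangular x - triangular x'" by (simp only: dvd_mult_cancel_left) simp
    then show ?thesis using True by simp
  next
    case False
    have "p dvd 2 * (triangular x - triangular x')" using e by (metis dvd_mult_left power2_eq_square)
    then show ?thesis using odd_prime_not_dvd_2(1)[OF p False] p by (metis prime_dvd_multD)
  qed
qed

definition primes_upto :: "nat \<Rightarrow> nat set" where "primes_upto K = {p. prime p \<and> p \<le> K}"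

definition primorial :: "nat \<Rightarrow> int" where "primorial K = (\<Prod>p\<in>primes_upto K. int p)"

lemma finite_primes_upto [simp]: "finite (primes_upto K)"
  by (rule finite_subset[of _ "{..K}"]) (auto simp: primes_upto_def)

lemma primorial_pos: "primorial K > 0"
  unfolding primorial_def by (rule prod_pos) (auto simp: primes_upto_def prime_gt_0_nat)

lemma nat_in_primes_upto:
  fixes p :: int
  assumes "prime p" "p \<le> int K"
  shows "nat p \<in> primes_upto K" "int (nat p) = p"
proof -
  have "prime (nat p)" using assms(1) prime_int_nat_transfer by blast
  then show "nat p \<in> primes_upto K" using assms(2) by (simp add: primes_upto_def)
  show "int (nat p) = p" using assms(1) prime_gt_0_int[of p] by simp
qed

lemma prime_dvd_primorial:
  fixes p :: int
  assumes "prime p" "p \<le> int K"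
  shows "p dvd primorial K"
proof -
  have "int (nat p) dvd primorial K"
    unfolding primorial_def using nat_in_primes_upto(1)[OF assms] by (intro dvd_prodI) auto
  then show ?thesis unfolding nat_in_primes_upto(2)[OF assms] .
qed

lemma prime_dvd_primorialD:
  fixes p :: int
  assumes "prime p" "p dvd primorial K"
  shows "p \<le> int K"
proof -
  obtain r where r: "r \<in> primes_upto K" "p dvd int r"
    using assms unfolding primorial_def by (subst (asm) prime_dvd_prod_iff) auto
  then have "r > 0" by (simp add: primes_upto_def prime_gt_0_nat)
  then have "p \<le> int r" using r(2) zdvd_imp_le by simp
  then show ?thesis using r(1) by (simp add: primes_upto_def)
qed

text \<open>Nonnegative representatives make the linear coefficients a(2x + 1), b(2y + 1), c(2z + 1)
  of the resulting ternary form positive.\<close>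

lemma common_solution:
  assumes sol: "\<And>p. prime p \<Longrightarrow> nonsingular_solution p a b c n"
  obtains x y z where "x \<ge> 0" "y \<ge> 0" "z \<ge> 0" "primorial K dvd tri_form a b c x y z - n"
    "\<And>p. prime p \<Longrightarrow> p \<le> int K \<Longrightarrow> \<not> (p dvd b * (2 * y + 1) \<and> p dvd c * (2 * z + 1))"
proof -
  have "\<forall>p. \<exists>x y z. prime p \<longrightarrow> p dvd tri_form a b c x y z - n \<and> \<not> (p dvd b * (2 * y + 1) \<and> p dvd c * (2 * z + 1))"
    using sol unfolding nonsingular_solution_def by blast
  then obtain X Y Z where XYZ: "\<And>p. prime p \<Longrightarrow> p dvd tri_form a b c (X p) (Y p) (Z p) - n
      \<and> \<not> (p dvd b * (2 * Y p + 1) \<and> p dvd c * (2 * Z p + 1))" by metis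
  let ?P = "primes_upto K"
  have pr: "prime p" if "p \<in> ?P" for p using that by (simp add: primes_upto_def)
  obtain x where x: "x \<ge> 0" "\<And>p. p \<in> ?P \<Longrightarrow> int p ^ 2 dvd x - X (int p)"
    using crt_prime_squares[of ?P "\<lambda>p. X (int p)"] pr by auto
  obtain y where y: "y \<ge> 0" "\<And>p. p \<in> ?P \<Longrightarrow> int p ^ 2 dvd y - Y (int p)"
    using crt_prime_squares[of ?P "\<lambda>p. Y (int p)"] pr by auto
  obtain z where z: "z \<ge> 0" "\<And>p. p \<in> ?P \<Longrightarrow> int p ^ 2 dvd z - Z (int p)"
    using crt_prime_squares[of ?P "\<lambda>p. Z (int p)"] pr by auto
  have "primorial K dvd tri_form a b c x y z - n" unfolding primorial_def
  proof (rule prod_primes_dvd)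
    fix p assume p: "p \<in> ?P"
    then have ip: "prime (int p)" using pr by simp
    have "int p dvd a * (triangular x - triangular (X (int p))) + b * (triangular y - triangular (Y (int p)))
        + c * (triangular z - triangular (Z (int p))) + (tri_form a b c (X (int p)) (Y (int p)) (Z (int p)) - n)"
      using x(2)[OF p] y(2)[OF p] z(2)[OF p] XYZ[OF ip] triangular_cong_prime[OF ip] by (intro dvd_add dvd_mult) auto
    then show "int p dvd tri_form a b c x y z - n" by (simp add: tri_form_def algebra_simps)
  qed (use pr in auto)
  moreover have "\<not> (p dvd b * (2 * y + 1) \<and> p dvd c * (2 * z + 1))" if p: "prime p" "p \<le> int K" for p
  proof -
    have np: "nat p \<in> ?P" "int (nat p) = p" using nat_in_primes_upto[OF p] by blast+
    have "p dvd y - Y p" "p dvd z - Z p" using y(2)[OF np(1)] z(2)[OF np(1)] unfolding np(2)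
      by (metis dvd_mult_left power2_eq_square)+
    then have yz: "[y = Y p] (mod p)" "[z = Z p] (mod p)" by (simp_all add: cong_iff_dvd_diff)
    have "[b * (2 * y + 1) = b * (2 * Y p + 1)] (mod p)" "[c * (2 * z + 1) = c * (2 * Z p + 1)] (mod p)"
      by (intro cong_mult cong_add cong_refl yz)+
    then show ?thesis using XYZ[OF p(1)] by (simp add: cong_dvd_iff)
  qed
  ultimately show ?thesis using that x(1) y(1) z(1) by blast
qed

text \<open>Take for \<open>f\<close> the product of the primes up to \<open>K\<close> that do not
  divide \<beta>. Modulo each prime up to \<open>K\<close> exactly one of \<beta> and f\<gamma>
  vanishes, so the sum is a unit.\<close>

lemma coprime_combination:
  assumes "\<And>p. prime p \<Longrightarrow> p \<le> int K \<Longrightarrow> \<not> (p dvd \<beta> \<and> p dvd \<gamma>)" and K: "K \<ge> 2"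
  obtains f where "coprime (\<beta> + f * \<gamma>) (2 * primorial K)"
proof -
  define f where "f = (\<Prod>p\<in>{p \<in> primes_upto K. \<not> int p dvd \<beta>}. int p)"
  have "coprime (\<beta> + f * \<gamma>) (2 * primorial K)"
  proof (rule coprime_int_primesI)
    fix p :: int
    assume p: "prime p" "p dvd \<beta> + f * \<gamma>" "p dvd 2 * primorial K"
    have "p \<le> int K"
    proof (cases "p dvd 2")
      case True
      then show ?thesis using zdvd_imp_le[of p 2] K by simp
    next
      case False
      then show ?thesis using p prime_dvd_primorialD by (simp add: prime_dvd_mult_iff)
    qed
    show False
    proof (cases "p dvd \<beta>")
      case True
      then have "p dvd f * \<gamma>" using p(2) by (simp add: dvd_add_right_iff)
      moreover have "\<not> p dvd \<gamma>" using assms(1)[OF p(1) \<open>p \<le> int K\<close>] True by blast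
      ultimately have "p dvd f" using p(1) by (simp add: prime_dvd_mult_iff)
      then obtain r where r: "r \<in> primes_upto K" "\<not> int r dvd \<beta>" "p dvd int r"
        using p(1) unfolding f_def by (subst (asm) prime_dvd_prod_iff) auto
      then have "p = int r" using p(1) primes_dvd_imp_eq[of p "int r"] by (simp add: primes_upto_def)
      then show False using r True by simp
    next
      case False
      have np: "nat p \<in> primes_upto K" "int (nat p) = p" using nat_in_primes_upto[OF p(1) \<open>p \<le> int K\<close>] by blast+
      then have "int (nat p) dvd f" unfolding f_def using False by (intro dvd_prodI) auto
      then have "p dvd f * \<gamma>" using np by simp
      then have "p dvd \<beta>" using p(2) by (simp add: dvd_add_left_iff)
      then show False using False by simp
    qed
  qed
  then show ?thesis by (rule that)
qed

section \<open>From residue classes to asymptotic density\<close>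

lemma triangular_shift: "triangular (x + 2 * q * i) = triangular x + q * ((2 * x + 1) * i + 2 * q * i ^ 2)"
proof -
  have "2 * triangular (x + 2 * q * i) = 2 * (triangular x + q * ((2 * x + 1) * i + 2 * q * i ^ 2))"
    using two_times_triangular[of x] two_times_triangular[of "x + 2 * q * i"]
    by (simp add: algebra_simps power2_eq_square)
  then show ?thesis by simp
qed

text \<open>Every n in the class of \<open>n0\<close> is F + q m, where F is the value at the common
  solution, and it is represented as soon as m is a value of \<open>ternary_form\<close>. The
  numbers below F enter only the constant.\<close>

lemma class_exceptional_le:
  fixes a b c n0 :: int and K :: nat
  assumes abc: "a > 0" "b > 0" "c > 0" and K: "K \<ge> 2" "a \<le> K" "b \<le> K" "c \<le> K"
    and sol: "\<And>p. prime p \<Longrightarrow> nonsingular_solution p a b c n0"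
  shows "\<exists>F. \<forall>\<^sub>F N in sequentially.
    real (card {n \<in> exceptional_set (tri_form a b c). n \<le> N \<and> primorial K dvd int n - n0}) \<le> F + 16 / K * (N / primorial K + 1)"
proof -
  define q where "q = primorial K"
  have q0: "q > 0" by (simp add: q_def primorial_pos)
  obtain x y z where xyz: "x \<ge> 0" "y \<ge> 0" "z \<ge> 0" "q dvd tri_form a b c x y z - n0"
    and ns: "\<And>p. prime p \<Longrightarrow> p \<le> int K \<Longrightarrow> \<not> (p dvd b * (2 * y + 1) \<and> p dvd c * (2 * z + 1))"
    unfolding q_def using common_solution[OF sol] by metis
  obtain f where f: "coprime (b * (2 * y + 1) + f * (c * (2 * z + 1))) (2 * q)"
    unfolding q_def using coprime_combination[OF ns K(1)] by blast
  interpret ternary "2 * q * a" "2 * q * b" "2 * q * c" "a * (2 * x + 1)" "b * (2 * y + 1)" "c * (2 * z + 1)" "2 * q" f "int K"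
  proof
    \<comment> \<open>As \<open>a\<close>, \<open>b\<close>, \<open>c\<close> are at most
      \<open>K\<close>, all their prime factors divide \<open>2 * q\<close>; this is why
      \<open>K\<close> has to dominate the coefficients.\<close>
    show "coprime u (2 * (2 * q * a) * (2 * q * b) * (2 * q * c))" if u: "coprime u (2 * q)" for u
    proof -
      have small: "coprime u w" if "w > 0" "w \<le> int K" for w
      proof (rule coprime_int_primesI)
        fix p :: int assume p: "prime p" "p dvd u" "p dvd w"
        then have "p \<le> int K" using zdvd_imp_le[of p w] that by simp
        then have "p dvd 2 * q" using p prime_dvd_primorial by (simp add: q_def)
        then show False using u p by (meson coprime_common_divisor not_prime_unit)
      qed
      have "coprime u 2" using u by simp
      then have "coprime u (2 ^ 4)" by (simp only: coprime_power_right_iff simp_thms)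
      then have "coprime u 16" by simp
      then show ?thesis using u small[of a] small[of b] small[of c] abc K by simp
    qed
    show "d > int K" if d: "d > 1" "coprime d (2 * q)" for d
    proof (rule ccontr)
      assume nd: "\<not> d > int K"
      obtain p where p: "prime p" "p dvd d" using prime_divisor_exists[of d] d by auto
      then have "p \<le> int K" using zdvd_imp_le[of p d] d nd by simp
      then have "p dvd 2 * q" using p prime_dvd_primorial by (simp add: q_def)
      then show False using d p by (meson coprime_common_divisor not_prime_unit)
    qed
  qed (use q0 abc xyz f K in auto)
  define F where "F = tri_form a b c x y z"
  have "triangular u \<ge> 0" if "u \<ge> 0" for u using that by (simp add: triangular_def pos_imp_zdiv_nonneg_iff)
  then have F0: "F \<ge> 0" using abc xyz by (simp add: F_def tri_form_def)
  have rep: "tri_form a b c (x + 2 * q * i) (y + 2 * q * j) (z + 2 * q * k) = F + q * ternary_form (i, j, k)" for i j k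
    unfolding F_def tri_form_def triangular_shift ternary_form_def quad_def split_conv
    by (simp add: algebra_simps power2_eq_square)
  let ?E = "exceptional_set (tri_form a b c)"
  have sub: "card {n \<in> ?E. n \<le> N \<and> q dvd int n - n0} \<le> nat F + card (missing 0 (int (N div nat q + 1)))" for N
  proof -
    let ?h = "\<lambda>m. nat (F + q * m)"
    have "{n \<in> ?E. n \<le> N \<and> q dvd int n - n0} \<subseteq> {..<nat F} \<union> ?h ` missing 0 (int (N div nat q + 1))"
    proof
      fix n assume n: "n \<in> {n \<in> ?E. n \<le> N \<and> q dvd int n - n0}"
      show "n \<in> {..<nat F} \<union> ?h ` missing 0 (int (N div nat q + 1))"
      proof (cases "int n < F")
        case False
        have "q dvd (int n - n0) - (F - n0)" using n xyz(4) unfolding F_def by (blast intro: dvd_diff)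
        then obtain m where "(int n - n0) - (F - n0) = q * m" by (elim dvdE)
        then have m: "int n = F + q * m" by simp
        have "q * m \<ge> 0" using m False by simp
        then have m0: "m \<ge> 0" using q0 by (simp add: zero_le_mult_iff)
        have "q * m \<le> int N" using m F0 n by simp
        then have "(q * m) div q \<le> int N div q" using q0 by (rule zdiv_mono1)
        then have "m \<le> int N div q" using q0 by simp
        also have "int N div q = int (N div nat q)" using q0 by (simp add: zdiv_int)
        finally have "m < int (N div nat q + 1)" by simp
        moreover have "m \<notin> range ternary_form"
        proof
          assume "m \<in> range ternary_form"
          then obtain i j k where "m = ternary_form (i, j, k)" by auto
          then have "tri_form a b c (x + 2 * q * i) (y + 2 * q * j) (z + 2 * q * k) = int n" using rep m by simp
          then show False using n unfolding exceptional_set_def by blast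
        qed
        ultimately have "m \<in> missing 0 (int (N div nat q + 1))" using m0 by (simp add: missing_def)
        moreover have "n = ?h m" using m by simp
        ultimately show ?thesis by blast
      next
        case True
        then have "n < nat F" by simp
        then show ?thesis by blast
      qed
    qed
    then have "card {n \<in> ?E. n \<le> N \<and> q dvd int n - n0} \<le> card ({..<nat F} \<union> ?h ` missing 0 (int (N div nat q + 1)))"
      by (intro card_mono) auto
    also have "\<dots> \<le> card {..<nat F} + card (?h ` missing 0 (int (N div nat q + 1)))" by (rule card_Un_le)
    also have "card (?h ` missing 0 (int (N div nat q + 1))) \<le> card (missing 0 (int (N div nat q + 1)))" by (intro card_image_le) simp
    finally show ?thesis by simp
  qed
  obtain M0 where M0: "\<And>M. M \<ge> M0 \<Longrightarrow> real (card (missing 0 (int M))) \<le> 16 / int K * M"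
    using eventually_card_missing_le unfolding eventually_sequentially by blast
  have "\<forall>\<^sub>F N in sequentially.
    real (card {n \<in> ?E. n \<le> N \<and> q dvd int n - n0}) \<le> real_of_int F + 16 / K * (N / q + 1)"
    using eventually_ge_at_top[of "M0 * nat q"]
  proof eventually_elim
    case (elim N)
    have "M0 \<le> N div nat q" using elim q0 by (simp add: less_eq_div_iff_mult_less_eq)
    then have "real (card (missing 0 (int (N div nat q + 1)))) \<le> 16 / int K * real (N div nat q + 1)" by (intro M0) simp
    also have "\<dots> \<le> 16 / K * (N / q + 1)"
    proof -
      have "real (N div nat q) \<le> real N / real (nat q)" by (rule of_nat_div_le_of_nat)
      then have "real (N div nat q + 1) \<le> N / q + 1" using q0 by simp
      then have "16 / K * real (N div nat q + 1) \<le> 16 / K * (N / q + 1)" by (intro mult_left_mono) simp_all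
      then show ?thesis by simp
    qed
    finally have "real (card (missing 0 (int (N div nat q + 1)))) \<le> 16 / K * (N / q + 1)" .
    moreover have "real (card {n \<in> ?E. n \<le> N \<and> q dvd int n - n0}) \<le> real (nat F + card (missing 0 (int (N div nat q + 1))))"
      using sub[of N] by (simp only: of_nat_le_iff)
    then have "real (card {n \<in> ?E. n \<le> N \<and> q dvd int n - n0}) \<le> F + real (card (missing 0 (int (N div nat q + 1))))"
      using F0 by simp
    ultimately show ?case by linarith
  qed
  then show ?thesis unfolding q_def by blast
qed

lemma exceptional_set_permute:
  "exceptional_set (tri_form b a c) = exceptional_set (tri_form a b c)"
  "exceptional_set (tri_form c a b) = exceptional_set (tri_form a b c)"
proof -
  have "tri_form b a c y x z = tri_form a b c x y z" "tri_form c a b z x y = tri_form a b c x y z" for x y z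
    by (simp_all add: tri_form_def)
  then show "exceptional_set (tri_form b a c) = exceptional_set (tri_form a b c)"
    "exceptional_set (tri_form c a b) = exceptional_set (tri_form a b c)"
    unfolding exceptional_set_def by metis+
qed

text \<open>The special variable may depend on the class \<open>n0\<close>, so the coefficients are
  permuted class by class. The class bounds add up to a proportion 16/K plus a constant, which for
  large N is absorbed in a further 1/K; hence the 17.\<close>

theorem legendre_imp_asymptotically_universal:
  assumes abc: "a > 0" "b > 0" "c > 0" and odd: "odd a \<or> odd b \<or> odd c"
    and L: "legendre a b c" "legendre b a c" "legendre c a b"
  shows "asymptotically_universal (tri_form a b c)"
proof -
  let ?E = "exceptional_set (tri_form a b c)"
  have class_bound: "\<exists>F. \<forall>\<^sub>F N in sequentially.
    real (card {n \<in> ?E. n \<le> N \<and> primorial K dvd int n - n0}) \<le> F + 16 / K * (N / primorial K + 1)"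
    if K: "K \<ge> 2" "a \<le> int K" "b \<le> int K" "c \<le> int K" for n0 and K :: nat
  proof -
    have perm: "exceptional_set (tri_form b a c) = ?E" "exceptional_set (tri_form c a b) = ?E"
      by (rule exceptional_set_permute)+
    from exists_nonsingular_solutions[OF L odd, of n0]
    consider "\<forall>p. prime p \<longrightarrow> nonsingular_solution p a b c n0" | "\<forall>p. prime p \<longrightarrow> nonsingular_solution p b a c n0"
      | "\<forall>p. prime p \<longrightarrow> nonsingular_solution p c a b n0" by auto
    then show ?thesis
    proof cases
      case 1
      then show ?thesis by (intro class_exceptional_le abc K) blast
    next
      case 2
      then show ?thesis unfolding perm(1)[symmetric] by (intro class_exceptional_le abc K) blast
    next
      case 3
      then show ?thesis unfolding perm(2)[symmetric] by (intro class_exceptional_le abc K) blast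
    qed
  qed
  have "(\<lambda>N. real (card {n \<in> ?E. 1 \<le> n \<and> n \<le> N}) / real N) \<longlonglongrightarrow> 0"
  proof (rule tendstoI)
    fix e :: real assume e: "e > 0"
    obtain K0 :: nat where K0: "17 / e < K0" using reals_Archimedean2 by blast
    define K where "K = K0 + nat a + nat b + nat c + 2"
    have K: "K \<ge> 2" "a \<le> int K" "b \<le> int K" "c \<le> int K" by (simp_all add: K_def)
    have "17 / e < real K" using K0 by (simp add: K_def)
    then have Ke: "17 / K < e" using e K(1) by (simp add: field_simps)
    define q where "q = primorial K"
    have q0: "q > 0" by (simp add: q_def primorial_pos)
    have "\<forall>n0. \<exists>F. \<forall>\<^sub>F N in sequentially.
      real (card {n \<in> ?E. n \<le> N \<and> q dvd int n - n0}) \<le> F + 16 / K * (N / q + 1)"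
      unfolding q_def using class_bound[OF K] by blast
    from choice[OF this] obtain F where F: "\<And>n0. \<forall>\<^sub>F N in sequentially.
      real (card {n \<in> ?E. n \<le> N \<and> q dvd int n - n0}) \<le> F n0 + 16 / K * (N / q + 1)" by blast
    have "\<forall>\<^sub>F N in sequentially. \<forall>n0\<in>{0..<q}.
      real (card {n \<in> ?E. n \<le> N \<and> q dvd int n - n0}) \<le> F n0 + 16 / K * (N / q + 1)"
      by (intro eventually_ball_finite ballI F) simp
    then show "\<forall>\<^sub>F N in sequentially. dist (real (card {n \<in> ?E. 1 \<le> n \<and> n \<le> N}) / real N) 0 < e"
      using eventually_gt_at_top[of "nat \<lceil>((\<Sum>n0\<in>{0..<q}. F n0) + 16 / K * q) * K\<rceil>"] eventually_gt_at_top[of 0]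
    proof eventually_elim
      case (elim N)
      have "{n \<in> ?E. 1 \<le> n \<and> n \<le> N} \<subseteq> (\<Union>n0\<in>{0..<q}. {n \<in> ?E. n \<le> N \<and> q dvd int n - n0})"
      proof
        fix n assume n: "n \<in> {n \<in> ?E. 1 \<le> n \<and> n \<le> N}"
        have "int n mod q \<in> {0..<q}" "q dvd int n - int n mod q" using q0 by simp_all
        then show "n \<in> (\<Union>n0\<in>{0..<q}. {n \<in> ?E. n \<le> N \<and> q dvd int n - n0})" using n by blast
      qed
      then have "card {n \<in> ?E. 1 \<le> n \<and> n \<le> N} \<le> card (\<Union>n0\<in>{0..<q}. {n \<in> ?E. n \<le> N \<and> q dvd int n - n0})"
        by (intro card_mono) auto
      also have "\<dots> \<le> (\<Sum>n0\<in>{0..<q}. card {n \<in> ?E. n \<le> N \<and> q dvd int n - n0})" by (intro card_UN_le) simp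
      finally have "real (card {n \<in> ?E. 1 \<le> n \<and> n \<le> N}) \<le> (\<Sum>n0\<in>{0..<q}. real (card {n \<in> ?E. n \<le> N \<and> q dvd int n - n0}))"
        by (simp only: of_nat_le_iff flip: of_nat_sum)
      also have "\<dots> \<le> (\<Sum>n0\<in>{0..<q}. F n0 + 16 / K * (N / q + 1))" using elim(1) by (intro sum_mono) blast
      also have "\<dots> = (\<Sum>n0\<in>{0..<q}. F n0) + real (card {0..<q}) * (16 / K * (N / q + 1))"
        by (simp only: sum.distrib sum_constant)
      also have "real (card {0..<q}) * (16 / K * (N / q + 1)) = 16 / K * q + 16 / K * N"
        using q0 K(1) by (simp add: field_simps)
      also have "(\<Sum>n0\<in>{0..<q}. F n0) + (16 / K * q + 16 / K * N) = (\<Sum>n0\<in>{0..<q}. F n0) + 16 / K * q + 16 / K * N"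
        by simp
      also have "\<dots> < 1 / K * N + 16 / K * N"
      proof -
        have "((\<Sum>n0\<in>{0..<q}. F n0) + 16 / K * q) * K < N" using elim(2) by linarith
        then have "(\<Sum>n0\<in>{0..<q}. F n0) + 16 / K * q < N / K" using K(1) by (simp add: less_divide_eq)
        then show ?thesis by simp
      qed
      also have "\<dots> = 17 / K * N" using K(1) by (simp add: field_simps)
      finally have "real (card {n \<in> ?E. 1 \<le> n \<and> n \<le> N}) / N < 17 / K" using elim(3) by (simp add: divide_less_eq)
      then show ?case using Ke by simp
    qed
  qed
  then show ?thesis unfolding asymptotically_universal_def has_asymptotic_density_def .
qed

section \<open>Necessity of the residue conditions\<close>

text \<open>Up to Dk the class has at least k - 1 positive members, and k - 1 is at least k/2 once k
  is at least 2. So the exceptional proportion is at least 1/(2D) arbitrarily far out.\<close>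

lemma not_asymptotically_universal_if_class_missing:
  fixes D r :: int
  assumes r: "0 \<le> r" "r < D" and miss: "\<And>n. int n mod D = r \<Longrightarrow> n \<in> exceptional_set f"
  shows "\<not> asymptotically_universal f"
proof
  assume "asymptotically_universal f"
  then have "(\<lambda>N. real (card {n \<in> exceptional_set f. 1 \<le> n \<and> n \<le> N}) / real N) \<longlonglongrightarrow> 0"
    by (simp add: asymptotically_universal_def has_asymptotic_density_def)
  moreover have "0 < 1 / (2 * real_of_int D)" using r by simp
  ultimately have "\<forall>\<^sub>F N in sequentially. real (card {n \<in> exceptional_set f. 1 \<le> n \<and> n \<le> N}) / real N < 1 / (2 * real_of_int D)"
    by (rule order_tendstoD(2))
  then obtain N0 where N0: "\<And>N. N \<ge> N0 \<Longrightarrow> real (card {n \<in> exceptional_set f. 1 \<le> n \<and> n \<le> N}) / real N < 1 / (2 * real_of_int D)"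
    unfolding eventually_sequentially by blast
  define k where "k = N0 + 2"
  define N where "N = nat D * k"
  have D1: "nat D \<ge> 1" using r by simp
  then have "1 * k \<le> N" unfolding N_def by (intro mult_right_mono) auto
  then have "N \<ge> N0" by (simp add: k_def)
  have "card {1..<k} \<le> card {n \<in> exceptional_set f. 1 \<le> n \<and> n \<le> N}"
  proof (rule card_inj_on_le[where f = "\<lambda>j. nat r + nat D * j"])
    show "inj_on (\<lambda>j. nat r + nat D * j) {1..<k}" using D1 by (auto intro!: inj_onI)
    show "(\<lambda>j. nat r + nat D * j) ` {1..<k} \<subseteq> {n \<in> exceptional_set f. 1 \<le> n \<and> n \<le> N}"
    proof (rule image_subsetI)
      fix j assume j: "j \<in> {1..<k}"
      have "int (nat r + nat D * j) mod D = r" using r by simp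
      then have "nat r + nat D * j \<in> exceptional_set f" by (rule miss)
      moreover have "1 * 1 \<le> nat D * j" using j D1 by (intro mult_mono) auto
      then have "1 \<le> nat r + nat D * j" by linarith
      moreover have "nat D * (j + 1) \<le> nat D * k" using j by (intro mult_left_mono) auto
      then have "nat r + nat D * j \<le> N" using r by (simp add: N_def)
      ultimately show "nat r + nat D * j \<in> {n \<in> exceptional_set f. 1 \<le> n \<and> n \<le> N}" by simp
    qed
  qed (rule finite_subset[of _ "{..N}"], auto)
  then have "real (k - 1) \<le> real (card {n \<in> exceptional_set f. 1 \<le> n \<and> n \<le> N})" by simp
  then have "real k / 2 \<le> real (card {n \<in> exceptional_set f. 1 \<le> n \<and> n \<le> N})" by (simp add: k_def)
  then have "(real k / 2) / N \<le> real (card {n \<in> exceptional_set f. 1 \<le> n \<and> n \<le> N}) / N" by (rule divide_right_mono) simp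
  also have "\<dots> < 1 / (2 * real_of_int D)" using \<open>N \<ge> N0\<close> by (rule N0)
  finally have "(real k / 2) / N < 1 / (2 * real_of_int D)" .
  moreover have "(real k / 2) / N = 1 / (2 * real_of_int D)"
  proof -
    have "real N = real_of_int D * real k" using r by (simp add: N_def)
    moreover have "real k > 0" "real_of_int D > 0" using r by (simp_all add: k_def)
    ultimately show ?thesis by simp
  qed
  ultimately show False by simp
qed

text \<open>1 and p - 1 have the same square, so the map is not injective on the p residues and
  hence not surjective. This covers the case that \<open>p\<close> divides \<open>e\<close> as
  well.\<close>

lemma exists_nonvalue_square_mod:
  fixes p e :: int
  assumes p: "prime p" "p \<noteq> 2"
  obtains s where "\<And>X. \<not> p dvd e * X ^ 2 - s"
proof -
  have p2: "p > 2" using p prime_ge_2_int[of p] by simp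
  let ?f = "\<lambda>X. (e * X ^ 2) mod p"
  have "?f 1 = ?f (p - 1)"
  proof -
    have "e * (p - 1) ^ 2 - e * 1 ^ 2 = p * (e * (p - 2))" by (simp add: algebra_simps power2_eq_square)
    then show ?thesis by (metis mod_eq_dvd_iff dvd_triv_left)
  qed
  then have "\<not> inj_on ?f {0..<p}" using inj_onD[of ?f "{0..<p}" 1 "p - 1"] p2 by auto
  then have "card (?f ` {0..<p}) \<noteq> card {0..<p}" using eq_card_imp_inj_on by blast
  moreover have "?f ` {0..<p} \<subseteq> {0..<p}" using p2 by auto
  ultimately obtain s where s: "s \<in> {0..<p}" "s \<notin> ?f ` {0..<p}" by (metis subset_antisym subsetI)
  have "\<not> p dvd e * X ^ 2 - s" for X
  proof
    assume "p dvd e * X ^ 2 - s"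
    then have "(e * X ^ 2) mod p = s mod p" by (simp add: mod_eq_dvd_iff)
    also have "s mod p = s" using s(1) by simp
    finally have "?f X = s" .
    moreover have "?f (X mod p) = ?f X" by (metis mod_mult_right_eq power_mod)
    ultimately have "?f (X mod p) = s" by simp
    moreover have "X mod p \<in> {0..<p}" using p2 by simp
    ultimately show False using s(2) by blast
  qed
  then show ?thesis by (rule that)
qed

text \<open>8 is invertible modulo \<open>D\<close>, so \<open>s\<close> corresponds to one class of
  n; if the quadratic form missed \<open>s\<close>, that whole class would be exceptional.\<close>

lemma asymptotically_universal_imp_class_represented:
  fixes D s :: int
  assumes D: "coprime 8 D" "D > 0" and univ: "asymptotically_universal (tri_form a b c)"
  shows "\<exists>x y z. D dvd a * x ^ 2 + b * y ^ 2 + c * z ^ 2 - s"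
proof (rule ccontr)
  assume no: "\<nexists>x y z. D dvd a * x ^ 2 + b * y ^ 2 + c * z ^ 2 - s"
  obtain h where "[8 * h = 1] (mod D)" using cong_solve_coprime_int[OF D(1)] by blast
  then have h: "D dvd 8 * h - 1" by (simp add: cong_iff_dvd_diff)
  define r where "r = (h * (s - (a + b + c))) mod D"
  have r: "0 \<le> r" "r < D" using D by (simp_all add: r_def)
  have "n \<in> exceptional_set (tri_form a b c)" if n: "int n mod D = r" for n
  proof (rule ccontr)
    assume "n \<notin> exceptional_set (tri_form a b c)"
    then obtain x y z where t: "tri_form a b c x y z = int n" by (auto simp: exceptional_set_def)
    have "D dvd int n - h * (s - (a + b + c))" using n by (simp add: r_def mod_eq_dvd_iff)
    then have "D dvd 8 * (int n - h * (s - (a + b + c))) + (8 * h - 1) * (s - (a + b + c))"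
      using h by (intro dvd_add dvd_mult dvd_mult2)
    also have "8 * (int n - h * (s - (a + b + c))) + (8 * h - 1) * (s - (a + b + c)) = 8 * int n - (s - (a + b + c))"
      by (simp add: algebra_simps)
    also have "\<dots> = a * (2 * x + 1) ^ 2 + b * (2 * y + 1) ^ 2 + c * (2 * z + 1) ^ 2 - s"
      unfolding t[symmetric] eight_tri_form by simp
    finally show False using no by blast
  qed
  then have "\<not> asymptotically_universal (tri_form a b c)" by (rule not_asymptotically_universal_if_class_missing[OF r])
  then show False using univ by blast
qed

lemma coprime_8_odd_prime:
  fixes p :: int
  assumes "prime p" "p \<noteq> 2"
  shows "coprime 8 (p ^ k)"
proof -
  have "coprime p 8" using assms(1) odd_prime_not_dvd_2(3)[OF assms] by (rule prime_imp_coprime)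
  then show ?thesis by (simp add: coprime_commute)
qed

text \<open>With two coefficients divisible by \<open>p\<close> the form collapses modulo
  \<open>p\<close> to c Z^2, which misses a residue.\<close>

lemma asymptotically_universal_imp_not_two_dvd:
  assumes univ: "asymptotically_universal (tri_form a b c)" and p: "prime p" "p \<noteq> 2" and a: "p dvd a"
  shows "\<not> p dvd b"
proof
  assume b: "p dvd b"
  obtain s where s: "\<And>X. \<not> p dvd c * X ^ 2 - s" using exists_nonvalue_square_mod[OF p] by blast
  have "coprime 8 p" using coprime_8_odd_prime[OF p, of 1] by simp
  then obtain x y z where "p dvd a * x ^ 2 + b * y ^ 2 + c * z ^ 2 - s"
    using asymptotically_universal_imp_class_represented[OF _ _ univ] prime_gt_0_int[OF p(1)] by blast
  then have "p dvd (a * x ^ 2 + b * y ^ 2 + c * z ^ 2 - s) - (a * x ^ 2 + b * y ^ 2)"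
    by (rule dvd_diff) (use a b in simp)
  then show False using s[of z] by simp
qed

text \<open>Aim at p s, where s is not of the form a1 X^2 modulo \<open>p\<close>. If -bc is a
  nonresidue, then b y^2 + c z^2 vanishes modulo \<open>p\<close> only when \<open>p\<close> divides
  y and z. Modulo p^2 the target must then come from a x^2 alone, which makes s a value of a1
  X^2.\<close>

lemma asymptotically_universal_imp_residue:
  assumes univ: "asymptotically_universal (tri_form a b c)" and p: "prime p" "p \<noteq> 2" and a: "p dvd a"
    and b: "\<not> p dvd b" and c: "\<not> p dvd c"
  shows "\<exists>h. p dvd h ^ 2 + b * c"
proof (rule ccontr)
  assume no: "\<nexists>h. p dvd h ^ 2 + b * c"
  obtain a1 where a1: "a = p * a1" using a by (elim dvdE)
  obtain s where s: "\<And>X. \<not> p dvd a1 * X ^ 2 - s" using exists_nonvalue_square_mod[OF p] by blast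
  have p0: "p > 0" using prime_gt_0_int[OF p(1)] .
  obtain x y z where d: "p ^ 2 dvd a * x ^ 2 + b * y ^ 2 + c * z ^ 2 - p * s"
    using asymptotically_universal_imp_class_represented[OF coprime_8_odd_prime[OF p, of 2] zero_less_power[OF p0] univ, of "p * s"] by blast
  then have "p dvd a * x ^ 2 + b * y ^ 2 + c * z ^ 2 - p * s" by (metis dvd_mult_left power2_eq_square)
  then have "p dvd (a * x ^ 2 + b * y ^ 2 + c * z ^ 2 - p * s) - p * (a1 * x ^ 2 - s)" by (rule dvd_diff) simp
  then have yz: "p dvd b * y ^ 2 + c * z ^ 2" by (simp add: a1 algebra_simps)
  have z: "p dvd z"
  proof (rule ccontr)
    assume "\<not> p dvd z"
    then obtain w where w: "p dvd z * w - 1" using prime_inverse_mod[OF p(1)] by blast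
    \<comment> \<open>An inverse \<open>w\<close> of \<open>z\<close> would turn b y w into a square
      root of -bc modulo \<open>p\<close>.\<close>
    have "(b * y * w) ^ 2 + b * c = (b * w ^ 2) * (b * y ^ 2 + c * z ^ 2) - (z * w - 1) * (b * c * (z * w + 1))"
      by (simp add: algebra_simps power2_eq_square)
    also have "p dvd \<dots>" by (rule dvd_diff[OF dvd_mult[OF yz] dvd_mult2[OF w]])
    finally show False using no by blast
  qed
  then have "p dvd c * z ^ 2" by (simp add: power2_eq_square)
  then have "p dvd b * y ^ 2" using yz by (simp add: dvd_add_left_iff)
  then have y: "p dvd y" using p(1) b by (metis prime_dvd_multD prime_dvd_power)
  have "p ^ 2 dvd b * y ^ 2" "p ^ 2 dvd c * z ^ 2" using y z by (simp_all add: dvd_power_same)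
  then have "p ^ 2 dvd (a * x ^ 2 + b * y ^ 2 + c * z ^ 2 - p * s) - (b * y ^ 2 + c * z ^ 2)"
    by (intro dvd_diff[OF d] dvd_add)
  then have "p * p dvd p * (a1 * x ^ 2 - s)" by (simp add: a1 power2_eq_square algebra_simps)
  then have "p dvd a1 * x ^ 2 - s" using p0 by simp
  then show False using s by blast
qed

theorem asymptotically_universal_imp_legendre:
  assumes univ: "asymptotically_universal (tri_form a b c)"
  shows "legendre a b c"
  unfolding legendre_def
proof (intro allI impI)
  fix p assume p: "prime p \<and> p \<noteq> 2 \<and> p dvd a"
  have "tri_form a b c x y z = tri_form a c b x z y" for x y z by (simp add: tri_form_def)
  then have "exceptional_set (tri_form a c b) = exceptional_set (tri_form a b c)" unfolding exceptional_set_def by metis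
  then have univ': "asymptotically_universal (tri_form a c b)" using univ by (simp add: asymptotically_universal_def)
  have "\<not> p dvd b" "\<not> p dvd c"
    using asymptotically_universal_imp_not_two_dvd[OF univ] asymptotically_universal_imp_not_two_dvd[OF univ'] p by blast+
  then show "\<not> p dvd b \<and> \<not> p dvd c \<and> (\<exists>h. p dvd h ^ 2 + b * c)"
    using asymptotically_universal_imp_residue[OF univ] p by blast
qed

text \<open>Split off one prime, m = p k. If \<open>p\<close> divides k, a root modulo k is lifted
  by a Hensel step; otherwise roots modulo \<open>p\<close> and modulo k are glued.\<close>

lemma square_residue_lift:
  fixes m u :: int
  assumes "m > 0" and "\<And>p. prime p \<Longrightarrow> p dvd m \<Longrightarrow> p \<noteq> 2 \<and> \<not> p dvd u \<and> (\<exists>h. p dvd h ^ 2 - u)"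
  shows "\<exists>y. m dvd y ^ 2 - u"
  using assms
proof (induction "nat m" arbitrary: m rule: less_induct)
  case less
  show ?case
  proof (cases "m = 1")
    case False
    then obtain p where p: "prime p" "p dvd m" using prime_divisor_exists[of m] less.prems(1) by auto
    obtain k where k: "m = p * k" using p(2) by (elim dvdE)
    have p2: "p \<ge> 2" using prime_ge_2_int p by blast
    then have k0: "k > 0" using k less.prems(1) by (simp add: zero_less_mult_iff)
    have "k < m" using k k0 p2 by simp
    then have "nat k < nat m" using k0 by simp
    moreover have "r \<noteq> 2 \<and> \<not> r dvd u \<and> (\<exists>h. r dvd h ^ 2 - u)" if "prime r" "r dvd k" for r
      using that k by (intro less.prems(2)) auto
    ultimately obtain y where y: "k dvd y ^ 2 - u" using less.hyps k0 by blast
    have pu: "p \<noteq> 2" "\<not> p dvd u" using less.prems(2)[OF p] by blast+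
    obtain h where h: "p dvd h ^ 2 - u" using less.prems(2)[OF p] by blast
    show ?thesis
    proof (cases "p dvd k")
      case True
      obtain e where e: "y ^ 2 - u = k * e" using y by (elim dvdE)
      have "\<not> p dvd y"
      proof
        assume "p dvd y"
        then have "p dvd y ^ 2" by (simp add: power2_eq_square)
        then have "p dvd y ^ 2 - (y ^ 2 - u)" by (rule dvd_diff) (use e True in simp)
        then show False using pu by simp
      qed
      then have "\<not> p dvd 2 * y" using p odd_prime_not_dvd_2(1)[OF p(1) pu(1)] by (simp add: prime_dvd_mult_iff)
      then obtain v where v: "p dvd (2 * y) * v - 1" using prime_inverse_mod[OF p(1)] by blast
      \<comment> \<open>Chosen so that e + 2yt vanishes modulo \<open>p\<close>; the remaining term
        k t^2 does so because \<open>p\<close> divides \<open>k\<close>.\<close>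
      define t where "t = - e * v"
      have "(y + k * t) ^ 2 - u = k * (k * t ^ 2 - e * ((2 * y) * v - 1))"
      proof -
        have "(y + k * t) ^ 2 - u = (y ^ 2 - u) + k * (2 * y * t + k * t ^ 2)" by (simp add: algebra_simps power2_eq_square)
        then show ?thesis unfolding e by (simp add: t_def algebra_simps)
      qed
      moreover have "p dvd k * t ^ 2 - e * ((2 * y) * v - 1)"
        by (rule dvd_diff[OF dvd_mult2[OF True] dvd_mult[OF v]])
      ultimately have "m dvd (y + k * t) ^ 2 - u" unfolding k by (simp add: mult.commute mult_dvd_mono)
      then show ?thesis by blast
    next
      case False
      then have cop: "coprime p k" using p(1) prime_imp_coprime by blast
      obtain x where x: "[x = h] (mod p)" "[x = y] (mod k)" using binary_chinese_remainder_int[OF cop] by blast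
      have "[x ^ 2 = u] (mod p)" "[x ^ 2 = u] (mod k)"
        using cong_trans[OF cong_pow[OF x(1), of 2]] cong_trans[OF cong_pow[OF x(2), of 2]] h y
        by (simp_all add: cong_iff_dvd_diff)
      then have "p * k dvd x ^ 2 - u" using cop by (simp add: cong_iff_dvd_diff divides_mult)
      then show ?thesis using k by blast
    qed
  qed simp
qed

lemma odd_part_properties:
  assumes "a > 0"
  shows "odd_part a > 0" "odd (odd_part a)" "odd_part a dvd a"
    "\<And>p. prime p \<Longrightarrow> p \<noteq> 2 \<Longrightarrow> p dvd a \<Longrightarrow> p dvd odd_part a"
proof -
  have e: "a = 2 ^ multiplicity 2 a * odd_part a" by (simp add: odd_part_def multiplicity_dvd)
  then have "0 < 2 ^ multiplicity 2 a * odd_part a" using assms by simp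
  then show "odd_part a > 0" by (simp add: zero_less_mult_iff)
  show "odd (odd_part a)" unfolding odd_part_def using assms by (intro multiplicity_decompose) auto
  show "odd_part a dvd a" by (metis e dvd_triv_right)
  fix p :: int assume p: "prime p" "p \<noteq> 2" "p dvd a"
  have "\<not> p dvd 2 ^ multiplicity 2 a" using odd_prime_not_dvd_2(1)[OF p(1,2)] p(1) prime_dvd_power by blast
  moreover have "p dvd 2 ^ multiplicity 2 a * odd_part a" using p(3) e by simp
  ultimately show "p dvd odd_part a" using p(1) by (metis prime_dvd_multD)
qed

text \<open>Both coprimality to \<open>odd_part a\<close> and solvability of the congruence can be
  tested on prime factors, the latter by \<open>square_residue_lift\<close>.\<close>

lemma quad_residue_iff_legendre:
  assumes a: "a > 0"
  shows "quad_residue (- (b * c)) (odd_part a) \<longleftrightarrow> legendre a b c"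
proof
  assume q: "quad_residue (- (b * c)) (odd_part a)"
  then have cop: "coprime (- (b * c)) (odd_part a)" by (simp add: quad_residue_def coprime_iff_gcd_eq_1)
  obtain y where y: "odd_part a dvd y ^ 2 + b * c"
    using q by (auto simp: quad_residue_def QuadRes_def cong_iff_dvd_diff)
  show "legendre a b c" unfolding legendre_def
  proof (intro allI impI)
    fix p assume p: "prime p \<and> p \<noteq> 2 \<and> p dvd a"
    then have po: "p dvd odd_part a" using odd_part_properties(4)[OF a] by blast
    have "\<not> p dvd b * c"
    proof
      assume "p dvd b * c"
      then have "p dvd - (b * c)" by simp
      then show False using cop po p by (meson coprime_common_divisor not_prime_unit)
    qed
    moreover have "p dvd y ^ 2 + b * c" using po y by (rule dvd_trans)
    ultimately show "\<not> p dvd b \<and> \<not> p dvd c \<and> (\<exists>h. p dvd h ^ 2 + b * c)" by auto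
  qed
next
  assume L: "legendre a b c"
  have facts: "p \<noteq> 2 \<and> \<not> p dvd - (b * c) \<and> (\<exists>h. p dvd h ^ 2 - - (b * c))" if p: "prime p" "p dvd odd_part a" for p
  proof -
    have p2: "p \<noteq> 2" using odd_part_properties(2)[OF a] p(2) by auto
    moreover have "p dvd a" using p(2) odd_part_properties(3)[OF a] by (rule dvd_trans)
    ultimately have "\<not> p dvd b \<and> \<not> p dvd c \<and> (\<exists>h. p dvd h ^ 2 + b * c)" using L p(1) unfolding legendre_def by blast
    then show ?thesis using p2 p(1) by (simp add: prime_dvd_mult_iff)
  qed
  have "coprime (- (b * c)) (odd_part a)" using facts by (intro coprime_int_primesI) blast
  moreover have "\<exists>y. odd_part a dvd y ^ 2 - - (b * c)"
    using facts by (intro square_residue_lift odd_part_properties(1)[OF a])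
  ultimately show "quad_residue (- (b * c)) (odd_part a)"
    by (simp add: quad_residue_def QuadRes_def cong_iff_dvd_diff coprime_iff_gcd_eq_1)
qed

theorem theorem1p3:
  fixes a b c :: int
  assumes "a > 0" and "b > 0" and "c > 0"
    and "gcd a (gcd b c) = 1"
  shows "asymptotically_universal (tri_form a b c) \<longleftrightarrow>
    quad_residue (- (b * c)) (odd_part a) \<and>
    quad_residue (- (a * c)) (odd_part b) \<and>
    quad_residue (- (a * b)) (odd_part c)"
proof -
  \<comment> \<open>One odd coefficient gives nonsingular solutions at 2 for at least two of the
    three choices of the special variable.\<close>
  have odd: "odd a \<or> odd b \<or> odd c"
  proof (rule ccontr)
    assume "\<not> ?thesis"
    then have "2 dvd gcd a (gcd b c)" by simp
    then show False using assms(4) by simp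
  qed
  have perm: "asymptotically_universal (tri_form b a c) \<longleftrightarrow> asymptotically_universal (tri_form a b c)"
    "asymptotically_universal (tri_form c a b) \<longleftrightarrow> asymptotically_universal (tri_form a b c)"
    unfolding asymptotically_universal_def by (simp_all only: exceptional_set_permute(1)[of b a c] exceptional_set_permute(2)[of c a b])
  have "asymptotically_universal (tri_form a b c) \<longleftrightarrow> legendre a b c \<and> legendre b a c \<and> legendre c a b"
    using legendre_imp_asymptotically_universal[OF assms(1-3) odd] asymptotically_universal_imp_legendre perm by blast
  then show ?thesis using assms by (simp add: quad_residue_iff_legendre)
qed

end
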